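(* Let $X=\mathcal U/K$ be a Hurwitz surface of genus $14$, where $K$ is the torsion-free kernel of an epimorphism from the triangle group $\Gamma(2,3,7)=\langle x,y\mid x^2=y^3=(xy)^7=1\rangle$ onto $\mathrm{PSL}(2,13)$, so that $\mathrm{PSL}(2,13)$ acts as a group of automorphisms of $X$ and $X$ carries a regular map of type $\{7,3\}$. Then the edge-centres of this map (the points of $X$ fixed by elements of order $2$ of $\mathrm{PSL}(2,13)$) are Weierstrass points of $X$.
   Context: $\mathcal U$ is the upper half-plane. For $p\in X$ the gaps at $p$ are the $g$ integers $1=\gamma_1<\dots<\gamma_g<2g$ such that no meromorphic function on $X$ has a pole of order exactly $\gamma_j$ at $p$ and is holomorphic elsewhere; the weight is $w_p=\sum_{i=1}^g(\gamma_i-i)$ and $p$ is a Weierstrass point if $w_p\ne0$. *)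

theory Defs
  imports "HOL-Complex_Analysis.Complex_Analysis" "HOL-Algebra.Coset"
begin

section \<open>The Fuchsian triangle group Gamma(2,3,7) acting on the upper half-plane\<close>

definition upper_half_plane :: "complex set" where
  "upper_half_plane = {z. Im z > 0}"

text \<open>Action of a real 2x2 matrix of determinant 1 on the upper half-plane by a Moebius map.\<close>
definition mob_act :: "real^2^2 \<Rightarrow> complex \<Rightarrow> complex" where
  "mob_act M z = (of_real (M$1$1) * z + of_real (M$1$2)) / (of_real (M$2$1) * z + of_real (M$2$2))"

definition mtrace :: "real^2^2 \<Rightarrow> real" where
  "mtrace M = M$1$1 + M$2$2"

definition mdet :: "real^2^2 \<Rightarrow> real" where
  "mdet M = M$1$1 * M$2$2 - M$1$2 * M$2$1"

text \<open>Matrices x, y in SL(2,R) whose images in PSL(2,R) are the standard generators of the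
  (2,3,7) triangle group: elliptic elements with rotation angles pi, 2pi/3, and xy of
  rotation angle 2pi/7 (trace characterisation, determining the pair up to conjugacy).\<close>
definition triangle_237_gens :: "real^2^2 \<Rightarrow> real^2^2 \<Rightarrow> bool" where
  "triangle_237_gens x y \<longleftrightarrow> mdet x = 1 \<and> mdet y = 1 \<and> mtrace x = 0 \<and> mtrace y = 1
     \<and> mtrace (x ** y) = 2 * cos (pi / 7)"

inductive_set gen_mat :: "real^2^2 \<Rightarrow> real^2^2 \<Rightarrow> (real^2^2) set" for x y where
  gx: "x \<in> gen_mat x y"
| gy: "y \<in> gen_mat x y"
| gmul: "A \<in> gen_mat x y \<Longrightarrow> B \<in> gen_mat x y \<Longrightarrow> A ** B \<in> gen_mat x y"

text \<open>The (lift to SL(2,R) of the) group generated by x and y, as a group record.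
  The triangle group Gamma(2,3,7) is its image in PSL(2,R); -I = x**x lies in it.\<close>
definition tri_group :: "real^2^2 \<Rightarrow> real^2^2 \<Rightarrow> (real^2^2) monoid" where
  "tri_group x y = \<lparr>carrier = gen_mat x y, mult = (**), one = mat 1\<rparr>"

section \<open>The group PSL(2,13)\<close>

type_synonym m13 = "int \<times> int \<times> int \<times> int"

fun mmul13 :: "m13 \<Rightarrow> m13 \<Rightarrow> m13" where
  "mmul13 (a,b,c,d) (e,f,g,h) =
     ((a*e+b*g) mod 13, (a*f+b*h) mod 13, (c*e+d*g) mod 13, (c*f+d*h) mod 13)"

fun mneg13 :: "m13 \<Rightarrow> m13" where
  "mneg13 (a,b,c,d) = ((-a) mod 13, (-b) mod 13, (-c) mod 13, (-d) mod 13)"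

definition SL2_13 :: "m13 set" where
  "SL2_13 = {(a,b,c,d). a \<in> {0..12} \<and> b \<in> {0..12} \<and> c \<in> {0..12} \<and> d \<in> {0..12}
                        \<and> (a*d - b*c) mod 13 = 1}"

text \<open>PSL(2,13) = SL(2,13)/{+I,-I}; elements are the classes {M, -M}.\<close>
definition PSL2_13 :: "m13 set monoid" where
  "PSL2_13 = \<lparr>carrier = {{M, mneg13 M} | M. M \<in> SL2_13},
              mult = (\<lambda>A B. (\<lambda>(M,N). mmul13 M N) ` (A \<times> B)),
              one = {(1,0,0,1), (12,0,0,12)}\<rparr>"

section \<open>Meromorphic functions on X = U/K, gaps and Weierstrass points\<close>

text \<open>f (a function on U) represents a meromorphic function on U/K which has a pole of order
  exactly n at the point [p] and is holomorphic elsewhere.  Since K is torsion free, the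
  coordinate z of U is a local coordinate of X at every point.\<close>
definition pole_exactly_at :: "(real^2^2) set \<Rightarrow> complex \<Rightarrow> nat \<Rightarrow> (complex \<Rightarrow> complex) \<Rightarrow> bool" where
  "pole_exactly_at K p n f \<longleftrightarrow>
     f meromorphic_on upper_half_plane
     \<and> (\<forall>k\<in>K. \<forall>z\<in>upper_half_plane. f (mob_act k z) = f z)
     \<and> is_pole f p \<and> zorder f p = - int n
     \<and> (\<forall>z\<in>upper_half_plane. (\<forall>k\<in>K. z \<noteq> mob_act k p) \<longrightarrow> \<not> is_pole f z)"

definition gaps :: "(real^2^2) set \<Rightarrow> complex \<Rightarrow> nat set" where
  "gaps K p = {n. n \<ge> 1 \<and> \<not> (\<exists>f. pole_exactly_at K p n f)}"

text \<open>Weight w_p = sum_{i=1}^g (gamma_i - i), gamma_1 < ... < gamma_g the gaps.\<close>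
definition weierstrass_weight :: "(real^2^2) set \<Rightarrow> complex \<Rightarrow> int" where
  "weierstrass_weight K p =
     (\<Sum>i=1..card (gaps K p). int (sorted_list_of_set (gaps K p) ! (i - 1)) - int i)"

definition weierstrass_point :: "(real^2^2) set \<Rightarrow> complex \<Rightarrow> bool" where
  "weierstrass_point K p \<longleftrightarrow> weierstrass_weight K p \<noteq> 0"

end

theory Submission
  imports Defs "HOL-Library.Numeral_Type" "HOL-Number_Theory.Cong"
begin

text \<open>The centralizer of an involution T in PSL(2,13) is dihedral of order 12, so T fixes six points of X;
  four besides p are enough. If p were not a Weierstrass point, its gaps would be 1, ..., m. Choose an odd
  n among m + 1, m + 2 and a function with a pole of order n at p only; subtracting its composition with T
  makes it a T-anti-invariant function f, which vanishes to odd order at the other fixed points.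
  For an anti-invariant u, the requirement that u / f has no pole off p therefore amounts to at most
  (n - 5) / 2 linear conditions. Hence some combination of anti-invariant functions with poles of order n + 2 t
  at p, t = 1, ..., (n - 3) / 2, satisfies them, and u / f has a pole of even order at most
  n - 3 < m + 1 at p, contradicting the gaps.

  The function theory rests on Poincare series of weight 24 with poles on one orbit: a quotient of two of them
  descends to X, and counting linear conditions shows that there are finitely many gaps and that a function
  has no more zeros than poles.

  The group theory is arithmetic. The triangle group lies in the group of norm 1 units of a quaternion order over
  Z[2 cos(pi/7)] that is definite at the two other real places, so the 12 integer coordinates of an
  element are bounded by its norm, which makes the Poincare series converge. The epimorphism is
  reduction modulo a prime above 13, so for k in K some sign e makes the norm of 2 - e tr k divisible by 169;
  for elliptic k this norm is below 64.\<close>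

section \<open>Moebius transformations\<close>

text \<open>The counts are inequalities, valid for an unspecified number m of gaps; n <= m + 2 is
  all that links n to it. The bound of zeros by poles comes from the powers f^M: the finitely many
  extra conditions that turn a form into a function are the same for all M, so they become
  negligible.

  An epimorphism is a priori an abstract map. It is a reduction because lifts X, Y of the images of
  x, y to SL(2,13) can be chosen with the traces 0 and 1 of x and y and with (XY)^7 = -1, which
  makes the trace of XY a root modulo 13 of the cubic of 2 cos(pi/7). Products of 1, x, y, xy and of
  1, X, Y, XY then follow the same multiplication table, and the same coordinates describe an
  element and its image. The cubic has three roots modulo 13, one for each prime above 13, and the
  three are treated alike.

  The square 169 arises because a norm is quadratic in the coordinates of k - e, each divisible by
  the prime. The weight 24 is twice 12: each of the 12 integer coordinates contributes a factor of
  square decay.\<close>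

no_notation fps_nth (infixl "$" 75)

lemma matrix_mult_22:
  fixes A B :: "real^2^2"
  shows "(A ** B)$1$1 = A$1$1 * B$1$1 + A$1$2 * B$2$1" "(A ** B)$1$2 = A$1$1 * B$1$2 + A$1$2 * B$2$2"
    "(A ** B)$2$1 = A$2$1 * B$1$1 + A$2$2 * B$2$1" "(A ** B)$2$2 = A$2$1 * B$1$2 + A$2$2 * B$2$2"
  by (simp_all add: matrix_matrix_mult_def sum_2)

lemma mat_eq_22_iff:
  fixes A B :: "real^2^2"
  shows "A = B \<longleftrightarrow> A$1$1 = B$1$1 \<and> A$1$2 = B$1$2 \<and> A$2$1 = B$2$1 \<and> A$2$2 = B$2$2"
  by (auto simp: vec_eq_iff forall_2)

lemma mat_1_22 [simp]:
  "(mat 1 :: real^2^2)$1$1 = 1" "(mat 1 :: real^2^2)$1$2 = 0"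
  "(mat 1 :: real^2^2)$2$1 = 0" "(mat 1 :: real^2^2)$2$2 = 1"
  by (simp_all add: mat_def)

lemma mdet_mult: "mdet (A ** B) = mdet A * mdet B"
  by (simp add: mdet_def matrix_mult_22 algebra_simps)

text \<open>The adjugate is the inverse at determinant 1; explicit entries let an equation such as
  \<open>madj A = A\<close> be read off entry by entry.\<close>

definition madj :: "real^2^2 \<Rightarrow> real^2^2" where
  "madj A = (\<chi> i j. if i = j then (if i = 1 then A$2$2 else A$1$1) else - A$i$j)"

lemma madj_nth [simp]:
  "madj A $1$1 = A$2$2" "madj A $1$2 = - A$1$2" "madj A $2$1 = - A$2$1" "madj A $2$2 = A$1$1"
  by (simp_all add: madj_def)

lemma madj_mult: "mdet A = 1 \<Longrightarrow> madj A ** A = mat 1" "mdet A = 1 \<Longrightarrow> A ** madj A = mat 1"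
  by (simp_all add: mat_eq_22_iff matrix_mult_22 mdet_def algebra_simps)

lemma mdet_madj [simp]: "mdet (madj A) = mdet A"
  by (simp add: mdet_def mult.commute)

text \<open>The factor of automorphy: \<open>mden_mult\<close> is its cocycle relation, and the
  derivative of \<open>mob_act M\<close> at z is 1 / (mden M z)^2.\<close>

definition mden :: "real^2^2 \<Rightarrow> complex \<Rightarrow> complex" where
  "mden M z = of_real (M$2$1) * z + of_real (M$2$2)"

definition mnum :: "real^2^2 \<Rightarrow> complex \<Rightarrow> complex" where
  "mnum M z = of_real (M$1$1) * z + of_real (M$1$2)"

lemma mob_act_alt: "mob_act M z = mnum M z / mden M z"
  by (simp add: mob_act_def mnum_def mden_def)

text \<open>The common source of the nonvanishing of \<open>mden\<close> and of the formula for the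
  imaginary part of an image point.\<close>

lemma Im_mult_cnj_num_den: "Im (mnum M z * cnj (mden M z)) = mdet M * Im z"
  by (simp add: mnum_def mden_def mdet_def algebra_simps)

lemma mden_nonzero:
  assumes "mdet M = 1" "Im z > 0" shows "mden M z \<noteq> 0"
  using Im_mult_cnj_num_den[of M z] assms by auto

lemma Im_mob_act:
  assumes "mdet M = 1" "Im z > 0" shows "Im (mob_act M z) = Im z / (cmod (mden M z))^2"
  unfolding mob_act_alt complex_div_cnj[of "mnum M z"]
  using Im_mult_cnj_num_den[of M z] assms by (simp flip: of_real_power)

lemma mob_act_in_U:
  assumes "mdet M = 1" "z \<in> upper_half_plane" shows "mob_act M z \<in> upper_half_plane"
  using assms mden_nonzero[of M z] by (simp add: upper_half_plane_def Im_mob_act)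

lemma mden_mult:
  assumes "mdet B = 1" "Im z > 0"
  shows "mden (A ** B) z = mden A (mob_act B z) * mden B z"
  using mden_nonzero[OF assms]
  by (simp add: mob_act_alt mden_def[of A] mden_def[of "A ** B"] matrix_mult_22 field_simps)
     (simp add: mden_def mnum_def algebra_simps)

lemma mnum_mult:
  assumes "mdet B = 1" "Im z > 0"
  shows "mnum (A ** B) z = mnum A (mob_act B z) * mden B z"
  using mden_nonzero[OF assms]
  by (simp add: mob_act_alt mnum_def[of A] mnum_def[of "A ** B"] matrix_mult_22 field_simps)
     (simp add: mden_def mnum_def algebra_simps)

lemma mob_act_mult:
  assumes "mdet B = 1" "Im z > 0"
  shows "mob_act (A ** B) z = mob_act A (mob_act B z)"
  unfolding mob_act_alt[of "A ** B"] mden_mult[OF assms] mnum_mult[OF assms]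
  using mden_nonzero[OF assms] by (simp add: mob_act_alt[of A])

lemma mob_act_1 [simp]: "mob_act (mat 1) z = z"
  by (simp add: mob_act_def)

lemma mob_act_minus_1 [simp]: "mob_act (- mat 1) z = z"
  by (simp add: mob_act_def)

lemma mob_act_madj:
  assumes "mdet B = 1" "Im z > 0"
  shows "mob_act (madj B) (mob_act B z) = z" "mob_act B (mob_act (madj B) z) = z"
  using assms by (simp_all flip: mob_act_mult add: madj_mult)

lemma open_upper_half_plane: "open upper_half_plane"
  unfolding upper_half_plane_def using open_halfspace_Im_gt[of 0] by simp

lemma connected_upper_half_plane: "connected upper_half_plane"
  unfolding upper_half_plane_def
  using convex_halfspace_Im_gt[of 0] convex_connected by fastforce

lemma mob_act_has_derivative:
  assumes "mdet M = 1" "Im z > 0"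
  shows "(mob_act M has_field_derivative 1 / (mden M z)^2) (at z)"
proof -
  have nz: "of_real (M$2$1) * z + of_real (M$2$2) \<noteq> (0::complex)"
    using mden_nonzero[OF assms] by (simp add: mden_def)
  have d: "of_real (M$1$1) * of_real (M$2$2) - of_real (M$1$2) * of_real (M$2$1) = (1::complex)"
    using assms(1) unfolding mdet_def by (metis of_real_1 of_real_diff of_real_mult)
  show ?thesis
    unfolding mob_act_def mden_def
  proof (rule DERIV_cong)
    show "((\<lambda>z. (of_real (M$1$1) * z + of_real (M$1$2)) / (of_real (M$2$1) * z + of_real (M$2$2)))
      has_field_derivative
       (of_real (M$1$1) * (of_real (M$2$1) * z + of_real (M$2$2)) -
        (of_real (M$1$1) * z + of_real (M$1$2)) * of_real (M$2$1)) /
       ((of_real (M$2$1) * z + of_real (M$2$2)) * (of_real (M$2$1) * z + of_real (M$2$2)))) (at z)"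
      by (intro DERIV_divide nz) (auto intro!: derivative_eq_intros)
    have "of_real (M$1$1) * (of_real (M$2$1) * z + of_real (M$2$2)) -
        (of_real (M$1$1) * z + of_real (M$1$2)) * of_real (M$2$1) = (1::complex)"
      using d by (simp add: algebra_simps)
    thus "(of_real (M$1$1) * (of_real (M$2$1) * z + of_real (M$2$2)) -
        (of_real (M$1$1) * z + of_real (M$1$2)) * of_real (M$2$1)) /
       ((of_real (M$2$1) * z + of_real (M$2$2)) * (of_real (M$2$1) * z + of_real (M$2$2)))
       = 1 / (of_real (M$2$1) * z + of_real (M$2$2))\<^sup>2"
      by (simp add: power2_eq_square)
  qed
qed

lemma mob_act_analytic:
  assumes "mdet M = 1" shows "mob_act M analytic_on upper_half_plane"
  unfolding analytic_on_open[OF open_upper_half_plane]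
  by (rule holomorphic_onI)
     (use mob_act_has_derivative[OF assms] in
       \<open>auto simp: upper_half_plane_def field_differentiable_def intro: has_field_derivative_at_within\<close>)

lemma mden_analytic: "mden M analytic_on A"
  unfolding mden_def by (intro analytic_intros)

lemma mob_act_inj:
  assumes "mdet M = 1" "Im z > 0" "Im w > 0" "mob_act M z = mob_act M w" shows "z = w"
  using mob_act_madj(1)[OF assms(1,2)] mob_act_madj(1)[OF assms(1,3)] assms(4) by metis

lemma filterlim_mob_act_at:
  assumes "mdet M = 1" "z \<in> upper_half_plane"
  shows "filterlim (mob_act M) (at (mob_act M z)) (at z)"
proof -
  have z: "Im z > 0" using assms by (simp add: upper_half_plane_def)
  have "mob_act M \<midarrow>z\<rightarrow> mob_act M z"
    using mob_act_has_derivative[OF assms(1) z] DERIV_isCont isCont_def by blast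
  moreover have "\<forall>\<^sub>F w in at z. w \<in> upper_half_plane \<and> w \<noteq> z"
    using eventually_at_in_open[OF open_upper_half_plane assms(2)] by (auto elim: eventually_mono)
  hence "\<forall>\<^sub>F w in at z. mob_act M w \<noteq> mob_act M z"
    by eventually_elim (use mob_act_inj[OF assms(1) _ z] in \<open>auto simp: upper_half_plane_def\<close>)
  ultimately show ?thesis by (simp add: filterlim_at)
qed

text \<open>An equality of filters, stronger than a limit, transports eventual statements along the
  map in both directions. The inverse map \<open>madj M\<close> supplies the second
  inclusion.\<close>

lemma filtermap_mob_act_at:
  assumes "mdet M = 1" "z \<in> upper_half_plane"
  shows "filtermap (mob_act M) (at z) = at (mob_act M z)"
proof (rule antisym)
  show "filtermap (mob_act M) (at z) \<le> at (mob_act M z)"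
    using filterlim_mob_act_at[OF assms] by (simp add: filterlim_def)
  have z: "Im z > 0" using assms by (simp add: upper_half_plane_def)
  have "filterlim (mob_act (madj M)) (at z) (at (mob_act M z))"
    using filterlim_mob_act_at[of "madj M" "mob_act M z"] assms mob_act_in_U[OF assms]
      mob_act_madj(1)[OF assms(1) z] by simp
  hence "filtermap (mob_act M) (filtermap (mob_act (madj M)) (at (mob_act M z))) \<le> filtermap (mob_act M) (at z)"
    by (intro filtermap_mono) (simp add: filterlim_def)
  moreover have "filtermap (mob_act M) (filtermap (mob_act (madj M)) (at (mob_act M z))) = at (mob_act M z)"
  proof -
    have "\<forall>\<^sub>F w in at (mob_act M z). w \<in> upper_half_plane"
      using eventually_at_in_open'[OF open_upper_half_plane mob_act_in_U[OF assms]] .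
    hence "\<forall>\<^sub>F w in at (mob_act M z). mob_act M (mob_act (madj M) w) = w"
      by eventually_elim (use mob_act_madj(2)[OF assms(1)] in \<open>auto simp: upper_half_plane_def\<close>)
    thus ?thesis unfolding filtermap_filtermap
      by (intro filter_eqI) (auto simp: eventually_filtermap elim: eventually_elim2)
  qed
  ultimately show "at (mob_act M z) \<le> filtermap (mob_act M) (at z)" by simp
qed

section \<open>Laurent expansions\<close>

notation fls_nth (infixl "$$" 75)

text \<open>Orders are measured by \<open>fls_subdegree\<close> of the Laurent series. The zero
  series has subdegree 0, so a bound >= 0 also covers functions vanishing near z, while a negative
  subdegree already implies a nonzero series.\<close>

lemma laurent_has:
  assumes "f meromorphic_on {z}"
  shows "(\<lambda>w. f (z + w)) has_laurent_expansion laurent_expansion f z"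
  using assms by (rule meromorphic_on_imp_has_laurent_expansion) simp

lemma laurent_eq_0_iff:
  assumes "f meromorphic_on {z}"
  shows "laurent_expansion f z = 0 \<longleftrightarrow> (\<forall>\<^sub>F w in at z. f w = 0)"
  using has_laurent_expansion_eventually_zero_iff[OF laurent_has[OF assms]] by simp

lemma laurent_diff:
  assumes "f meromorphic_on {z}" "g meromorphic_on {z}"
  shows "laurent_expansion (\<lambda>w. f w - g w) z = laurent_expansion f z - laurent_expansion g z"
  by (rule laurent_expansion_eqI) (intro laurent_expansion_intros laurent_has assms)

lemma laurent_mult:
  assumes "f meromorphic_on {z}" "g meromorphic_on {z}"
  shows "laurent_expansion (\<lambda>w. f w * g w) z = laurent_expansion f z * laurent_expansion g z"
  by (rule laurent_expansion_eqI) (intro laurent_expansion_intros laurent_has assms)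

lemma laurent_divide:
  assumes "f meromorphic_on {z}" "g meromorphic_on {z}"
  shows "laurent_expansion (\<lambda>w. f w / g w) z = laurent_expansion f z / laurent_expansion g z"
  by (rule laurent_expansion_eqI) (intro laurent_expansion_intros laurent_has assms)

lemma laurent_power:
  assumes "f meromorphic_on {z}"
  shows "laurent_expansion (\<lambda>w. f w ^ n) z = laurent_expansion f z ^ n"
  by (rule laurent_expansion_eqI) (intro laurent_expansion_intros laurent_has assms)

lemma laurent_lincomb_nth:
  assumes "\<And>i. i \<in> I \<Longrightarrow> f i meromorphic_on {z}"
  shows "laurent_expansion (\<lambda>w. \<Sum>i\<in>I. c i * f i w) z $$ n = (\<Sum>i\<in>I. c i * laurent_expansion (f i) z $$ n)"
proof -
  have "laurent_expansion (\<lambda>w. \<Sum>i\<in>I. c i * f i w) z = (\<Sum>i\<in>I. fls_const (c i) * laurent_expansion (f i) z)"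
    by (rule laurent_expansion_eqI) (intro laurent_expansion_intros laurent_has assms)
  thus ?thesis by (simp add: fls_nth_sum)
qed

lemma laurent_is_pole_iff:
  assumes "f meromorphic_on {z}"
  shows "is_pole f z \<longleftrightarrow> fls_subdegree (laurent_expansion f z) < 0"
  using is_pole_fls_subdegree_iff[OF laurent_has[OF assms]] .

lemma laurent_zorder:
  assumes "f meromorphic_on {z}" "laurent_expansion f z \<noteq> 0"
  shows "zorder f z = fls_subdegree (laurent_expansion f z)"
  using has_laurent_expansion_zorder[OF laurent_has[OF assms(1)] assms(2)] .

lemma laurent_analytic_subdegree:
  assumes "f analytic_on {z}"
  shows "fls_subdegree (laurent_expansion f z) \<ge> 0"
  using laurent_is_pole_iff[OF analytic_on_imp_meromorphic_on[OF assms]] analytic_at_imp_no_pole[OF assms]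
  by simp

lemma laurent_analytic_nonzero:
  assumes "f analytic_on {z}" "f z \<noteq> 0"
  shows "laurent_expansion f z \<noteq> 0" "fls_subdegree (laurent_expansion f z) = 0"
proof -
  have m: "f meromorphic_on {z}" using assms(1) by (rule analytic_on_imp_meromorphic_on)
  have ev: "\<forall>\<^sub>F w in at z. f w \<noteq> 0"
    using assms by (rule analytic_at_neq_imp_eventually_neq)
  show nz: "laurent_expansion f z \<noteq> 0"
    using has_laurent_expansion_eventually_nonzero_iff[OF laurent_has[OF m]] ev by simp
  show "fls_subdegree (laurent_expansion f z) = 0"
    using zorder_eq_0I[OF assms] laurent_zorder[OF m nz] by simp
qed

lemma laurent_lead:
  assumes "f meromorphic_on {z}" "laurent_expansion f z \<noteq> 0" "fls_subdegree (laurent_expansion f z) = n"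
  shows "((\<lambda>w. f w * (w - z) powi (-n)) \<longlongrightarrow> laurent_expansion f z $$ n) (at z)"
proof -
  have "(\<lambda>w. f (z + w) * w powi (-n)) has_laurent_expansion laurent_expansion f z * fls_X_intpow (-n)"
    by (intro laurent_expansion_intros laurent_has assms)
  hence "(\<lambda>w. (\<lambda>w. f w * (w - z) powi (-n)) (z + w)) has_laurent_expansion fls_shift n (laurent_expansion f z)"
    by (simp add: fls_shifted_times_simps)
  from has_laurent_expansion_imp_tendsto[OF this] show ?thesis using assms(2,3) by simp
qed

text \<open>Reads off order and leading coefficient from a limit, the form in which compositions and
  Poincare series are understood near a point.\<close>

lemma laurent_lead_conv:
  assumes "f meromorphic_on {z}" "((\<lambda>w. f w * (w - z) powi (-n)) \<longlongrightarrow> c) (at z)" "c \<noteq> 0"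
  shows "laurent_expansion f z \<noteq> 0" "fls_subdegree (laurent_expansion f z) = n"
    "laurent_expansion f z $$ n = c"
proof -
  define F where "F = laurent_expansion f z"
  show nz: "laurent_expansion f z \<noteq> 0"
  proof
    assume "laurent_expansion f z = 0"
    hence "\<forall>\<^sub>F w in at z. f w = 0" using laurent_eq_0_iff assms(1) by simp
    hence "((\<lambda>w. f w * (w - z) powi (-n)) \<longlongrightarrow> 0) (at z)"
      by (intro tendsto_eventually) (auto elim: eventually_mono)
    thus False using assms(2,3) tendsto_unique[OF at_neq_bot] by blast
  qed
  define m where "m = fls_subdegree (laurent_expansion f z)"
  have l: "((\<lambda>w. f w * (w - z) powi (-m)) \<longlongrightarrow> laurent_expansion f z $$ m) (at z)"
    using laurent_lead[OF assms(1) nz] m_def by simp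
  have lnz: "laurent_expansion f z $$ m \<noteq> 0" using nz by (simp add: m_def)
  \<comment> \<open>Both normalisations of f have finite nonzero limits, hence so has their quotient
    (w - z)^(n - m), which forces n = m.\<close>
  have "((\<lambda>w. (f w * (w - z) powi (-m)) / (f w * (w - z) powi (-n))) \<longlongrightarrow> laurent_expansion f z $$ m / c) (at z)"
    by (intro tendsto_divide l assms)
  moreover have "\<forall>\<^sub>F w in at z. f w \<noteq> 0 \<and> w \<noteq> z"
    using has_laurent_expansion_eventually_nonzero_iff[OF laurent_has[OF assms(1)]] nz
    by (auto intro!: eventually_conj simp: eventually_at_filter)
  hence "\<forall>\<^sub>F w in at z. (f w * (w - z) powi (-m)) / (f w * (w - z) powi (-n)) = (w - z) powi (n - m)"
    by eventually_elim (auto simp: power_int_diff power_int_minus field_simps)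
  ultimately have t: "((\<lambda>w. (w - z) powi (n - m)) \<longlongrightarrow> laurent_expansion f z $$ m / c) (at z)"
    by (subst (asm) tendsto_cong) auto
  have nm: "n = m"
  proof (rule ccontr)
    assume "n \<noteq> m"
    then consider "n - m > 0" | "m - n > 0" by linarith
    thus False
    proof cases
      case 1
      have "((\<lambda>w. (w - z) powi (n - m)) \<longlongrightarrow> (z - z) powi (n-m)) (at z)"
        by (rule tendsto_power_int'[OF tendsto_diff[OF tendsto_ident_at tendsto_const]]) (use 1 in auto)
      hence "laurent_expansion f z $$ m / c = 0"
        using tendsto_unique[OF at_neq_bot t] 1 by (simp add: power_int_0_left_if)
      thus False using lnz assms(3) by simp
    next
      case 2
      have "((\<lambda>w. (w - z) powi (m - n)) \<longlongrightarrow> (z - z) powi (m-n)) (at z)"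
        by (rule tendsto_power_int'[OF tendsto_diff[OF tendsto_ident_at tendsto_const]]) (use 2 in auto)
      hence a: "((\<lambda>w. (w - z) powi (m - n)) \<longlongrightarrow> 0) (at z)" using 2 by (simp add: power_int_0_left_if)
      have "((\<lambda>w. (w - z) powi (n - m) * (w - z) powi (m - n)) \<longlongrightarrow> (laurent_expansion f z $$ m / c) * 0) (at z)"
        by (intro tendsto_mult t a)
      moreover have "\<forall>\<^sub>F w in at z. (w - z) powi (n - m) * (w - z) powi (m - n) = 1"
        using eventually_neq_at_within[of z z UNIV]
        by eventually_elim (auto simp flip: power_int_add)
      ultimately have "((\<lambda>w. 1::complex) \<longlongrightarrow> 0) (at z)" by (subst (asm) tendsto_cong) auto
      thus False using tendsto_unique[OF at_neq_bot _ tendsto_const] by force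
    qed
  qed
  thus "fls_subdegree (laurent_expansion f z) = n" using m_def by simp
  show "laurent_expansion f z $$ n = c" using tendsto_unique[OF at_neq_bot l] assms(2) nm by blast
qed

lemma meromorphic_compose_at:
  assumes "f meromorphic_on {g z}" "g analytic_on {z}"
  shows "(\<lambda>w. f (g w)) meromorphic_on {z}"
  by (rule meromorphic_on_compose[OF assms(1,2)]) simp

text \<open>The factor d^n on the coefficient at the order n is what the parity arguments need: for
  d = -1 it is the sign (-1)^n.\<close>

lemma laurent_compose:
  assumes f: "f meromorphic_on {g z}" and g: "g analytic_on {z}"
    and flt: "filtermap g (at z) = at (g z)" and d: "(g has_field_derivative d) (at z)" "d \<noteq> 0"
  shows "laurent_expansion (\<lambda>w. f (g w)) z = 0 \<longleftrightarrow> laurent_expansion f (g z) = 0" (is ?A)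
    and "fls_subdegree (laurent_expansion (\<lambda>w. f (g w)) z) = fls_subdegree (laurent_expansion f (g z))" (is ?B)
    and "fls_subdegree (laurent_expansion f (g z)) = n \<Longrightarrow>
      laurent_expansion (\<lambda>w. f (g w)) z $$ n = d powi n * laurent_expansion f (g z) $$ n"
proof -
  have m: "(\<lambda>w. f (g w)) meromorphic_on {z}" using f g by (rule meromorphic_compose_at)
  show A: ?A
    unfolding laurent_eq_0_iff[OF m] laurent_eq_0_iff[OF f] flt[symmetric] eventually_filtermap ..
  define n where "n = fls_subdegree (laurent_expansion f (g z))"
  have *: "laurent_expansion (\<lambda>w. f (g w)) z \<noteq> 0 \<and> fls_subdegree (laurent_expansion (\<lambda>w. f (g w)) z) = n \<and>
      laurent_expansion (\<lambda>w. f (g w)) z $$ n = d powi n * laurent_expansion f (g z) $$ n"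
    if nz: "laurent_expansion f (g z) \<noteq> 0"
  proof -
    have "((\<lambda>w. f w * (w - g z) powi (-n)) \<longlongrightarrow> laurent_expansion f (g z) $$ n) (filtermap g (at z))"
      unfolding flt by (rule laurent_lead[OF f nz]) (simp add: n_def)
    hence l: "((\<lambda>w. f (g w) * (g w - g z) powi (-n)) \<longlongrightarrow> laurent_expansion f (g z) $$ n) (at z)"
      by (simp add: filterlim_filtermap)
    have "((\<lambda>w. (g w - g z) / (w - z)) \<longlongrightarrow> d) (at z)"
      using d(1) by (simp add: has_field_derivative_iff)
    hence "((\<lambda>w. ((g w - g z) / (w - z)) powi n) \<longlongrightarrow> d powi n) (at z)"
      using d(2) by (intro tendsto_power_int) auto
    from tendsto_mult[OF this l]
    have "((\<lambda>w. ((g w - g z) / (w - z)) powi n * (f (g w) * (g w - g z) powi (-n)))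
        \<longlongrightarrow> d powi n * laurent_expansion f (g z) $$ n) (at z)" .
    moreover have "\<forall>\<^sub>F w in filtermap g (at z). w \<noteq> g z"
      unfolding flt using eventually_neq_at_within[of "g z" "g z" UNIV] by simp
    hence "\<forall>\<^sub>F w in at z. g w \<noteq> g z" by (simp add: eventually_filtermap)
    hence "\<forall>\<^sub>F w in at z. ((g w - g z) / (w - z)) powi n * (f (g w) * (g w - g z) powi (-n))
        = f (g w) * (w - z) powi (-n)"
      by eventually_elim (simp add: power_int_divide_distrib power_int_minus field_simps)
    ultimately have "((\<lambda>w. f (g w) * (w - z) powi (-n)) \<longlongrightarrow> d powi n * laurent_expansion f (g z) $$ n) (at z)"
      by (subst (asm) tendsto_cong) auto
    from laurent_lead_conv[OF m this] show ?thesis using nz d(2) by (simp add: n_def power_int_eq_0_iff)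
  qed
  show ?B using * A n_def by (cases "laurent_expansion f (g z) = 0") auto
  show "laurent_expansion (\<lambda>w. f (g w)) z $$ n = d powi n * laurent_expansion f (g z) $$ n"
    if "fls_subdegree (laurent_expansion f (g z)) = n" for n
    using * A that n_def by (cases "laurent_expansion f (g z) = 0") auto
qed

text \<open>The identity theorem, from the alternative that f either is 0 or avoids 0, each time up
  to a sparse set.\<close>

lemma laurent_zero_propagate:
  assumes "f meromorphic_on A" "open A" "connected A" "z \<in> A" "w \<in> A" "laurent_expansion f z = 0"
  shows "laurent_expansion f w = 0"
proof -
  have m: "f meromorphic_on {u}" if "u \<in> A" for u using assms(1) meromorphic_on_subset that by blast
  have "\<forall>\<^sub>F u in at z. f u = 0" using laurent_eq_0_iff[OF m[OF assms(4)]] assms(6) by simp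
  moreover from this have "\<not> (\<forall>\<^sub>F u in at z. f u \<noteq> 0)"
    using eventually_frequently[OF at_neq_bot, of "\<lambda>u. f u = 0" z] by (simp add: frequently_def)
  ultimately have "eventually (\<lambda>u. f u = 0) (cosparse A)"
    using meromorphic_imp_constant_or_avoid[OF assms(1-3), of 0] assms(2,4)
    by (auto simp: eventually_cosparse_open_eq)
  thus ?thesis
    using laurent_eq_0_iff[OF m[OF assms(5)]] assms(2,5) by (auto simp: eventually_cosparse_open_eq)
qed

lemma sparse_subdegree_nonzero:
  assumes "f meromorphic_on A" "\<And>z. z \<in> A \<Longrightarrow> laurent_expansion f z \<noteq> 0" "open A"
  shows "{z\<in>A. fls_subdegree (laurent_expansion f z) \<noteq> 0} sparse_in A"
proof -
  have "\<forall>\<^sub>F z in cosparse A. z \<in> A" by (rule eventually_in_cosparse) (use assms in auto)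
  hence "\<forall>\<^sub>F z in cosparse A. fls_subdegree (laurent_expansion f z) = 0"
    using meromorphic_on_imp_not_pole_cosparse[OF assms(1)] meromorphic_on_imp_not_zero_cosparse[OF assms(1)]
  proof eventually_elim
    case (elim z)
    have m: "f meromorphic_on {z}" using assms(1) elim(1) meromorphic_on_subset by blast
    show ?case using elim laurent_is_pole_iff[OF m] isolated_zero_fls_subdegree_iff[OF laurent_has[OF m]] by simp
  qed
  hence "{z. fls_subdegree (laurent_expansion f z) \<noteq> 0} sparse_in A" by (simp add: eventually_cosparse)
  thus ?thesis by (rule sparse_in_subset2) auto
qed

lemma underdetermined_homogeneous_system:
  fixes a :: "'j \<Rightarrow> 'i \<Rightarrow> 'a::field"
  assumes "finite I" "finite J" "card J < card I"
  shows "\<exists>c. (\<exists>i\<in>I. c i \<noteq> 0) \<and> (\<forall>j\<in>J. (\<Sum>i\<in>I. c i * a j i) = 0)"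
  using assms(2,1,3)
proof (induction J arbitrary: I a rule: finite_induct)
  case empty
  then obtain i where "i \<in> I" by (metis card.empty card_gt_0_iff ex_in_conv)
  thus ?case by (intro exI[of _ "\<lambda>_. 1"]) auto
next
  case (insert j0 J)
  show ?case
  proof (cases "\<forall>i\<in>I. a j0 i = 0")
    case True
    have "card J < card I" using insert by simp
    from insert.IH[OF insert.prems(1) this, of a] obtain c
      where "(\<exists>i\<in>I. c i \<noteq> 0) \<and> (\<forall>j\<in>J. (\<Sum>i\<in>I. c i * a j i) = 0)" by blast
    thus ?thesis using True by (intro exI[of _ c]) auto
  next
    case False
    then obtain p where p: "p \<in> I" "a j0 p \<noteq> 0" by blast
    define I' where "I' = I - {p}"
    have I': "finite I'" "card J < card I'" "I = insert p I'" "p \<notin> I'"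
      using insert p by (auto simp: I'_def)
    \<comment> \<open>Gaussian elimination: equation j0 is solved for the unknown p and substituted
      into the others.\<close>
    define b where "b = (\<lambda>j i. a j i - a j p * a j0 i / a j0 p)"
    from insert.IH[OF I'(1,2), of b] obtain c where
      c: "\<exists>i\<in>I'. c i \<noteq> 0" "\<And>j. j \<in> J \<Longrightarrow> (\<Sum>i\<in>I'. c i * b j i) = 0" by blast
    define d where "d = c(p := - (\<Sum>i\<in>I'. c i * a j0 i) / a j0 p)"
    have S: "(\<Sum>i\<in>I. d i * a j i) = d p * a j p + (\<Sum>i\<in>I'. c i * a j i)" for j
    proof -
      have "(\<Sum>i\<in>I'. d i * a j i) = (\<Sum>i\<in>I'. c i * a j i)"
        by (rule sum.cong) (use I' in \<open>auto simp: d_def\<close>)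
      thus ?thesis using I' by simp
    qed
    have "(\<Sum>i\<in>I. d i * a j i) = 0" if "j \<in> insert j0 J" for j
    proof (cases "j = j0")
      case True thus ?thesis using p unfolding S by (simp add: d_def)
    next
      case False
      hence "0 = (\<Sum>i\<in>I'. c i * b j i)" using c that by simp
      also have "\<dots> = (\<Sum>i\<in>I'. c i * a j i) - (\<Sum>i\<in>I'. c i * a j0 i) * (a j p / a j0 p)"
        unfolding b_def sum_distrib_right sum_subtractf[symmetric]
        by (rule sum.cong) (auto simp: algebra_simps)
      finally show ?thesis unfolding S by (simp add: d_def field_simps)
    qed
    moreover have "\<exists>i\<in>I. d i \<noteq> 0" using c(1) I' by (auto simp: d_def)
    ultimately show ?thesis by blast
  qed
qed

lemma finite_representatives:
  assumes "\<And>a. a \<in> S \<Longrightarrow> E a a" "\<And>a b. a \<in> S \<Longrightarrow> b \<in> S \<Longrightarrow> E a b \<Longrightarrow> E b a"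
    "\<And>a b c. a \<in> S \<Longrightarrow> b \<in> S \<Longrightarrow> c \<in> S \<Longrightarrow> E a b \<Longrightarrow> E b c \<Longrightarrow> E a c"
  shows "\<exists>R\<subseteq>S. (\<forall>s\<in>S. \<exists>r\<in>R. E s r) \<and> (\<forall>r\<in>R. \<forall>r'\<in>R. E r r' \<longrightarrow> r = r')"
proof -
  \<comment> \<open>The choice depends only on the predicate describing the class, so equivalent
    elements get the same representative.\<close>
  define c where "c = (\<lambda>s. SOME t. t \<in> S \<and> E s t)"
  have c: "c s \<in> S \<and> E s (c s)" if "s \<in> S" for s
    unfolding c_def by (rule someI[of _ s]) (use that assms(1) in auto)
  have eq: "c s = c s'" if "s \<in> S" "s' \<in> S" "E (c s) (c s')" for s s'
  proof -
    have 1: "E s s'" using that c[OF that(1)] c[OF that(2)] assms(2,3) by metis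
    have "E s t \<longleftrightarrow> E s' t" if "t \<in> S" for t
      using 1 that \<open>s \<in> S\<close> \<open>s' \<in> S\<close> assms(2,3) by metis
    hence "(\<lambda>t. t \<in> S \<and> E s t) = (\<lambda>t. t \<in> S \<and> E s' t)" by blast
    thus ?thesis by (simp add: c_def)
  qed
  show ?thesis
  proof (intro exI[of _ "c ` S"] conjI)
    show "c ` S \<subseteq> S" "\<forall>s\<in>S. \<exists>r\<in>c ` S. E s r" using c by blast+
    show "\<forall>r\<in>c ` S. \<forall>r'\<in>c ` S. E r r' \<longrightarrow> r = r'" using eq by blast
  qed
qed

section \<open>Automorphic functions\<close>

text \<open>Automorphy of weight m is asked only near each point, so the values at poles, and at
  zeros of a denominator where division returns 0, do not matter.\<close>

definition autom :: "(real^2^2) set \<Rightarrow> nat \<Rightarrow> (complex \<Rightarrow> complex) \<Rightarrow> bool" where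
  "autom K m f \<longleftrightarrow> f meromorphic_on upper_half_plane \<and>
     (\<forall>k\<in>K. \<forall>z\<in>upper_half_plane. \<forall>\<^sub>F w in at z. f (mob_act k w) = mden k w ^ m * f w)"

lemma meromorphic_atI: "f meromorphic_on A \<Longrightarrow> z \<in> A \<Longrightarrow> f meromorphic_on {z}"
  using meromorphic_on_subset by blast

lemma autom_at: "autom K m f \<Longrightarrow> z \<in> upper_half_plane \<Longrightarrow> f meromorphic_on {z}"
  unfolding autom_def using meromorphic_atI by blast

lemma autom_meromorphic: "autom K m f \<Longrightarrow> f meromorphic_on upper_half_plane"
  unfolding autom_def by blast

lemma autom_lincomb:
  assumes "finite I" "\<And>i. i \<in> I \<Longrightarrow> autom K m (f i)"
  shows "autom K m (\<lambda>w. \<Sum>i\<in>I. c i * f i w)"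
  unfolding autom_def
proof (intro conjI ballI)
  show "(\<lambda>w. \<Sum>i\<in>I. c i * f i w) meromorphic_on upper_half_plane"
    using assms(2) by (intro meromorphic_intros) (auto simp: autom_def)
  fix k z assume "k \<in> K" "z \<in> upper_half_plane"
  hence "\<forall>\<^sub>F w in at z. \<forall>i\<in>I. f i (mob_act k w) = mden k w ^ m * f i w"
    using assms by (intro eventually_ball_finite) (auto simp: autom_def)
  thus "\<forall>\<^sub>F w in at z. (\<Sum>i\<in>I. c i * f i (mob_act k w)) = mden k w ^ m * (\<Sum>i\<in>I. c i * f i w)"
    by eventually_elim (simp add: sum_distrib_left mult_ac)
qed

lemma autom_mult:
  assumes "autom K m f" "autom K n g"
  shows "autom K (m + n) (\<lambda>w. f w * g w)"
  unfolding autom_def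
proof (intro conjI ballI)
  show "(\<lambda>w. f w * g w) meromorphic_on upper_half_plane"
    using assms by (intro meromorphic_intros) (auto simp: autom_def)
  fix k z assume "k \<in> K" "z \<in> upper_half_plane"
  hence "\<forall>\<^sub>F w in at z. f (mob_act k w) = mden k w ^ m * f w" "\<forall>\<^sub>F w in at z. g (mob_act k w) = mden k w ^ n * g w"
    using assms by (auto simp: autom_def)
  thus "\<forall>\<^sub>F w in at z. f (mob_act k w) * g (mob_act k w) = mden k w ^ (m + n) * (f w * g w)"
    by eventually_elim (simp add: power_add)
qed

lemma autom_power:
  assumes "autom K m f"
  shows "autom K (m * n) (\<lambda>w. f w ^ n)"
proof (induction n)
  case 0
  show ?case by (auto simp: autom_def)
next
  case (Suc n)
  from autom_mult[OF assms Suc] show ?case by (simp add: add_ac)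
qed

lemma autom_divide:
  assumes "autom K m f" "autom K m g" "\<And>k. k \<in> K \<Longrightarrow> mdet k = 1"
  shows "autom K 0 (\<lambda>w. f w / g w)"
  unfolding autom_def
proof (intro conjI ballI)
  show "(\<lambda>w. f w / g w) meromorphic_on upper_half_plane"
    using assms by (intro meromorphic_intros) (auto simp: autom_def)
  fix k z assume k: "k \<in> K" and z: "z \<in> upper_half_plane"
  hence "\<forall>\<^sub>F w in at z. f (mob_act k w) = mden k w ^ m * f w" "\<forall>\<^sub>F w in at z. g (mob_act k w) = mden k w ^ m * g w"
    using assms by (auto simp: autom_def)
  moreover have "\<forall>\<^sub>F w in at z. w \<in> upper_half_plane"
    using eventually_at_in_open'[OF open_upper_half_plane z] .
  ultimately show "\<forall>\<^sub>F w in at z. f (mob_act k w) / g (mob_act k w) = mden k w ^ 0 * (f w / g w)"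
  proof eventually_elim
    case (elim w)
    have "mden k w \<noteq> 0" using elim(3) assms(3)[OF k] mden_nonzero by (simp add: upper_half_plane_def)
    thus ?case using elim by simp
  qed
qed

text \<open>K lies in SL(2,R) and contains -1, so torsion-freeness is stated up to sign.
  Discreteness takes the form of summability, with the exponent that \<open>summable_G\<close>
  provides; it becomes the weight of the Poincare series.\<close>

locale fuchsian =
  fixes K :: "(real^2^2) set"
  assumes det_K: "\<And>k. k \<in> K \<Longrightarrow> mdet k = 1"
    and one_K: "mat 1 \<in> K"
    and minus_one_K: "- mat 1 \<in> K"
    and mult_K: "\<And>k l. k \<in> K \<Longrightarrow> l \<in> K \<Longrightarrow> k ** l \<in> K"
    and madj_K: "\<And>k. k \<in> K \<Longrightarrow> madj k \<in> K"
    and torsion_free: "\<And>k z. k \<in> K \<Longrightarrow> z \<in> upper_half_plane \<Longrightarrow> mob_act k z = z \<Longrightarrow> k = mat 1 \<or> k = - mat 1"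
    and summable_K: "(\<lambda>k. 1 / norm k ^ 24) summable_on K"
    and cocompact: "\<exists>C. compact C \<and> C \<subseteq> upper_half_plane \<and> (\<forall>z\<in>upper_half_plane. \<exists>k\<in>K. mob_act k z \<in> C)"
begin

definition eqv :: "complex \<Rightarrow> complex \<Rightarrow> bool" where
  "eqv z w \<longleftrightarrow> (\<exists>k\<in>K. z = mob_act k w)"

lemma U_Im: "z \<in> upper_half_plane \<Longrightarrow> Im z > 0"
  by (simp add: upper_half_plane_def)

lemma K_U: "k \<in> K \<Longrightarrow> z \<in> upper_half_plane \<Longrightarrow> mob_act k z \<in> upper_half_plane"
  using mob_act_in_U det_K by blast

lemma eqv_refl: "eqv z z"
  unfolding eqv_def using one_K by force

lemma eqv_sym: "eqv z w \<Longrightarrow> w \<in> upper_half_plane \<Longrightarrow> eqv w z"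
  unfolding eqv_def using madj_K mob_act_madj(1) det_K U_Im by metis

lemma eqv_trans: "eqv a b \<Longrightarrow> eqv b c \<Longrightarrow> c \<in> upper_half_plane \<Longrightarrow> eqv a c"
  unfolding eqv_def using mult_K mob_act_mult det_K U_Im by metis

lemma autom_laurent:
  assumes "autom K m f" "z \<in> upper_half_plane" "eqv w z"
  shows "laurent_expansion f w = 0 \<longleftrightarrow> laurent_expansion f z = 0"
    "fls_subdegree (laurent_expansion f w) = fls_subdegree (laurent_expansion f z)"
proof -
  obtain k where k: "k \<in> K" "w = mob_act k z" using assms by (auto simp: eqv_def)
  have w: "w \<in> upper_half_plane" using k K_U assms by simp
  have d: "mden k z \<noteq> 0" using mden_nonzero det_K k U_Im assms by blast
  have m: "mden k meromorphic_on {z}" "(\<lambda>w. mden k w ^ m) meromorphic_on {z}"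
    by (rule analytic_on_imp_meromorphic_on analytic_on_power mden_analytic)+
  have n: "laurent_expansion (\<lambda>w. mden k w ^ m) z \<noteq> 0" "fls_subdegree (laurent_expansion (\<lambda>w. mden k w ^ m) z) = 0"
    using laurent_analytic_nonzero[OF analytic_on_power[OF mden_analytic], of k z m] d by auto
  have an: "mob_act k analytic_on {z}"
    using mob_act_analytic[OF det_K[OF k(1)]] assms(2) analytic_on_subset by blast
  have c: "laurent_expansion (\<lambda>w. f (mob_act k w)) z = laurent_expansion (\<lambda>w. mden k w ^ m) z * laurent_expansion f z"
    unfolding laurent_mult[OF m(2) autom_at[OF assms(1,2)], symmetric]
    by (rule laurent_expansion_cong) (use assms k in \<open>auto simp: autom_def\<close>)
  have fm: "f meromorphic_on {mob_act k z}" using autom_at[OF assms(1) w] k by simp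
  have "1 / (mden k z)\<^sup>2 \<noteq> 0" using d by simp
  note L = laurent_compose[OF fm an filtermap_mob_act_at[OF det_K[OF k(1)] assms(2)]
      mob_act_has_derivative[OF det_K[OF k(1)] U_Im[OF assms(2)]] this]
  show A: "laurent_expansion f w = 0 \<longleftrightarrow> laurent_expansion f z = 0"
    using L(1) c n k by simp
  show "fls_subdegree (laurent_expansion f w) = fls_subdegree (laurent_expansion f z)"
    using L(2) c n k A by (cases "laurent_expansion f z = 0") auto
qed

text \<open>A compact set meeting every orbit contains only finitely many zeros and poles. As f is
  any meromorphic function here, the last clause asks for a nonzero order on the whole orbit of z;
  for automorphic f this is a single condition by \<open>autom_laurent\<close>.\<close>

lemma zero_reps:
  assumes "f meromorphic_on upper_half_plane" "\<And>z. z \<in> upper_half_plane \<Longrightarrow> laurent_expansion f z \<noteq> 0"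
  obtains S where "finite S" "S \<subseteq> upper_half_plane"
    "\<And>s. s \<in> S \<Longrightarrow> fls_subdegree (laurent_expansion f s) \<noteq> 0"
    "\<And>z. z \<in> upper_half_plane \<Longrightarrow> (\<And>w. eqv w z \<Longrightarrow> fls_subdegree (laurent_expansion f w) \<noteq> 0) \<Longrightarrow> \<exists>s\<in>S. eqv s z"
proof -
  obtain C where C: "compact C" "C \<subseteq> upper_half_plane" "\<forall>z\<in>upper_half_plane. \<exists>k\<in>K. mob_act k z \<in> C"
    using cocompact by blast
  have "{z\<in>upper_half_plane. fls_subdegree (laurent_expansion f z) \<noteq> 0} sparse_in C"
    using sparse_subdegree_nonzero[OF assms open_upper_half_plane] sparse_in_subset C(2) by blast
  hence fin: "finite (C \<inter> {z\<in>upper_half_plane. fls_subdegree (laurent_expansion f z) \<noteq> 0})"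
    using sparse_in_compact_finite C(1) by blast
  show ?thesis
  proof (rule that[OF fin])
    fix z assume z: "z \<in> upper_half_plane" "\<And>w. eqv w z \<Longrightarrow> fls_subdegree (laurent_expansion f w) \<noteq> 0"
    then obtain k where k: "k \<in> K" "mob_act k z \<in> C" using C(3) by blast
    hence "eqv (mob_act k z) z" by (auto simp: eqv_def)
    thus "\<exists>s\<in>C \<inter> {z\<in>upper_half_plane. fls_subdegree (laurent_expansion f z) \<noteq> 0}. eqv s z"
      using z k C(2) by blast
  qed auto
qed

text \<open>Once singularities are removed, |a| attains its maximum over the half-plane on a compact
  set meeting every orbit, so a is constant by the maximum principle, with value 0 at p.\<close>

lemma autom0_holomorphic_const:
  assumes a: "autom K 0 a" and p: "p \<in> upper_half_plane"
    and reg: "\<And>z. z \<in> upper_half_plane \<Longrightarrow> fls_subdegree (laurent_expansion a z) \<ge> 0"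
    and p0: "laurent_expansion a p $$ 0 = 0"
  shows "laurent_expansion a p = 0"
proof -
  define g where "g = remove_sings a"
  note m = autom_at[OF a]
  have g_an: "g analytic_on {z}" if "z \<in> upper_half_plane" for z
  proof -
    have "a \<midarrow>z\<rightarrow> laurent_expansion a z $$ 0"
      using has_laurent_expansion_imp_tendsto[OF laurent_has[OF m[OF that]] reg[OF that]] .
    moreover have "isolated_singularity_at a z" using m[OF that] by (simp add: meromorphic_at_iff)
    ultimately show ?thesis unfolding g_def by (rule remove_sings_analytic_at[rotated])
  qed
  hence g_hol: "g holomorphic_on upper_half_plane"
    using analytic_imp_holomorphic analytic_on_analytic_at by blast
  have g_inv: "g (mob_act k z) = g z" if "k \<in> K" "z \<in> upper_half_plane" for k z
  proof -
    have "remove_sings (a \<circ> mob_act k) z = remove_sings a (mob_act k z)"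
      by (rule remove_sings_compose) (use filtermap_mob_act_at[OF det_K[OF that(1)] that(2)] in simp)
    moreover have "remove_sings (a \<circ> mob_act k) z = remove_sings a z"
      by (rule remove_sings_cong) (use a that in \<open>auto simp: autom_def\<close>)
    ultimately show ?thesis by (simp add: g_def)
  qed
  have gp: "g p = 0"
    unfolding g_def using has_laurent_expansion_imp_tendsto[OF laurent_has[OF m[OF p]] reg[OF p]] p0
    by (intro remove_sings_eqI) simp
  obtain C where C: "compact C" "C \<subseteq> upper_half_plane" "\<forall>z\<in>upper_half_plane. \<exists>k\<in>K. mob_act k z \<in> C"
    using cocompact by blast
  have "C \<noteq> {}" using C(3) p by blast
  moreover have "continuous_on C (\<lambda>z. norm (g z))"
    using g_hol C(2) by (intro continuous_intros) (meson holomorphic_on_imp_continuous_on continuous_on_subset)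
  ultimately obtain z0 where z0: "z0 \<in> C" "\<forall>z\<in>C. norm (g z) \<le> norm (g z0)"
    using continuous_attains_sup[OF C(1)] by blast
  have "norm (g z) \<le> norm (g z0)" if "z \<in> upper_half_plane" for z
    using C(3) z0(2) g_inv that by metis
  hence "g constant_on upper_half_plane"
    by (intro maximum_modulus_principle[OF g_hol open_upper_half_plane connected_upper_half_plane
          open_upper_half_plane subset_refl, of z0]) (use z0 C in auto)
  hence g0: "g z = 0" if "z \<in> upper_half_plane" for z
    using gp p that by (metis constant_on_def)
  have "\<forall>\<^sub>F w in at p. g w = a w"
    unfolding g_def using eventually_remove_sings_eq_at m[OF p] by (simp add: meromorphic_at_iff)
  moreover have "\<forall>\<^sub>F w in at p. w \<in> upper_half_plane"
    using eventually_at_in_open'[OF open_upper_half_plane p] .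
  ultimately have "\<forall>\<^sub>F w in at p. a w = 0" by eventually_elim (use g0 in auto)
  thus ?thesis using laurent_eq_0_iff[OF m[OF p]] by simp
qed

text \<open>A gap is defined by functions invariant at every single point. Passing to
  \<open>remove_sings\<close>, which takes limits as values, turns invariance near each point into
  invariance at each point and keeps the poles.\<close>

lemma not_gapI:
  assumes a: "autom K 0 a" and p: "p \<in> upper_half_plane" and n: "n \<ge> 1"
    and ap: "fls_subdegree (laurent_expansion a p) = - int n"
    and reg: "\<And>z. z \<in> upper_half_plane \<Longrightarrow> \<not> eqv z p \<Longrightarrow> fls_subdegree (laurent_expansion a z) \<ge> 0"
  shows "n \<notin> gaps K p"
proof -
  define g where "g = remove_sings a"
  note m = autom_at[OF a]
  have iso: "isolated_singularity_at a z" if "z \<in> upper_half_plane" for z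
    using m[OF that] by (simp add: meromorphic_at_iff)
  have "pole_exactly_at K p n g" unfolding pole_exactly_at_def
  proof (intro conjI ballI impI)
    show "g meromorphic_on upper_half_plane"
      unfolding g_def by (intro remove_sings_meromorphic autom_meromorphic[OF a])
    show "g (mob_act k z) = g z" if "k \<in> K" "z \<in> upper_half_plane" for k z
    proof -
      have "remove_sings (a \<circ> mob_act k) z = remove_sings a (mob_act k z)"
        by (rule remove_sings_compose) (use filtermap_mob_act_at[OF det_K[OF that(1)] that(2)] in simp)
      moreover have "remove_sings (a \<circ> mob_act k) z = remove_sings a z"
        by (rule remove_sings_cong) (use a that in \<open>auto simp: autom_def\<close>)
      ultimately show ?thesis by (simp add: g_def)
    qed
    show "is_pole g p" unfolding g_def
      using iso[OF p] laurent_is_pole_iff[OF m[OF p]] ap n by simp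
    have "laurent_expansion a p \<noteq> 0" using ap n by auto
    thus "zorder g p = - int n" unfolding g_def
      using iso[OF p] laurent_zorder[OF m[OF p]] ap by simp
    fix z assume z: "z \<in> upper_half_plane" "\<forall>k\<in>K. z \<noteq> mob_act k p"
    hence "\<not> is_pole a z" using reg[OF z(1)] laurent_is_pole_iff[OF m[OF z(1)]] by (auto simp: eqv_def)
    thus "\<not> is_pole g z" unfolding g_def using iso[OF z(1)] by simp
  qed
  thus ?thesis by (auto simp: gaps_def)
qed

lemma not_gapD:
  assumes p: "p \<in> upper_half_plane" and n: "n \<ge> 1" "n \<notin> gaps K p"
  obtains a where "autom K 0 a" "fls_subdegree (laurent_expansion a p) = - int n"
    "\<And>z. z \<in> upper_half_plane \<Longrightarrow> \<not> eqv z p \<Longrightarrow> fls_subdegree (laurent_expansion a z) \<ge> 0"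
proof -
  obtain f where f: "pole_exactly_at K p n f" using n by (auto simp: gaps_def)
  hence a: "autom K 0 f"
    by (auto simp: autom_def pole_exactly_at_def intro!: eventually_mono[OF eventually_at_in_open'[OF open_upper_half_plane]])
  note m = autom_at[OF a]
  show ?thesis
  proof (rule that[OF a])
    have "is_pole f p" using f by (simp add: pole_exactly_at_def)
    hence "fls_subdegree (laurent_expansion f p) < 0" using laurent_is_pole_iff[OF m[OF p]] by simp
    hence "laurent_expansion f p \<noteq> 0" by auto
    thus "fls_subdegree (laurent_expansion f p) = - int n"
      using laurent_zorder[OF m[OF p]] f by (simp add: pole_exactly_at_def)
    fix z assume "z \<in> upper_half_plane" "\<not> eqv z p"
    thus "fls_subdegree (laurent_expansion f z) \<ge> 0"
      using f laurent_is_pole_iff[OF m, of z] by (auto simp: pole_exactly_at_def eqv_def)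
  qed
qed

end

section \<open>Poincare series\<close>

lemma norm_22_le:
  fixes k :: "real^2^2"
  shows "norm k \<le> \<bar>k$1$1\<bar> + \<bar>k$1$2\<bar> + \<bar>k$2$1\<bar> + \<bar>k$2$2\<bar>"
proof -
  have v: "norm (v :: real^2) \<le> \<bar>v$1\<bar> + \<bar>v$2\<bar>" for v
    using norm_le_l1_cart[of v] by (simp add: sum_2)
  have "norm k \<le> norm (k$1) + norm (k$2)"
    unfolding norm_vec_def using L2_set_le_sum[of UNIV "\<lambda>i. norm (k$i)"] by (simp add: sum_2 norm_vec_def)
  thus ?thesis using v[of "k$1"] v[of "k$2"] by linarith
qed

text \<open>Equal to (k z + i) mden k z, the automorphy factor of k followed by the Cayley
  transform. Locally uniformly in z it is bounded below by a multiple of the norm of k, whereas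
  \<open>mden\<close> alone may stay small.\<close>

definition mjac :: "real^2^2 \<Rightarrow> complex \<Rightarrow> complex" where
  "mjac k z = mnum k z + \<i> * mden k z"

lemma norm_mjac:
  assumes "mdet k = 1" "Im z > 0"
  shows "cmod (mnum k z) \<le> cmod (mjac k z)" "cmod (mden k z) \<le> cmod (mjac k z)"
proof -
  \<comment> \<open>The cross term of |num + i den|^2 is 2 Im (num cnj den), which is 2 Im z > 0 at
    determinant 1.\<close>
  have "(cmod (mjac k z))\<^sup>2 = (cmod (mnum k z))\<^sup>2 + (cmod (mden k z))\<^sup>2 + 2 * Im (mnum k z * cnj (mden k z))"
    unfolding mjac_def cmod_power2 by (simp add: power2_eq_square algebra_simps)
  hence "(cmod (mjac k z))\<^sup>2 \<ge> (cmod (mnum k z))\<^sup>2 + (cmod (mden k z))\<^sup>2"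
    using Im_mult_cnj_num_den[of k z] assms by simp
  hence "(cmod (mnum k z))\<^sup>2 \<le> (cmod (mjac k z))\<^sup>2" "(cmod (mden k z))\<^sup>2 \<le> (cmod (mjac k z))\<^sup>2"
    by (smt (verit) zero_le_power2)+
  thus "cmod (mnum k z) \<le> cmod (mjac k z)" "cmod (mden k z) \<le> cmod (mjac k z)"
    by (auto simp: power2_le_iff_abs_le)
qed

lemma affine_coeff_bound:
  fixes a b :: real
  assumes "cmod z \<le> R" "Im z \<ge> \<epsilon>" "\<epsilon> > 0" "cmod (of_real a * z + of_real b) \<le> B"
  shows "\<bar>a\<bar> \<le> B / \<epsilon>" "\<bar>b\<bar> \<le> B * (1 + R / \<epsilon>)"
proof -
  have "\<bar>a\<bar> * \<epsilon> \<le> \<bar>a\<bar> * Im z" using assms by (intro mult_left_mono) auto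
  also have "\<dots> = \<bar>Im (of_real a * z + of_real b)\<bar>" using assms by (simp add: abs_mult)
  also have "\<dots> \<le> B" using abs_Im_le_cmod[of "of_real a * z + of_real b"] assms by linarith
  finally show a: "\<bar>a\<bar> \<le> B / \<epsilon>" using assms by (simp add: field_simps)
  have "\<bar>b\<bar> = cmod ((of_real a * z + of_real b) - of_real a * z)" by simp
  also have "\<dots> \<le> B + \<bar>a\<bar> * cmod z"
    using norm_triangle_ineq4[of "of_real a * z + of_real b" "of_real a * z"] assms(4) by (simp add: norm_mult)
  also have "\<bar>a\<bar> * cmod z \<le> B / \<epsilon> * R" using a assms by (intro mult_mono) (auto intro: order_trans[OF abs_ge_zero])
  finally show "\<bar>b\<bar> \<le> B * (1 + R / \<epsilon>)" by (simp add: algebra_simps)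
qed

lemma norm_le_num_den:
  assumes "cmod z \<le> R" "Im z \<ge> \<epsilon>" "\<epsilon> > 0" "cmod (mnum k z) \<le> B" "cmod (mden k z) \<le> B"
  shows "norm k \<le> 2 * (1 / \<epsilon> + 1 + R / \<epsilon>) * B"
proof -
  have "norm k \<le> B / \<epsilon> + B * (1 + R / \<epsilon>) + (B / \<epsilon> + B * (1 + R / \<epsilon>))"
    using affine_coeff_bound[OF assms(1-4)[unfolded mnum_def]]
      affine_coeff_bound[OF assms(1-3) assms(5)[unfolded mden_def]] norm_22_le[of k] by linarith
  thus ?thesis by (simp add: algebra_simps)
qed

text \<open>With w = k z this is ((w + i) / (w - q))^n (w + i)^(-24) (mden k z)^(-24), the weight 24
  transform of a function whose only pole in the half-plane is at q, of order n. The bracket is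
  unchanged by scaling (mnum, mden), so n does not affect the weight.\<close>

definition poincare_term :: "complex \<Rightarrow> nat \<Rightarrow> real^2^2 \<Rightarrow> complex \<Rightarrow> complex" where
  "poincare_term q n k z = (mjac k z / (mnum k z - q * mden k z)) ^ n / mjac k z ^ 24"

lemma mjac_nonzero: "mdet k = 1 \<Longrightarrow> Im z > 0 \<Longrightarrow> mjac k z \<noteq> 0"
  using norm_mjac(2)[of k z] mden_nonzero[of k z] by auto

lemma num_minus_den: "mden k z \<noteq> 0 \<Longrightarrow> mnum k z - q * mden k z = (mob_act k z - q) * mden k z"
  by (simp add: mob_act_alt field_simps)

lemma poincare_term_analytic:
  assumes "mdet k = 1" "Im z > 0" "mob_act k z \<noteq> q"
  shows "poincare_term q n k analytic_on {z}"
proof -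
  have "mnum k z - q * mden k z \<noteq> 0"
    using num_minus_den[OF mden_nonzero[OF assms(1,2)]] mden_nonzero[OF assms(1,2)] assms(3) by simp
  thus ?thesis using mjac_nonzero[OF assms(1,2)]
    unfolding poincare_term_def mjac_def mnum_def mden_def by (intro analytic_intros) auto
qed

lemma poincare_term_meromorphic: "poincare_term q n k meromorphic_on A"
  unfolding poincare_term_def mjac_def mnum_def mden_def by (intro meromorphic_intros)

lemma poincare_term_mult:
  assumes "mdet d = 1" "Im z > 0"
  shows "poincare_term q n k (mob_act d z) = mden d z ^ 24 * poincare_term q n (k ** d) z"
  using mden_nonzero[OF assms]
  unfolding poincare_term_def mjac_def mnum_mult[OF assms] mden_mult[OF assms]
  by (simp flip: distrib_right mult.assoc left_diff_distrib) (simp add: power_mult_distrib)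

section \<open>Convergence, automorphy and poles of the series\<close>

context fuchsian
begin

lemma norm_K_pos: "k \<in> K \<Longrightarrow> norm k > 0"
  using det_K[of k] by (auto simp: mdet_def)

text \<open>N elements of norm at most B contribute at least N / B^24 to a convergent sum.\<close>

lemma finite_norm_le: "finite {k\<in>K. norm k \<le> B}"
proof -
  have "card F \<le> nat \<lceil>infsum (\<lambda>k. 1 / norm k ^ 24) K * B ^ 24\<rceil>"
    if F: "F \<subseteq> {k\<in>K. norm k \<le> B}" "finite F" for F
  proof (cases "F = {}")
    case False
    then obtain k0 where "k0 \<in> F" by blast
    hence "k0 \<in> K" "norm k0 \<le> B" using F(1) by auto
    hence B: "B > 0" using norm_K_pos[of k0] by linarith
    have "real (card F) * (1 / B ^ 24) = (\<Sum>k\<in>F. 1 / B ^ 24)" by simp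
    also have "\<dots> \<le> (\<Sum>k\<in>F. 1 / norm k ^ 24)"
    proof (rule sum_mono)
      fix k assume "k \<in> F"
      hence k: "norm k > 0" "norm k \<le> B" using F(1) norm_K_pos[of k] by auto
      thus "1 / B ^ 24 \<le> 1 / norm k ^ 24" using B
        by (intro divide_left_mono power_mono mult_pos_pos zero_less_power) auto
    qed
    also have "\<dots> \<le> infsum (\<lambda>k. 1 / norm k ^ 24) K"
      using F by (intro finite_sum_le_infsum summable_K) auto
    finally have "real (card F) \<le> infsum (\<lambda>k. 1 / norm k ^ 24) K * B ^ 24"
      using B by (simp add: field_simps)
    thus ?thesis by linarith
  qed simp
  thus ?thesis by (rule conjunct1[OF finite_if_finite_subsets_card_bdd])
qed

text \<open>Both k and -k occur; in even weight their terms agree, so they do not cancel.\<close>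

definition poincare :: "complex \<Rightarrow> nat \<Rightarrow> complex \<Rightarrow> complex" where
  "poincare q n z = (\<Sum>\<^sub>\<infinity>k\<in>K. poincare_term q n k z)"

text \<open>Only finitely many k move the disc close to q. All other terms are dominated by a
  multiple of 1 / norm k ^ 24, and the M-test makes their sum holomorphic.\<close>

lemma poincare_local:
  assumes q: "q \<in> upper_half_plane" and z0: "z0 \<in> upper_half_plane"
  obtains r B h where "r > 0" "ball z0 r \<subseteq> upper_half_plane" "finite B" "B \<subseteq> K"
    "\<And>k. k \<in> K \<Longrightarrow> mob_act k z0 = q \<Longrightarrow> k \<in> B"
    "h holomorphic_on ball z0 r"
    "\<And>z. z \<in> ball z0 r \<Longrightarrow> poincare q n z = (\<Sum>k\<in>B. poincare_term q n k z) + h z"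
proof -
  obtain r where r: "r > 0" "cball z0 r \<subseteq> upper_half_plane"
    using open_upper_half_plane z0 open_contains_cball by blast
  define R where "R = cmod z0 + r"
  have "compact (cball z0 r)" "cball z0 r \<noteq> {}" using r by auto
  moreover have "continuous_on (cball z0 r) Im" by (intro continuous_intros)
  ultimately obtain zm where zm: "zm \<in> cball z0 r" "\<forall>z\<in>cball z0 r. Im zm \<le> Im z"
    using continuous_attains_inf by blast
  define \<epsilon> where "\<epsilon> = Im zm"
  have e: "\<epsilon> > 0" "\<And>z. z \<in> cball z0 r \<Longrightarrow> Im z \<ge> \<epsilon>"
    using zm r by (auto simp: \<epsilon>_def U_Im)
  have R: "cmod z \<le> R" if "z \<in> cball z0 r" for z
    using that norm_triangle_ineq2[of z z0] by (auto simp: R_def dist_norm norm_minus_commute)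
  have Impos: "Im z > 0" if "z \<in> cball z0 r" for z using e that by force
  define C where "C = 2 * (1 / \<epsilon> + 1 + R / \<epsilon>)"
  have Rpos: "R \<ge> 0" using r by (simp add: R_def)
  have Cpos: "C > 0" using e Rpos by (simp add: C_def add_pos_nonneg)
  have normC: "norm k \<le> C * cmod (mjac k z)" if "k \<in> K" "z \<in> cball z0 r" for k z
    unfolding C_def
    by (rule norm_le_num_den[of z]) (use that R e norm_mjac[OF det_K Impos] in auto)
  \<comment> \<open>Image points within Im q / 2 of q have imaginary part at least Im q / 2. This
    bounds the denominator of k, then its numerator, then its norm, so B is finite.\<close>
  define \<delta> where "\<delta> = Im q / 2"
  have d: "\<delta> > 0" using q by (simp add: \<delta>_def U_Im)
  define B where "B = {k\<in>K. \<exists>z\<in>cball z0 r. cmod (mob_act k z - q) \<le> \<delta>}"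
  define D where "D = (cmod q + \<delta> + 1) * sqrt (R / \<delta>)"
  have "norm k \<le> C * D" if "k \<in> B" for k
  proof -
    from that obtain z where k: "k \<in> K" and z: "z \<in> cball z0 r" "cmod (mob_act k z - q) \<le> \<delta>"
      by (auto simp: B_def)
    have nz: "mden k z \<noteq> 0" using mden_nonzero[OF det_K[OF k] Impos[OF z(1)]] .
    have "Im q - Im (mob_act k z) \<le> \<delta>"
      using abs_Im_le_cmod[of "mob_act k z - q"] z(2) by simp
    hence i: "Im (mob_act k z) \<ge> \<delta>" by (simp add: \<delta>_def)
    hence "\<delta> \<le> Im z / (cmod (mden k z))\<^sup>2" using Im_mob_act[OF det_K[OF k] Impos[OF z(1)]] by simp
    hence "\<delta> * (cmod (mden k z))\<^sup>2 \<le> Im z" using nz by (simp add: field_simps)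
    also have "Im z \<le> R" using abs_Im_le_cmod[of z] R[OF z(1)] by linarith
    finally have "(cmod (mden k z))\<^sup>2 \<le> R / \<delta>" using d by (simp add: field_simps)
    hence den: "cmod (mden k z) \<le> sqrt (R / \<delta>)" using real_le_rsqrt by blast
    have "cmod (mob_act k z) \<le> cmod q + \<delta>" using norm_triangle_ineq2[of "mob_act k z" q] z(2) by linarith
    hence "cmod (mnum k z) \<le> (cmod q + \<delta>) * cmod (mden k z)"
      using nz unfolding mob_act_alt norm_divide by (subst (asm) pos_divide_le_eq) auto
    also have "\<dots> \<le> (cmod q + \<delta>) * sqrt (R / \<delta>)" using den d by (intro mult_left_mono) auto
    finally have "cmod (mnum k z) \<le> (cmod q + \<delta>) * sqrt (R / \<delta>)" .
    moreover have "sqrt (R / \<delta>) \<ge> 0" using Rpos d by simp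
    moreover have "cmod q + \<delta> \<ge> 0" using d by simp
    ultimately have "cmod (mnum k z) \<le> D" "cmod (mden k z) \<le> D"
      using den mult_nonneg_nonneg[of "cmod q + \<delta>" "sqrt (R/\<delta>)"] unfolding D_def
        distrib_right[of "cmod q + \<delta>"] by linarith+
    thus ?thesis unfolding C_def using norm_le_num_den[OF R[OF z(1)] e(2)[OF z(1)] e(1)] by blast
  qed
  hence "B \<subseteq> {k\<in>K. norm k \<le> C * D}" by (auto simp: B_def)
  hence finB: "finite B" using finite_norm_le finite_subset by blast
  \<comment> \<open>At distance more than delta from q, the factor (w + i) / (w - q) = 1 + (q + i) /
    (w - q) is bounded by S.\<close>
  define S where "S = 1 + cmod (q + \<i>) / \<delta>"
  have Spos: "S \<ge> 0" using d by (simp add: S_def)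
  have bnd: "norm (poincare_term q n k z) \<le> S ^ n * C ^ 24 * (1 / norm k ^ 24)" if k: "k \<in> K - B" and z: "z \<in> cball z0 r" for k z
  proof -
    have nz: "mden k z \<noteq> 0" using mden_nonzero[OF det_K Impos[OF z]] k by blast
    have far: "cmod (mob_act k z - q) > \<delta>" using k z unfolding B_def by (blast intro: leI not_le_imp_less)
    hence ne: "mob_act k z - q \<noteq> 0" using d by auto
    have "mjac k z / (mnum k z - q * mden k z) = (mob_act k z + \<i>) / (mob_act k z - q)"
      unfolding num_minus_den[OF nz] using nz by (simp add: mjac_def mob_act_alt field_simps)
    also have "\<dots> = 1 + (q + \<i>) / (mob_act k z - q)" using ne by (simp add: field_simps)
    also have "cmod \<dots> \<le> 1 + cmod (q + \<i>) / cmod (mob_act k z - q)"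
      using norm_triangle_ineq[of 1 "(q + \<i>) / (mob_act k z - q)"] by (simp add: norm_divide)
    also have "\<dots> \<le> S" unfolding S_def using far d by (intro add_left_mono divide_left_mono mult_pos_pos) auto
    finally have 1: "cmod (mjac k z / (mnum k z - q * mden k z)) ^ n \<le> S ^ n" by (rule power_mono) simp
    have kp: "norm k > 0" using norm_K_pos k by blast
    have j: "cmod (mjac k z) > 0" using mjac_nonzero[OF det_K Impos[OF z]] k by simp
    have "norm k ^ 24 \<le> (C * cmod (mjac k z)) ^ 24"
      using normC[of k z] k z by (intro power_mono) auto
    hence "1 / cmod (mjac k z) ^ 24 \<le> C ^ 24 * (1 / norm k ^ 24)"
      using j kp by (simp add: field_simps power_mult_distrib)
    hence "cmod (mjac k z / (mnum k z - q * mden k z)) ^ n * (1 / cmod (mjac k z) ^ 24) \<le> S ^ n * (C ^ 24 * (1 / norm k ^ 24))"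
      using 1 Spos by (intro mult_mono) auto
    thus ?thesis unfolding poincare_term_def norm_divide norm_power by (simp add: mult_ac)
  qed
  have sumK: "(\<lambda>k. S ^ n * C ^ 24 * (1 / norm k ^ 24)) summable_on (K - B)"
    by (intro summable_on_cmult_right summable_on_subset_banach[OF summable_K]) auto
  define h where "h = (\<lambda>z. \<Sum>\<^sub>\<infinity>k\<in>K - B. poincare_term q n k z)"
  have an: "poincare_term q n k analytic_on cball z0 r" if "k \<in> K - B" for k
  proof -
    have "poincare_term q n k analytic_on {z}" if z: "z \<in> cball z0 r" for z
    proof (rule poincare_term_analytic)
      show "mob_act k z \<noteq> q" using \<open>k \<in> K - B\<close> z d by (force simp: B_def)
    qed (use det_K \<open>k \<in> K - B\<close> Impos z in auto)
    thus ?thesis using analytic_on_analytic_at by blast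
  qed
  have "uniform_limit (cball z0 r) (\<lambda>F z. \<Sum>k\<in>F. poincare_term q n k z) h (finite_subsets_at_top (K - B))"
    unfolding h_def by (rule Weierstrass_m_test_general[OF bnd sumK])
  moreover have "\<forall>\<^sub>F F in finite_subsets_at_top (K - B). continuous_on (cball z0 r) (\<lambda>z. \<Sum>k\<in>F. poincare_term q n k z)
      \<and> (\<lambda>z. \<Sum>k\<in>F. poincare_term q n k z) holomorphic_on ball z0 r"
  proof (rule eventually_finite_subsets_at_top_weakI)
    fix F assume F: "finite F" "F \<subseteq> K - B"
    have "(\<lambda>z. \<Sum>k\<in>F. poincare_term q n k z) holomorphic_on cball z0 r"
      using F an by (intro holomorphic_on_sum) (auto intro: analytic_imp_holomorphic)
    thus "continuous_on (cball z0 r) (\<lambda>z. \<Sum>k\<in>F. poincare_term q n k z)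
      \<and> (\<lambda>z. \<Sum>k\<in>F. poincare_term q n k z) holomorphic_on ball z0 r"
      using holomorphic_on_imp_continuous_on holomorphic_on_subset ball_subset_cball by blast
  qed
  ultimately have hol: "h holomorphic_on ball z0 r"
    using holomorphic_uniform_limit[of z0 r "\<lambda>F z. \<Sum>k\<in>F. poincare_term q n k z" "finite_subsets_at_top (K - B)" h]
    by (simp add: finite_subsets_at_top_neq_bot)
  show ?thesis
  proof (rule that[OF r(1) _ finB _ _ hol])
    show "ball z0 r \<subseteq> upper_half_plane" using r by force
    show "B \<subseteq> K" by (auto simp: B_def)
    show "k \<in> B" if "k \<in> K" "mob_act k z0 = q" for k
      using that r d by (auto simp: B_def intro!: bexI[of _ z0])
    fix z assume z: "z \<in> ball z0 r"
    have "(\<lambda>k. poincare_term q n k z) summable_on (K - B)"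
      by (rule abs_summable_summable, rule summable_on_comparison_test[OF sumK]) (use bnd z in auto)
    hence "(\<Sum>\<^sub>\<infinity>k\<in>B \<union> (K - B). poincare_term q n k z) = (\<Sum>\<^sub>\<infinity>k\<in>B. poincare_term q n k z) + h z"
      unfolding h_def by (intro infsum_Un_disjoint) (use finB in auto)
    moreover have "B \<union> (K - B) = K" by (auto simp: B_def)
    ultimately show "poincare q n z = (\<Sum>k\<in>B. poincare_term q n k z) + h z"
      using finB by (simp add: poincare_def)
  qed
qed

lemma poincare_act:
  assumes "d \<in> K" "Im z > 0"
  shows "poincare q n (mob_act d z) = mden d z ^ 24 * poincare q n z"
proof -
  have b: "bij_betw (\<lambda>k. k ** d) K K"
    by (rule bij_betwI[where g = "\<lambda>k. k ** madj d"])
       (use assms mult_K madj_K madj_mult[OF det_K] in \<open>auto simp flip: matrix_mul_assoc\<close>)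
  have "poincare q n (mob_act d z) = (\<Sum>\<^sub>\<infinity>k\<in>K. mden d z ^ 24 * poincare_term q n (k ** d) z)"
    unfolding poincare_def by (rule infsum_cong) (use poincare_term_mult det_K assms in auto)
  also have "\<dots> = mden d z ^ 24 * (\<Sum>\<^sub>\<infinity>k\<in>K. poincare_term q n (k ** d) z)" by (rule infsum_cmult_right')
  also have "(\<Sum>\<^sub>\<infinity>k\<in>K. poincare_term q n (k ** d) z) = poincare q n z"
    unfolding poincare_def using infsum_reindex_bij_betw[OF b] .
  finally show ?thesis .
qed

lemma ev_ball: "r > 0 \<Longrightarrow> \<forall>\<^sub>F w in at (z::complex). w \<in> ball z r"
  using eventually_at_in_open'[of "ball z r" z] by simp

lemma poincare_autom:
  assumes q: "q \<in> upper_half_plane" shows "autom K 24 (poincare q n)"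
  unfolding autom_def
proof (intro conjI ballI)
  show "poincare q n meromorphic_on upper_half_plane"
    unfolding meromorphic_on_meromorphic_at[of _ upper_half_plane]
  proof
    fix z0 assume z0: "z0 \<in> upper_half_plane"
    obtain r B h where *: "r > 0" "finite B" "h holomorphic_on ball z0 r"
      "\<And>z. z \<in> ball z0 r \<Longrightarrow> poincare q n z = (\<Sum>k\<in>B. poincare_term q n k z) + h z"
      using poincare_local[OF q z0] by metis
    have "h analytic_on {z0}" using * by (intro holomorphic_on_imp_analytic_at[of _ "ball z0 r"]) auto
    hence "(\<lambda>z. (\<Sum>k\<in>B. poincare_term q n k z) + h z) meromorphic_on {z0}"
      by (intro meromorphic_intros poincare_term_meromorphic analytic_on_imp_meromorphic_on)
    moreover have "\<forall>\<^sub>F z in at z0. poincare q n z = (\<Sum>k\<in>B. poincare_term q n k z) + h z"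
      using ev_ball[OF *(1)] by eventually_elim (use * in auto)
    ultimately show "poincare q n meromorphic_on {z0}"
      by (subst meromorphic_on_cong) auto
  qed
next
  fix k z assume "k \<in> K" "z \<in> upper_half_plane"
  thus "\<forall>\<^sub>F w in at z. poincare q n (mob_act k w) = mden k w ^ 24 * poincare q n w"
    by (intro eventually_mono[OF eventually_at_in_open'[OF open_upper_half_plane]])
       (auto simp: poincare_act U_Im)
qed

lemma poincare_analytic:
  assumes q: "q \<in> upper_half_plane" and z: "z \<in> upper_half_plane" "\<not> eqv z q"
  shows "fls_subdegree (laurent_expansion (poincare q n) z) \<ge> 0"
proof -
  obtain r B h where *: "r > 0" "ball z r \<subseteq> upper_half_plane" "finite B" "B \<subseteq> K" "h holomorphic_on ball z r"
      "\<And>w. w \<in> ball z r \<Longrightarrow> poincare q n w = (\<Sum>k\<in>B. poincare_term q n k w) + h w"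
    using poincare_local[OF q z(1)] by metis
  have "poincare_term q n k analytic_on {z}" if "k \<in> B" for k
  proof (rule poincare_term_analytic)
    show "mob_act k z \<noteq> q" using z(2) eqv_sym[of q z] z(1) that *(4) by (auto simp: eqv_def)
  qed (use det_K that * z U_Im in auto)
  moreover have "h analytic_on {z}" using * by (intro holomorphic_on_imp_analytic_at[of _ "ball z r"]) auto
  ultimately have "(\<lambda>w. (\<Sum>k\<in>B. poincare_term q n k w) + h w) analytic_on {z}"
    by (intro analytic_intros)
  moreover have "laurent_expansion (poincare q n) z = laurent_expansion (\<lambda>w. (\<Sum>k\<in>B. poincare_term q n k w) + h w) z"
    by (rule laurent_expansion_cong) (use eventually_mono[OF ev_ball[OF *(1)]] * in auto)
  ultimately show ?thesis using laurent_analytic_subdegree by metis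
qed

lemma poincare_pole:
  assumes q: "q \<in> upper_half_plane" and n0: "n \<noteq> 0"
  shows "laurent_expansion (poincare q n) q \<noteq> 0" "fls_subdegree (laurent_expansion (poincare q n) q) = - int n"
proof -
  obtain r B h where *: "r > 0" "ball q r \<subseteq> upper_half_plane" "finite B" "B \<subseteq> K"
      "\<And>k. k \<in> K \<Longrightarrow> mob_act k q = q \<Longrightarrow> k \<in> B" "h holomorphic_on ball q r"
      "\<And>w. w \<in> ball q r \<Longrightarrow> poincare q n w = (\<Sum>k\<in>B. poincare_term q n k w) + h w"
    using poincare_local[OF q q] by metis
  \<comment> \<open>By torsion-freeness only 1 and -1 fix q. Their two equal terms carry the whole
    pole, with leading coefficient 2 (q + i)^(n - 24).\<close>
  define E where "E = {mat 1, - mat 1 :: real^2^2}"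
  have ne: "mat 1 \<noteq> (- mat 1 :: real^2^2)" by (simp add: mat_eq_22_iff)
  have EB: "E \<subseteq> B" using *(5) one_K minus_one_K by (auto simp: E_def)
  define g where "g = (\<lambda>w. (\<Sum>k\<in>B - E. poincare_term q n k w) + h w)"
  have "poincare_term q n k analytic_on {q}" if "k \<in> B - E" for k
    by (rule poincare_term_analytic) (use det_K that * q U_Im torsion_free[of k q] in \<open>auto simp: E_def\<close>)
  moreover have "h analytic_on {q}" using * by (intro holomorphic_on_imp_analytic_at[of _ "ball q r"]) auto
  ultimately have g: "g analytic_on {q}" unfolding g_def by (intro analytic_intros) auto
  have Im: "Im q > 0" using q U_Im by blast
  have qi: "q + \<i> \<noteq> 0" using Im by (auto simp: complex_eq_iff)
  have 1: "poincare_term q n (mat 1) w = ((w + \<i>) / (w - q)) ^ n / (w + \<i>) ^ 24" for w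
    by (simp add: poincare_term_def mjac_def mnum_def mden_def)
  have 2: "poincare_term q n (- mat 1) w = ((w + \<i>) / (w - q)) ^ n / (w + \<i>) ^ 24" for w
  proof -
    have "(- w - \<i>) / (q - w) = (w + \<i>) / (w - q)"
      by (metis add_uminus_conv_diff minus_add_distrib minus_diff_eq minus_divide_divide)
    moreover have "(- w - \<i>) ^ 24 = (w + \<i>) ^ 24"
    proof -
      have "- w - \<i> = - (w + \<i>)" by simp
      thus ?thesis by (simp only: power_minus_even even_numeral)
    qed
    ultimately show ?thesis by (simp add: poincare_term_def mjac_def mnum_def mden_def)
  qed
  have eq: "poincare q n w = 2 * (((w + \<i>) / (w - q)) ^ n / (w + \<i>) ^ 24) + g w" if "w \<in> ball q r" for w
  proof -
    have "(\<Sum>k\<in>B. poincare_term q n k w) = (\<Sum>k\<in>E. poincare_term q n k w) + (\<Sum>k\<in>B - E. poincare_term q n k w)"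
      using sum.subset_diff[OF EB *(3)] by (simp add: add.commute)
    thus ?thesis using *(7)[OF that] 1 2 ne by (simp add: g_def E_def)
  qed
  have lim: "((\<lambda>w. 2 * ((w + \<i>) ^ n / (w + \<i>) ^ 24) + g w * (w - q) ^ n) \<longlongrightarrow>
      2 * ((q + \<i>) ^ n / (q + \<i>) ^ 24) + g q * (q - q) ^ n) (at q)"
    by (intro tendsto_intros) (use qi analytic_at_imp_isCont[OF g] in \<open>auto simp: isCont_def\<close>)
  have "\<forall>\<^sub>F w in at q. w \<in> ball q r \<and> w \<noteq> q"
    using ev_ball[OF *(1)] eventually_neq_at_within[of q q UNIV] by eventually_elim auto
  hence "\<forall>\<^sub>F w in at q. 2 * ((w + \<i>) ^ n / (w + \<i>) ^ 24) + g w * (w - q) ^ n = poincare q n w * (w - q) powi (- (- int n))"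
    by eventually_elim (simp add: eq power_divide field_simps)
  hence "((\<lambda>w. poincare q n w * (w - q) powi (- (- int n))) \<longlongrightarrow> 2 * ((q + \<i>) ^ n / (q + \<i>) ^ 24) + g q * (q - q) ^ n) (at q)"
    using lim by (subst (asm) tendsto_cong) auto
  moreover have "2 * ((q + \<i>) ^ n / (q + \<i>) ^ 24) + g q * (q - q) ^ n \<noteq> 0" using qi n0 by (simp add: power_0_left)
  ultimately show "laurent_expansion (poincare q n) q \<noteq> 0" "fls_subdegree (laurent_expansion (poincare q n) q) = - int n"
    using laurent_lead_conv autom_at[OF poincare_autom[OF q] q] by blast+
qed

end

section \<open>Gaps and degrees\<close>

text \<open>Among the terms with nonzero coefficient, the one of least order cannot be
  cancelled.\<close>

lemma lincomb_distinct_orders: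
  assumes fin: "finite I" and m: "\<And>i. i \<in> I \<Longrightarrow> f i meromorphic_on {z}"
    and nz: "\<And>i. i \<in> I \<Longrightarrow> laurent_expansion (f i) z \<noteq> 0"
    and inj: "inj_on (\<lambda>i. fls_subdegree (laurent_expansion (f i) z)) I"
    and c: "\<exists>i\<in>I. c i \<noteq> 0"
  obtains i where "i \<in> I" "laurent_expansion (\<lambda>w. \<Sum>i\<in>I. c i * f i w) z \<noteq> 0"
    "fls_subdegree (laurent_expansion (\<lambda>w. \<Sum>i\<in>I. c i * f i w) z) = fls_subdegree (laurent_expansion (f i) z)"
proof -
  let ?o = "\<lambda>i. fls_subdegree (laurent_expansion (f i) z)" and ?F = "laurent_expansion (\<lambda>w. \<Sum>i\<in>I. c i * f i w) z"
  define A where "A = {i\<in>I. c i \<noteq> 0}"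
  have A: "finite A" "A \<noteq> {}" using fin c by (auto simp: A_def)
  define i0 where "i0 = arg_min_on ?o A"
  have i0: "i0 \<in> A" "\<And>i. i \<in> A \<Longrightarrow> ?o i0 \<le> ?o i"
    using arg_min_if_finite(1)[OF A, of ?o] arg_min_least[OF A, of _ ?o] by (auto simp: i0_def)
  hence i0I: "i0 \<in> I" by (auto simp: A_def)
  have nth: "?F $$ n = (\<Sum>i\<in>I. c i * laurent_expansion (f i) z $$ n)" for n
    by (rule laurent_lincomb_nth[OF m])
  have low: "c i * laurent_expansion (f i) z $$ n = 0" if "i \<in> I" "n < ?o i0" for i n
    using i0(2)[of i] that by (cases "c i = 0") (auto simp: A_def)
  have "?F $$ ?o i0 = c i0 * laurent_expansion (f i0) z $$ ?o i0 + (\<Sum>i\<in>I - {i0}. c i * laurent_expansion (f i) z $$ ?o i0)"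
    unfolding nth by (rule sum.remove[OF fin i0I])
  also have "(\<Sum>i\<in>I - {i0}. c i * laurent_expansion (f i) z $$ ?o i0) = 0"
  proof (rule sum.neutral, rule ballI)
    fix i assume i: "i \<in> I - {i0}"
    show "c i * laurent_expansion (f i) z $$ ?o i0 = 0"
    proof (cases "c i = 0")
      case False
      hence "?o i0 \<le> ?o i" "?o i0 \<noteq> ?o i" using i i0 i0I inj by (auto simp: A_def inj_on_def)
      thus ?thesis by simp
    qed simp
  qed
  finally have "?F $$ ?o i0 \<noteq> 0" using i0(1) nz[OF i0I] by (simp add: A_def)
  moreover have "?F $$ n = 0" if "n < ?o i0" for n
    unfolding nth using low that by (intro sum.neutral) auto
  ultimately have "?F \<noteq> 0" "fls_subdegree ?F = ?o i0" by (auto intro: fls_subdegree_eqI)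
  thus ?thesis using that i0I by blast
qed

lemma fls_subdegree_ge0I:
  assumes "\<And>i. i < 0 \<Longrightarrow> F $$ i = 0" shows "fls_subdegree (F :: complex fls) \<ge> 0"
  using assms by (cases "F = 0") (auto intro: fls_subdegree_geI)

lemma fls_nth_neg: "fls_subdegree (F :: complex fls) \<ge> 0 \<Longrightarrow> i < 0 \<Longrightarrow> F $$ i = 0"
  by simp

section \<open>Linear conditions for quotients of forms; finiteness of gaps; zeros against
  poles\<close>

context fuchsian
begin

lemma autom_laurent_nonzero:
  assumes "autom K m f" "p \<in> upper_half_plane" "laurent_expansion f p \<noteq> 0" "z \<in> upper_half_plane"
  shows "laurent_expansion f z \<noteq> 0"
  using laurent_zero_propagate[OF autom_meromorphic[OF assms(1)] open_upper_half_plane connected_upper_half_plane assms(4,2)] assms(3)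
  by blast

definition reg_off :: "complex \<Rightarrow> (complex \<Rightarrow> complex) \<Rightarrow> bool" where
  "reg_off p f \<longleftrightarrow> (\<forall>z\<in>upper_half_plane. \<not> eqv z p \<longrightarrow> fls_subdegree (laurent_expansion f z) \<ge> 0)"

text \<open>J is a finite list of Laurent coefficients, the same for all F. Once they vanish, F can
  be divided by the fixed form \<open>poincare p 1\<close> without creating poles off the orbit of
  p. Both dimension counts rest on such a J.\<close>

definition division_test :: "complex \<Rightarrow> (complex \<times> int) set \<Rightarrow> bool" where
  "division_test p J \<longleftrightarrow> finite J \<and> J \<subseteq> upper_half_plane \<times> UNIV \<and>
     (\<forall>F. autom K 24 F \<longrightarrow> reg_off p F \<longrightarrow> (\<forall>(s, i)\<in>J. laurent_expansion F s $$ i = 0) \<longrightarrow>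
       autom K 0 (\<lambda>w. F w / poincare p 1 w) \<and> reg_off p (\<lambda>w. F w / poincare p 1 w) \<and>
       laurent_expansion (\<lambda>w. F w / poincare p 1 w) p = laurent_expansion F p / laurent_expansion (poincare p 1) p)"

lemma division_testD:
  assumes "division_test p J" "autom K 24 F" "reg_off p F" "\<forall>j\<in>J. laurent_expansion F (fst j) $$ snd j = 0"
  shows "autom K 0 (\<lambda>w. F w / poincare p 1 w)" "reg_off p (\<lambda>w. F w / poincare p 1 w)"
    "laurent_expansion (\<lambda>w. F w / poincare p 1 w) p = laurent_expansion F p / laurent_expansion (poincare p 1) p"
proof -
  have "\<forall>(s, i)\<in>J. laurent_expansion F s $$ i = 0" using assms(4) by auto
  thus "autom K 0 (\<lambda>w. F w / poincare p 1 w)" "reg_off p (\<lambda>w. F w / poincare p 1 w)"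
    "laurent_expansion (\<lambda>w. F w / poincare p 1 w) p = laurent_expansion F p / laurent_expansion (poincare p 1) p"
    using assms(1-3) unfolding division_test_def by blast+
qed

lemma division_test_exists:
  assumes p: "p \<in> upper_half_plane"
  shows "\<exists>J. division_test p J"
proof -
  let ?G = "poincare p 1"
  note aG = poincare_autom[OF p, of 1]
  have Gnz: "laurent_expansion ?G z \<noteq> 0" if "z \<in> upper_half_plane" for z
    using autom_laurent_nonzero[OF aG p poincare_pole(1)[OF p] that] by simp
  obtain S where S: "finite S" "S \<subseteq> upper_half_plane"
    "\<And>s. s \<in> S \<Longrightarrow> fls_subdegree (laurent_expansion ?G s) \<noteq> 0"
    "\<And>z. z \<in> upper_half_plane \<Longrightarrow> (\<And>w. eqv w z \<Longrightarrow> fls_subdegree (laurent_expansion ?G w) \<noteq> 0) \<Longrightarrow> \<exists>s\<in>S. eqv s z"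
    using zero_reps[OF autom_meromorphic[OF aG] Gnz] by metis
  \<comment> \<open>Coefficients of negative index vanish for F regular off p, so conditions start
    at 0 and stop at the order of the denominator. At points equivalent to p that order is -1 and
    the range is empty.\<close>
  define J where "J = (SIGMA s:S. {0..<fls_subdegree (laurent_expansion ?G s)})"
  have "division_test p J" unfolding division_test_def
  proof (intro conjI allI impI)
    show "finite J" "J \<subseteq> upper_half_plane \<times> UNIV" using S by (auto simp: J_def)
    fix F assume F: "autom K 24 F" and reg0: "reg_off p F"
      and cond0: "\<forall>(s, i)\<in>J. laurent_expansion F s $$ i = 0"
    have reg: "\<And>z. z \<in> upper_half_plane \<Longrightarrow> \<not> eqv z p \<Longrightarrow> fls_subdegree (laurent_expansion F z) \<ge> 0"
      using reg0 unfolding reg_off_def by blast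
    have cond: "\<And>s i. (s, i) \<in> J \<Longrightarrow> laurent_expansion F s $$ i = 0" using cond0 by blast
    have div: "laurent_expansion (\<lambda>w. F w / ?G w) z = laurent_expansion F z / laurent_expansion ?G z"
      if "z \<in> upper_half_plane" for z
      by (rule laurent_divide[OF autom_at[OF F that] autom_at[OF aG that]])
    have "fls_subdegree (laurent_expansion (\<lambda>w. F w / ?G w) z) \<ge> 0" if z: "z \<in> upper_half_plane" "\<not> eqv z p" for z
    proof (cases "laurent_expansion F z = 0")
      case False
      have "fls_subdegree (laurent_expansion F z) \<ge> fls_subdegree (laurent_expansion ?G z)"
      proof (cases "fls_subdegree (laurent_expansion ?G z) = 0")
        case True thus ?thesis using reg z by simp
      next
        case nz: False
        hence "\<exists>s\<in>S. eqv s z" using S(4)[OF z(1)] autom_laurent(2)[OF aG z(1)] by metis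
        then obtain s where s: "s \<in> S" "eqv s z" by blast
        have sU: "s \<in> upper_half_plane" using s S by blast
        have sp: "\<not> eqv s p" using eqv_trans[OF eqv_sym[OF s(2) z(1)] _ p] z(2) by blast
        have "laurent_expansion F s \<noteq> 0" using autom_laurent(1)[OF F z(1) s(2)] False by simp
        moreover have "laurent_expansion F s $$ i = 0" if "i < fls_subdegree (laurent_expansion ?G s)" for i
          using cond[of s i] reg[OF sU sp] that s by (cases "i < 0") (auto simp: J_def)
        ultimately have "fls_subdegree (laurent_expansion F s) \<ge> fls_subdegree (laurent_expansion ?G s)"
          by (intro fls_subdegree_geI)
        thus ?thesis using autom_laurent(2)[OF F z(1) s(2)] autom_laurent(2)[OF aG z(1) s(2)] by simp
      qed
      thus ?thesis using False Gnz[OF z(1)] unfolding div[OF z(1)] by (simp add: fls_divide_subdegree)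
    next
      case True
      thus ?thesis unfolding div[OF z(1)] by simp
    qed
    thus "reg_off p (\<lambda>w. F w / ?G w)" unfolding reg_off_def by blast
    show "autom K 0 (\<lambda>w. F w / ?G w)" by (rule autom_divide[OF F aG det_K])
    show "laurent_expansion (\<lambda>w. F w / ?G w) p = laurent_expansion F p / laurent_expansion ?G p" by (rule div[OF p])
  qed
  thus ?thesis ..
qed

text \<open>With one more gap than conditions in J, some nontrivial combination passes the test, and
  the pole order of its quotient is one of the chosen gaps. The series have order n + 1 because
  dividing by the simple pole of \<open>poincare p 1\<close> removes one.\<close>

lemma finite_gaps:
  assumes p: "p \<in> upper_half_plane" shows "finite (gaps K p)"
proof (rule ccontr)
  assume "infinite (gaps K p)"
  obtain J where dt: "division_test p J" using division_test_exists[OF p] ..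
  have J: "finite J" "J \<subseteq> upper_half_plane \<times> UNIV" using dt by (auto simp: division_test_def)
  obtain I where I: "I \<subseteq> gaps K p" "card I = Suc (card J)" "finite I"
    using infinite_arbitrarily_large[OF \<open>infinite (gaps K p)\<close>] by metis
  have aP: "autom K 24 (poincare p (Suc n))" for n by (rule poincare_autom[OF p])
  obtain c where c: "\<exists>n\<in>I. c n \<noteq> 0"
    "\<forall>j\<in>J. (\<Sum>n\<in>I. c n * laurent_expansion (poincare p (Suc n)) (fst j) $$ snd j) = 0"
    using underdetermined_homogeneous_system[OF I(3) J(1), of "\<lambda>j n. laurent_expansion (poincare p (Suc n)) (fst j) $$ snd j"] I(2)
    by auto
  define F where "F = (\<lambda>w. \<Sum>n\<in>I. c n * poincare p (Suc n) w)"
  have aF: "autom K 24 F" unfolding F_def by (rule autom_lincomb[OF I(3) aP])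
  have nth: "laurent_expansion F z $$ i = (\<Sum>n\<in>I. c n * laurent_expansion (poincare p (Suc n)) z $$ i)"
    if "z \<in> upper_half_plane" for z i
    unfolding F_def by (rule laurent_lincomb_nth) (rule autom_at[OF aP that])
  have reg: "fls_subdegree (laurent_expansion F z) \<ge> 0" if z: "z \<in> upper_half_plane" "\<not> eqv z p" for z
    using poincare_analytic[OF p z]
    by (intro fls_subdegree_ge0I) (auto simp: nth[OF z(1)] fls_nth_neg intro!: sum.neutral)
  have cond: "\<forall>j\<in>J. laurent_expansion F (fst j) $$ snd j = 0"
    using c(2) J(2) nth by force
  have "reg_off p F" using reg unfolding reg_off_def by blast
  note q = division_testD[OF dt aF this cond]
  have sub: "fls_subdegree (laurent_expansion (poincare p (Suc n)) p) = - int (Suc n)" for n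
    using poincare_pole(2)[OF p, of "Suc n"] by simp
  have inj: "inj_on (\<lambda>n. fls_subdegree (laurent_expansion (poincare p (Suc n)) p)) I"
    unfolding sub by (auto simp: inj_on_def)
  have nzP: "laurent_expansion (poincare p (Suc n)) p \<noteq> 0" for n using poincare_pole(1)[OF p, of "Suc n"] by simp
  obtain n where n: "n \<in> I" "laurent_expansion F p \<noteq> 0" "fls_subdegree (laurent_expansion F p) = - int (Suc n)"
    using lincomb_distinct_orders[where f = "\<lambda>n. poincare p (Suc n)", OF I(3) autom_at[OF aP p] nzP inj c(1)]
    unfolding F_def sub by blast
  have "fls_subdegree (laurent_expansion (\<lambda>w. F w / poincare p 1 w) p) = - int n"
    unfolding q(3) using n poincare_pole[OF p, of 1] by (simp add: fls_divide_subdegree)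
  moreover have "n \<in> gaps K p" "n \<ge> 1" using n(1) I(1) by (auto simp: gaps_def)
  ultimately show False using not_gapI[OF q(1) p, of n] q(2) unfolding reg_off_def by blast
qed

text \<open>Forms with poles of order at most M e q at the points of Q, multiplied by f^M, are
  regular off p and have a pole of order at most M n at p. If the e q summed to more than n, at
  least M n + M such forms would face at most M n + card J < M n + M conditions. A nontrivial
  combination of the products, divided by \<open>poincare p 1\<close>, would be holomorphic
  everywhere and 0 at p, hence 0, although its poles at Q do not cancel before the
  multiplication.\<close>

lemma zeros_le_pole_order:
  assumes p: "p \<in> upper_half_plane" and f: "autom K 0 f"
    and fp: "laurent_expansion f p \<noteq> 0" "fls_subdegree (laurent_expansion f p) = - int n"
    and reg: "\<And>z. z \<in> upper_half_plane \<Longrightarrow> \<not> eqv z p \<Longrightarrow> fls_subdegree (laurent_expansion f z) \<ge> 0"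
    and Q: "finite Q" "Q \<subseteq> upper_half_plane" "\<And>q. q \<in> Q \<Longrightarrow> \<not> eqv q p"
      "\<And>q q'. q \<in> Q \<Longrightarrow> q' \<in> Q \<Longrightarrow> eqv q q' \<Longrightarrow> q = q'"
    and e: "\<And>q. q \<in> Q \<Longrightarrow> int (e q) \<le> fls_subdegree (laurent_expansion f q)"
  shows "(\<Sum>q\<in>Q. e q) \<le> n"
proof (rule ccontr)
  assume "\<not> ?thesis"
  hence big: "(\<Sum>q\<in>Q. e q) \<ge> Suc n" by simp
  obtain J where dt: "division_test p J" using division_test_exists[OF p] ..
  have J: "finite J" "J \<subseteq> upper_half_plane \<times> UNIV" using dt by (auto simp: division_test_def)
  \<comment> \<open>The surplus of forms grows like M while card J stays fixed.\<close>
  define M where "M = Suc (card J)"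
  define I where "I = (SIGMA q:Q. {1..M * e q})"
  have finI: "finite I" using Q(1) by (simp add: I_def)
  have "card I = M * (\<Sum>q\<in>Q. e q)" using Q(1) by (simp add: I_def sum_distrib_left)
  also have "\<dots> \<ge> M * Suc n" using big by (rule mult_le_mono2)
  finally have cI: "card I \<ge> M * n + M" by simp
  \<comment> \<open>The second part kills the principal part of F at p.\<close>
  define J' where "J' = J \<union> {p} \<times> {- int (M * n)..<0}"
  have "card J' \<le> card J + M * n"
    unfolding J'_def by (rule order_trans[OF card_Un_le]) (simp add: card_cartesian_product del: of_nat_mult)
  hence cJ: "card J' < card I" using cI by (simp add: M_def)
  have finJ: "finite J'" using J(1) by (simp add: J'_def)
  define P where "P = (\<lambda>i :: complex \<times> nat. poincare (fst i) (snd i))"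
  have aP: "autom K 24 (P i)" if "i \<in> I" for i
    unfolding P_def by (rule poincare_autom) (use that Q(2) in \<open>auto simp: I_def\<close>)
  have afM: "autom K 0 (\<lambda>w. f w ^ M)" using autom_power[OF f, of M] by simp
  have ah: "autom K 24 (\<lambda>w. f w ^ M * P i w)" if "i \<in> I" for i
    using autom_mult[OF afM aP[OF that]] by simp
  obtain c where c: "\<exists>i\<in>I. c i \<noteq> 0"
    "\<forall>j\<in>J'. (\<Sum>i\<in>I. c i * laurent_expansion (\<lambda>w. f w ^ M * P i w) (fst j) $$ snd j) = 0"
    using underdetermined_homogeneous_system[OF finI finJ cJ, of "\<lambda>j i. laurent_expansion (\<lambda>w. f w ^ M * P i w) (fst j) $$ snd j"]
    by auto
  define F where "F = (\<lambda>w. \<Sum>i\<in>I. c i * (f w ^ M * P i w))"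
  define H where "H = (\<lambda>w. \<Sum>i\<in>I. c i * P i w)"
  have aF: "autom K 24 F" unfolding F_def by (rule autom_lincomb[OF finI ah])
  have aH: "autom K 24 H" unfolding H_def by (rule autom_lincomb[OF finI aP])
  have FH: "F = (\<lambda>w. f w ^ M * H w)" by (simp add: F_def H_def sum_distrib_left mult_ac)
  have Fnth: "laurent_expansion F z $$ i = (\<Sum>j\<in>I. c j * laurent_expansion (\<lambda>w. f w ^ M * P j w) z $$ i)"
    if "z \<in> upper_half_plane" for z i
    unfolding F_def by (rule laurent_lincomb_nth) (rule autom_at[OF ah that])
  have Hnth: "laurent_expansion H z $$ i = (\<Sum>j\<in>I. c j * laurent_expansion (P j) z $$ i)"
    if "z \<in> upper_half_plane" for z i
    unfolding H_def by (rule laurent_lincomb_nth) (rule autom_at[OF aP that])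
  have LEh: "laurent_expansion (\<lambda>w. f w ^ M * P i w) z = laurent_expansion f z ^ M * laurent_expansion (P i) z"
    if "z \<in> upper_half_plane" "i \<in> I" for z i
    using laurent_mult[OF autom_at[OF afM that(1)] autom_at[OF aP[OF that(2)] that(1)]] laurent_power[OF autom_at[OF f that(1)]] by simp
  have fnz: "laurent_expansion f z \<noteq> 0" if "z \<in> upper_half_plane" for z
    using autom_laurent_nonzero[OF f p fp(1) that] .
  have hsub: "fls_subdegree (laurent_expansion (\<lambda>w. f w ^ M * P i w) z) =
      int M * fls_subdegree (laurent_expansion f z) + fls_subdegree (laurent_expansion (P i) z) \<or>
      laurent_expansion (\<lambda>w. f w ^ M * P i w) z = 0"
    if "z \<in> upper_half_plane" "i \<in> I" for z i
    using fnz[OF that(1)] by (cases "laurent_expansion (P i) z = 0") (simp_all add: LEh[OF that] fls_subdegree_pow)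
  have hreg: "fls_subdegree (laurent_expansion (\<lambda>w. f w ^ M * P i w) z) \<ge> 0"
    if z: "z \<in> upper_half_plane" "\<not> eqv z p" and i: "i \<in> I" for z i
  proof (cases "eqv z (fst i)")
    case True
    have q: "fst i \<in> Q" "snd i \<ge> 1" "snd i \<le> M * e (fst i)" using i by (auto simp: I_def)
    hence qU: "fst i \<in> upper_half_plane" using Q by blast
    have "fls_subdegree (laurent_expansion (P i) z) = - int (snd i)"
      using autom_laurent(2)[OF aP[OF i] qU True] poincare_pole(2)[OF qU, of "snd i"] q by (simp add: P_def)
    moreover have "fls_subdegree (laurent_expansion f z) \<ge> int (e (fst i))"
      using autom_laurent(2)[OF f qU True] e[OF q(1)] by simp
    hence "int M * fls_subdegree (laurent_expansion f z) \<ge> int M * int (e (fst i))" by (intro mult_left_mono) auto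
    moreover have "int (snd i) \<le> int M * int (e (fst i))" using q(3) by (metis of_nat_le_iff of_nat_mult)
    ultimately show ?thesis using hsub[OF z(1) i] by auto
  next
    case False
    have "fst i \<in> upper_half_plane" using i Q by (auto simp: I_def)
    hence "fls_subdegree (laurent_expansion (P i) z) \<ge> 0"
      using poincare_analytic[OF _ z(1) False] by (simp add: P_def)
    moreover have "int M * fls_subdegree (laurent_expansion f z) \<ge> 0" using reg[OF z] by simp
    ultimately show ?thesis using hsub[OF z(1) i] by auto
  qed
  have Freg: "fls_subdegree (laurent_expansion F z) \<ge> 0" if z: "z \<in> upper_half_plane" "\<not> eqv z p" for z
    using hreg[OF z]
    by (intro fls_subdegree_ge0I) (auto simp: Fnth[OF z(1)] fls_nth_neg intro!: sum.neutral)
  have Fp: "laurent_expansion F p $$ i = 0" if "i < 0" for i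
  proof (cases "i < - int (M * n)")
    case True
    have "laurent_expansion (\<lambda>w. f w ^ M * P j w) p $$ i = 0" if j: "j \<in> I" for j
    proof -
      have qU: "fst j \<in> upper_half_plane" "\<not> eqv (fst j) p" using j Q by (auto simp: I_def)
      have "fls_subdegree (laurent_expansion (P j) p) \<ge> 0"
        unfolding P_def using poincare_analytic[OF qU(1) p] eqv_sym[OF _ qU(1), of p] qU(2) by blast
      hence "laurent_expansion (\<lambda>w. f w ^ M * P j w) p = 0 \<or>
         fls_subdegree (laurent_expansion (\<lambda>w. f w ^ M * P j w) p) > i"
        using hsub[OF p j] fp(2) True by auto
      thus ?thesis by auto
    qed
    thus ?thesis by (simp add: Fnth[OF p])
  next
    case False
    hence "(p, i) \<in> J'" using that by (auto simp: J'_def)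
    thus ?thesis using c(2) Fnth[OF p, of i] by force
  qed
  have cond: "\<forall>j\<in>J. laurent_expansion F (fst j) $$ snd j = 0"
    using c(2) J(2) Fnth by (force simp: J'_def)
  define a where "a = (\<lambda>w. F w / poincare p 1 w)"
  have a: "autom K 0 a" "\<And>z. z \<in> upper_half_plane \<Longrightarrow> \<not> eqv z p \<Longrightarrow> fls_subdegree (laurent_expansion a z) \<ge> 0"
    "laurent_expansion a p = laurent_expansion F p / laurent_expansion (poincare p 1) p"
    using division_testD[OF dt aF _ cond] Freg unfolding reg_off_def a_def by auto
  have Fp0: "laurent_expansion F p = 0"
  proof (rule ccontr)
    assume nz: "laurent_expansion F p \<noteq> 0"
    have "fls_subdegree (laurent_expansion F p) \<ge> 0" using Fp by (intro fls_subdegree_ge0I)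
    \<comment> \<open>F is regular at p and the denominator has a simple pole there, so the quotient
      vanishes at p.\<close>
    hence s: "fls_subdegree (laurent_expansion a p) \<ge> 1"
      unfolding a(3) using nz poincare_pole[OF p, of 1] by (simp add: fls_divide_subdegree)
    hence "laurent_expansion a p $$ 0 = 0" by simp
    moreover have "fls_subdegree (laurent_expansion a z) \<ge> 0" if "z \<in> upper_half_plane" for z
      using a(2)[OF that] autom_laurent(2)[OF a(1) p, of z] s by force
    ultimately have "laurent_expansion a p = 0" using autom0_holomorphic_const[OF a(1) p] by blast
    thus False using s by simp
  qed
  obtain q k where qk: "(q, k) \<in> I" "c (q, k) \<noteq> 0" using c(1) by auto
  \<comment> \<open>Series attached to other points of Q are regular at q, so the highest pole of H
    at q comes from the single term with the largest k.\<close>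
  define A where "A = {k. (q, k) \<in> I \<and> c (q, k) \<noteq> 0}"
  have A: "finite A" "A \<noteq> {}" using qk by (auto simp: A_def I_def intro: finite_subset[of _ "{1..M * e q}"])
  define k0 where "k0 = Max A"
  have k0: "k0 \<in> A" "\<And>k. k \<in> A \<Longrightarrow> k \<le> k0" using A by (auto simp: k0_def)
  have q: "q \<in> Q" "q \<in> upper_half_plane" using qk Q by (auto simp: I_def)
  have k0I: "(q, k0) \<in> I" "k0 \<ge> 1" "c (q, k0) \<noteq> 0" using k0 by (auto simp: A_def I_def)
  have "laurent_expansion F q = 0"
    using autom_laurent_nonzero[OF aF q(2) _ p] Fp0 by blast
  moreover have "laurent_expansion F q = laurent_expansion f q ^ M * laurent_expansion H q"
    unfolding FH using laurent_mult[OF autom_at[OF afM q(2)] autom_at[OF aH q(2)]] laurent_power[OF autom_at[OF f q(2)]] by simp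
  ultimately have "laurent_expansion H q = 0" using fnz[OF q(2)] by simp
  hence "0 = laurent_expansion H q $$ (- int k0)" by simp
  also have "\<dots> = c (q, k0) * laurent_expansion (P (q, k0)) q $$ (- int k0) +
      (\<Sum>j\<in>I - {(q, k0)}. c j * laurent_expansion (P j) q $$ (- int k0))"
    unfolding Hnth[OF q(2)] by (rule sum.remove[OF finI k0I(1)])
  also have "(\<Sum>j\<in>I - {(q, k0)}. c j * laurent_expansion (P j) q $$ (- int k0)) = 0"
  proof (rule sum.neutral, rule ballI)
    fix j assume j: "j \<in> I - {(q, k0)}"
    have jU: "fst j \<in> Q" "fst j \<in> upper_half_plane" "snd j \<ge> 1" using j Q by (auto simp: I_def)
    show "c j * laurent_expansion (P j) q $$ (- int k0) = 0"
    proof (cases "fst j = q")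
      case True
      show ?thesis
      proof (cases "c j = 0")
        case False
        hence "snd j \<in> A" using True j by (auto simp: A_def)
        hence "snd j < k0" using k0(2)[of "snd j"] j True by (cases j) (auto simp: le_less)
        hence "- int k0 < fls_subdegree (laurent_expansion (P j) q)"
          using poincare_pole(2)[OF q(2), of "snd j"] jU True by (simp add: P_def)
        thus ?thesis by simp
      qed simp
    next
      case False
      hence "\<not> eqv q (fst j)" using Q(4)[OF q(1) jU(1)] by blast
      hence "fls_subdegree (laurent_expansion (P j) q) \<ge> 0"
        unfolding P_def using poincare_analytic[OF jU(2) q(2)] by blast
      thus ?thesis using k0I(2) by simp
    qed
  qed
  finally show False
    using poincare_pole[OF q(2), of k0] k0I(2,3) nth_fls_subdegree_nonzero[of "laurent_expansion (poincare q k0) q"]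
    by (simp add: P_def)
qed

end

section \<open>Anti-invariant functions of an involution\<close>

text \<open>The i-th gap is at least i, so a vanishing sum of gamma_i - i leaves no slack. List
  positions start at 0, hence the bound \<open>Suc i\<close>.\<close>

lemma weierstrass_weight_zeroD:
  assumes fin: "finite (gaps K p)" and "weierstrass_weight K p = 0"
  shows "gaps K p = {1..card (gaps K p)}"
proof -
  define L where "L = sorted_list_of_set (gaps K p)"
  have L: "set L = gaps K p" "sorted L" "distinct L" "length L = card (gaps K p)"
    using fin by (auto simp: L_def)
  have ge: "L ! i \<ge> Suc i" if "i < length L" for i
    using that
  proof (induction i)
    case 0
    hence "L ! 0 \<in> gaps K p" using L(1) nth_mem by blast
    thus ?case by (auto simp: gaps_def)
  next
    case (Suc i)
    have "L ! i < L ! Suc i" using L(2,3) Suc.prems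
      by (metis Suc_lessD Suc_n_not_le_n le_neq_implies_less lessI nth_eq_iff_index_eq order_less_imp_le sorted_nth_mono)
    thus ?case using Suc by simp
  qed
  have "(\<Sum>i=1..length L. int (L ! (i - 1)) - int i) = 0"
    using assms(2) L(4) by (simp add: weierstrass_weight_def L_def)
  moreover have "\<forall>i\<in>{1..length L}. int (L ! (i - 1)) - int i \<ge> 0"
  proof
    fix i assume "i \<in> {1..length L}"
    thus "int (L ! (i - 1)) - int i \<ge> 0" using ge[of "i - 1"] by simp linarith
  qed
  ultimately have "\<forall>i\<in>{1..length L}. int (L ! (i - 1)) - int i = 0"
    using sum_nonneg_eq_0_iff[of "{1..length L}" "\<lambda>i. int (L ! (i - 1)) - int i"] by simp
  hence e: "L ! i = Suc i" if "i < length L" for i using that by (force dest: bspec[of _ _ "Suc i"])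
  have "set L = {1..length L}"
  proof
    show "set L \<subseteq> {1..length L}" using e by (auto simp: in_set_conv_nth)
    show "{1..length L} \<subseteq> set L"
    proof
      fix i assume "i \<in> {1..length L}"
      hence "i - 1 < length L" "L ! (i - 1) = i" using e[of "i - 1"] by auto
      thus "i \<in> set L" by (metis nth_mem)
    qed
  qed
  thus ?thesis using L by simp
qed

lemma card_odd_lessThan: "card {i. odd i \<and> i < 2 * a + 1} = (a::nat)"
proof -
  have "{i. odd i \<and> i < 2 * a + 1} = (\<lambda>j. 2 * j + 1) ` {..<a}" by (auto elim!: oddE)
  thus ?thesis by (simp add: card_image inj_on_def)
qed

text \<open>T lifts an involution of X to SL(2,R); the square -1 acts trivially on the
  half-plane.\<close>

locale fuchsian_involution = fuchsian +
  fixes T :: "real^2^2" and p :: complex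
  assumes det_T: "mdet T = 1"
    and T_sq: "T ** T = - mat 1"
    and normalizes: "\<And>k. k \<in> K \<Longrightarrow> T ** k ** madj T \<in> K"
    and p_U: "p \<in> upper_half_plane"
    and T_p: "mob_act T p = p"
begin

lemma T_U: "z \<in> upper_half_plane \<Longrightarrow> mob_act T z \<in> upper_half_plane"
  using mob_act_in_U det_T by blast

lemma T_T: "z \<in> upper_half_plane \<Longrightarrow> mob_act T (mob_act T z) = z"
  using mob_act_mult[OF det_T U_Im, of z T] T_sq by simp

lemma T_K:
  assumes "k \<in> K" "z \<in> upper_half_plane"
  shows "\<exists>k'\<in>K. mob_act T (mob_act k z) = mob_act k' (mob_act T z)"
proof (intro bexI)
  show "T ** k ** madj T \<in> K" using normalizes assms by blast
  have "mob_act (T ** k ** madj T) (mob_act T z) = mob_act ((T ** k ** madj T) ** T) z"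
    using mob_act_mult[OF det_T U_Im[OF assms(2)]] by simp
  also have "(T ** k ** madj T) ** T = T ** k"
    using madj_mult(1)[OF det_T] by (simp flip: matrix_mul_assoc)
  also have "mob_act (T ** k) z = mob_act T (mob_act k z)"
    using mob_act_mult[OF det_K[OF assms(1)] U_Im[OF assms(2)]] .
  finally show "mob_act T (mob_act k z) = mob_act (T ** k ** madj T) (mob_act T z)" ..
qed

lemma eqv_T: "eqv z w \<Longrightarrow> w \<in> upper_half_plane \<Longrightarrow> eqv (mob_act T z) (mob_act T w)"
  unfolding eqv_def using T_K by blast

lemma autom_T:
  assumes "autom K 0 f" shows "autom K 0 (\<lambda>w. f (mob_act T w))"
  unfolding autom_def
proof (intro conjI ballI)
  show "(\<lambda>w. f (mob_act T w)) meromorphic_on upper_half_plane"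
    by (rule meromorphic_on_compose[OF autom_meromorphic[OF assms] mob_act_analytic[OF det_T]]) (use T_U in auto)
  fix k z assume k: "k \<in> K" and z: "z \<in> upper_half_plane"
  define k' where "k' = T ** k ** madj T"
  have k': "k' \<in> K" using normalizes k by (simp add: k'_def)
  have e: "mob_act T (mob_act k w) = mob_act k' (mob_act T w)" if "w \<in> upper_half_plane" for w
  proof -
    have "mob_act k' (mob_act T w) = mob_act (k' ** T) w"
      using mob_act_mult[OF det_T U_Im[OF that]] by simp
    also have "k' ** T = T ** k"
      unfolding k'_def using madj_mult(1)[OF det_T] by (simp flip: matrix_mul_assoc)
    also have "mob_act (T ** k) w = mob_act T (mob_act k w)"
      using mob_act_mult[OF det_K[OF k] U_Im[OF that]] .
    finally show ?thesis ..
  qed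
  have "\<forall>\<^sub>F w in at (mob_act T z). f (mob_act k' w) = f w"
    using assms k' T_U[OF z] by (auto simp: autom_def)
  hence "\<forall>\<^sub>F w in at z. f (mob_act k' (mob_act T w)) = f (mob_act T w)"
    unfolding filtermap_mob_act_at[OF det_T z, symmetric] by (simp add: eventually_filtermap)
  thus "\<forall>\<^sub>F w in at z. f (mob_act T (mob_act k w)) = mden k w ^ 0 * f (mob_act T w)"
    using eventually_at_in_open'[OF open_upper_half_plane z] by eventually_elim (simp add: e)
qed

lemma laurent_mob:
  assumes "f meromorphic_on upper_half_plane" "mdet S = 1" "z \<in> upper_half_plane"
  shows "laurent_expansion (\<lambda>w. f (mob_act S w)) z = 0 \<longleftrightarrow> laurent_expansion f (mob_act S z) = 0"
    and "fls_subdegree (laurent_expansion (\<lambda>w. f (mob_act S w)) z) = fls_subdegree (laurent_expansion f (mob_act S z))"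
    and "fls_subdegree (laurent_expansion f (mob_act S z)) = n \<Longrightarrow>
      laurent_expansion (\<lambda>w. f (mob_act S w)) z $$ n = (1 / (mden S z)\<^sup>2) powi n * laurent_expansion f (mob_act S z) $$ n"
proof -
  have fm: "f meromorphic_on {mob_act S z}"
    using assms meromorphic_atI mob_act_in_U by blast
  have an: "mob_act S analytic_on {z}"
    using mob_act_analytic[OF assms(2)] assms(3) analytic_on_subset by blast
  have "1 / (mden S z)\<^sup>2 \<noteq> 0" using mden_nonzero[OF assms(2) U_Im[OF assms(3)]] by simp
  note L = laurent_compose[OF fm an filtermap_mob_act_at[OF assms(2,3)] mob_act_has_derivative[OF assms(2) U_Im[OF assms(3)]] this]
  show "laurent_expansion (\<lambda>w. f (mob_act S w)) z = 0 \<longleftrightarrow> laurent_expansion f (mob_act S z) = 0" by (rule L(1))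
  show "fls_subdegree (laurent_expansion (\<lambda>w. f (mob_act S w)) z) = fls_subdegree (laurent_expansion f (mob_act S z))" by (rule L(2))
  show "fls_subdegree (laurent_expansion f (mob_act S z)) = n \<Longrightarrow>
      laurent_expansion (\<lambda>w. f (mob_act S w)) z $$ n = (1 / (mden S z)\<^sup>2) powi n * laurent_expansion f (mob_act S z) $$ n"
    by (rule L(3))
qed

definition anti_invariant :: "(complex \<Rightarrow> complex) \<Rightarrow> bool" where
  "anti_invariant f \<longleftrightarrow> autom K 0 f \<and> (\<forall>z\<in>upper_half_plane. \<forall>\<^sub>F w in at z. f (mob_act T w) = - f w)"

lemma laurent_uminus: "f meromorphic_on {z} \<Longrightarrow> laurent_expansion (\<lambda>w. - f w) z = - laurent_expansion f z"
  by (rule laurent_expansion_eqI) (intro laurent_expansion_intros laurent_has)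

lemma anti_invariant_laurent:
  assumes "anti_invariant f" "z \<in> upper_half_plane"
  shows "laurent_expansion (\<lambda>w. f (mob_act T w)) z = - laurent_expansion f z"
proof -
  have "laurent_expansion (\<lambda>w. f (mob_act T w)) z = laurent_expansion (\<lambda>w. - f w) z"
    by (rule laurent_expansion_cong) (use assms in \<open>auto simp: anti_invariant_def\<close>)
  thus ?thesis using laurent_uminus autom_at assms by (auto simp: anti_invariant_def)
qed

lemma anti_invariant_T:
  assumes "anti_invariant f" "z \<in> upper_half_plane"
  shows "laurent_expansion f (mob_act T z) = 0 \<longleftrightarrow> laurent_expansion f z = 0"
    "fls_subdegree (laurent_expansion f (mob_act T z)) = fls_subdegree (laurent_expansion f z)"
  using laurent_mob(1,2)[OF autom_meromorphic det_T assms(2), of K 0 f] anti_invariant_laurent[OF assms] assms(1)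
  by (auto simp: anti_invariant_def)

text \<open>S has derivative -1 at w, so composition multiplies the leading coefficient by (-1)^n,
  while the hypothesis on f multiplies it by -1.\<close>

lemma rotation_order_odd:
  assumes f: "anti_invariant f" and S: "mdet S = 1" "mob_act S w = w" "(mden S w)\<^sup>2 = -1"
    and fS: "\<forall>\<^sub>F u in at w. f (mob_act S u) = - f u" and w: "w \<in> upper_half_plane"
    and nz: "laurent_expansion f w \<noteq> 0"
  shows "odd (fls_subdegree (laurent_expansion f w))"
proof
  define n where "n = fls_subdegree (laurent_expansion f w)"
  assume "even (fls_subdegree (laurent_expansion f w))"
  hence ev: "even n" by (simp add: n_def)
  have a: "autom K 0 f" using f by (simp add: anti_invariant_def)
  have "laurent_expansion (\<lambda>u. f (mob_act S u)) w = - laurent_expansion f w"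
    using laurent_expansion_cong[OF fS refl] laurent_uminus[OF autom_at[OF a w]] by simp
  moreover have "laurent_expansion (\<lambda>u. f (mob_act S u)) w $$ n = (1 / (mden S w)\<^sup>2) powi n * laurent_expansion f w $$ n"
    using laurent_mob(3)[OF autom_meromorphic[OF a] S(1) w, of n] S(2) by (simp add: n_def)
  ultimately have "- (laurent_expansion f w $$ n) = laurent_expansion f w $$ n"
    using ev by (simp add: S(3) power_int_minus_left)
  hence "laurent_expansion f w $$ n = 0" by simp
  thus False using nz by (simp add: n_def)
qed

text \<open>The cocycle relation at a fixed point: the square is the factor of S S = -1, which is
  -1.\<close>

lemma mden_sq_minus_one:
  assumes "mdet S = 1" "S ** S = - mat 1" "mob_act S w = w" "w \<in> upper_half_plane"
  shows "(mden S w)\<^sup>2 = -1"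
  using mden_mult[OF assms(1) U_Im[OF assms(4)], of S] assms
  by (simp add: power2_eq_square) (simp add: mden_def)

text \<open>T fixes w only modulo K. Following T by the element of K that brings T w back to w gives
  a genuine rotation S about w, and K-invariant functions do not distinguish S from T.\<close>

lemma fixed_rotation:
  assumes w: "w \<in> upper_half_plane" "eqv (mob_act T w) w"
  obtains S where "mdet S = 1" "mob_act S w = w" "(mden S w)\<^sup>2 = -1"
    "\<And>f. anti_invariant f \<Longrightarrow> \<forall>\<^sub>F u in at w. f (mob_act S u) = - f u"
proof -
  obtain k' where k': "k' \<in> K" "mob_act T w = mob_act k' w" using w(2) by (auto simp: eqv_def)
  define k where "k = madj k'"
  have k: "k \<in> K" using madj_K k' by (simp add: k_def)
  define S where "S = k ** T"
  have d: "mdet S = 1" using det_K[OF k] det_T by (simp add: S_def mdet_mult)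
  have act: "mob_act S u = mob_act k (mob_act T u)" if "u \<in> upper_half_plane" for u
    unfolding S_def using mob_act_mult[OF det_T U_Im[OF that]] .
  have fx: "mob_act S w = w"
    using act[OF w(1)] mob_act_madj(1)[OF det_K[OF k'(1)] U_Im[OF w(1)]] k'(2) by (simp add: k_def)
  \<comment> \<open>T normalizes K, so S^2 is in K; as it fixes w, it is 1 or -1.\<close>
  have "S ** S = k ** (T ** k ** madj T) ** (T ** T)"
  proof -
    have "k ** (T ** k ** madj T) ** (T ** T) = k ** T ** k ** (madj T ** T) ** T"
      by (simp add: matrix_mul_assoc)
    thus ?thesis using madj_mult(1)[OF det_T] by (simp add: S_def matrix_mul_assoc)
  qed
  moreover have "k ** (T ** k ** madj T) ** (T ** T) \<in> K"
    unfolding T_sq by (intro mult_K k normalizes minus_one_K)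
  ultimately have SS: "S ** S \<in> K" by simp
  moreover have "mob_act (S ** S) w = w" using mob_act_mult[OF d U_Im[OF w(1)], of S] fx by simp
  ultimately consider "S ** S = mat 1" | "S ** S = - mat 1" using torsion_free w(1) by blast
  hence "S ** S = - mat 1"
  proof cases
    case 1
    \<comment> \<open>If S^2 = 1, then S is its own adjugate, hence 1 or -1, and T lies in K. But T
      fixes p, so T would be 1 or -1, contrary to T^2 = -1.\<close>
    have "madj S ** (S ** S) = S" using madj_mult(1)[OF d] by (simp add: matrix_mul_assoc)
    hence "madj S = S" unfolding 1 by simp
    hence "madj S $1$2 = S$1$2" "madj S $2$1 = S$2$1" "madj S $1$1 = S$1$1" by simp_all
    hence s: "S$1$2 = 0" "S$2$1 = 0" "S$2$2 = S$1$1" by simp_all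
    hence "S$1$1 * S$1$1 = 1" using d by (simp add: mdet_def)
    hence "S$1$1 = 1 \<or> S$1$1 = -1" by (simp add: square_eq_1_iff)
    hence "S = mat 1 \<or> S = - mat 1" using s by (auto simp: mat_eq_22_iff)
    hence "S \<in> K" using one_K minus_one_K by blast
    have "madj k ** S = T" using madj_mult(1)[OF det_K[OF k]] by (simp add: S_def matrix_mul_assoc)
    hence "T \<in> K" using mult_K[OF madj_K[OF k] \<open>S \<in> K\<close>] by simp
    hence "T = mat 1 \<or> T = - mat 1" using torsion_free[OF _ p_U T_p] by blast
    hence "T ** T = mat 1" by (auto simp: mat_eq_22_iff matrix_mult_22)
    thus ?thesis using T_sq by (simp add: mat_eq_22_iff)
  qed
  hence "(mden S w)\<^sup>2 = -1" using mden_sq_minus_one[OF d _ fx w(1)] by blast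
  moreover have "\<forall>\<^sub>F u in at w. f (mob_act S u) = - f u" if f: "anti_invariant f" for f
  proof -
    have "\<forall>\<^sub>F u in at (mob_act T w). f (mob_act k u) = f u"
      using f k T_U[OF w(1)] by (auto simp: anti_invariant_def autom_def)
    hence "\<forall>\<^sub>F u in at w. f (mob_act k (mob_act T u)) = f (mob_act T u)"
      unfolding filtermap_mob_act_at[OF det_T w(1), symmetric] by (simp add: eventually_filtermap)
    moreover have "\<forall>\<^sub>F u in at w. f (mob_act T u) = - f u" using f w(1) by (auto simp: anti_invariant_def)
    ultimately show ?thesis
      using eventually_at_in_open'[OF open_upper_half_plane w(1)] by eventually_elim (simp add: act)
  qed
  ultimately show ?thesis using that d fx by blast
qed

lemma anti_invariant_order_odd:
  assumes "anti_invariant f" "w \<in> upper_half_plane" "eqv (mob_act T w) w" "laurent_expansion f w \<noteq> 0"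
  shows "odd (fls_subdegree (laurent_expansion f w))"
proof -
  obtain S where S: "mdet S = 1" "mob_act S w = w" "(mden S w)\<^sup>2 = -1"
    "\<And>f. anti_invariant f \<Longrightarrow> \<forall>\<^sub>F u in at w. f (mob_act S u) = - f u"
    using fixed_rotation[OF assms(2,3)] by metis
  show ?thesis by (rule rotation_order_odd[OF assms(1) S(1-3) S(4)[OF assms(1)] assms(2,4)])
qed

text \<open>When u(T w) is subtracted from u(w), the leading terms at p reinforce each other,
  because T has derivative -1 at p and n is odd.\<close>

lemma anti_invariant_of_odd_nongap:
  assumes n: "odd n" "n \<notin> gaps K p"
  obtains f where "anti_invariant f" "laurent_expansion f p \<noteq> 0" "fls_subdegree (laurent_expansion f p) = - int n" "reg_off p f"
proof -
  have n1: "n \<ge> 1" using n(1) by (cases n) auto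
  obtain u where u: "autom K 0 u" "fls_subdegree (laurent_expansion u p) = - int n"
    "\<And>z. z \<in> upper_half_plane \<Longrightarrow> \<not> eqv z p \<Longrightarrow> fls_subdegree (laurent_expansion u z) \<ge> 0"
    using not_gapD[OF p_U n1 n(2)] by metis
  define v where "v = (\<lambda>w. u (mob_act T w))"
  define f where "f = (\<lambda>w. u w - v w)"
  have av: "autom K 0 v" unfolding v_def by (rule autom_T[OF u(1)])
  have LEf: "laurent_expansion f z = laurent_expansion u z - laurent_expansion v z" if "z \<in> upper_half_plane" for z
    unfolding f_def by (rule laurent_diff[OF autom_at[OF u(1) that] autom_at[OF av that]])
  have "autom K 0 f" unfolding autom_def
  proof (intro conjI ballI)
    show "f meromorphic_on upper_half_plane"
      unfolding f_def by (intro meromorphic_intros autom_meromorphic[OF u(1)] autom_meromorphic[OF av])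
    fix k z assume "k \<in> K" "z \<in> upper_half_plane"
    hence "\<forall>\<^sub>F w in at z. u (mob_act k w) = mden k w ^ 0 * u w" "\<forall>\<^sub>F w in at z. v (mob_act k w) = mden k w ^ 0 * v w"
      using u(1) av by (auto simp: autom_def)
    thus "\<forall>\<^sub>F w in at z. f (mob_act k w) = mden k w ^ 0 * f w"
      by eventually_elim (simp add: f_def)
  qed
  moreover have "\<forall>\<^sub>F w in at z. f (mob_act T w) = - f w" if "z \<in> upper_half_plane" for z
    using eventually_at_in_open'[OF open_upper_half_plane that]
    by eventually_elim (simp add: f_def v_def T_T)
  ultimately have anti_invariant_f: "anti_invariant f" by (simp add: anti_invariant_def)
  have unz: "laurent_expansion u p $$ (- int n) \<noteq> 0"
    using u(2) n1 nth_fls_subdegree_nonzero[of "laurent_expansion u p"] by (cases "laurent_expansion u p = 0") auto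
  have sv: "fls_subdegree (laurent_expansion v p) = - int n"
    unfolding v_def using laurent_mob(2)[OF autom_meromorphic[OF u(1)] det_T p_U] u(2) T_p by simp
  have "laurent_expansion v p $$ (- int n) = (1 / (mden T p)\<^sup>2) powi (- int n) * laurent_expansion u p $$ (- int n)"
    unfolding v_def using laurent_mob(3)[OF autom_meromorphic[OF u(1)] det_T p_U, of "- int n"] u(2) T_p by simp
  also have "\<dots> = - (laurent_expansion u p $$ (- int n))"
    using n(1) by (simp add: mden_sq_minus_one[OF det_T T_sq T_p p_U] power_int_minus)
  finally have "laurent_expansion f p $$ (- int n) \<noteq> 0" using unz by (simp add: LEf[OF p_U])
  moreover have "laurent_expansion f p $$ i = 0" if "i < - int n" for i
    using that u(2) sv by (simp add: LEf[OF p_U])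
  ultimately have ordf: "laurent_expansion f p \<noteq> 0" "fls_subdegree (laurent_expansion f p) = - int n"
    by (auto intro: fls_subdegree_eqI)
  have "reg_off p f" unfolding reg_off_def
  proof (intro ballI impI)
    fix z assume z: "z \<in> upper_half_plane" "\<not> eqv z p"
    have "\<not> eqv (mob_act T z) p"
    proof
      assume "eqv (mob_act T z) p"
      from eqv_T[OF this p_U] show False using z by (simp add: T_T T_p)
    qed
    hence "fls_subdegree (laurent_expansion v z) \<ge> 0"
      unfolding v_def using laurent_mob(2)[OF autom_meromorphic[OF u(1)] det_T z(1)] u(3)[OF T_U[OF z(1)]] by simp
    thus "fls_subdegree (laurent_expansion f z) \<ge> 0"
      using u(3)[OF z] by (intro fls_subdegree_ge0I) (simp add: LEf[OF z(1)])
  qed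
  thus ?thesis using that anti_invariant_f ordf by blast
qed

end

section \<open>The count of conditions at the zeros of an anti-invariant function\<close>

context fuchsian_involution
begin

theorem weierstrass_of_fixed_points:
  assumes W: "W \<subseteq> upper_half_plane" "card W = 4"
    "\<And>w w'. w \<in> W \<Longrightarrow> w' \<in> W \<Longrightarrow> eqv w w' \<Longrightarrow> w = w'"
    "\<And>w. w \<in> W \<Longrightarrow> \<not> eqv w p" "\<And>w. w \<in> W \<Longrightarrow> eqv (mob_act T w) w"
  shows "weierstrass_point K p"
proof (rule ccontr)
  assume "\<not> weierstrass_point K p"
  define m where "m = card (gaps K p)"
  have gaps: "gaps K p = {1..m}"
    using weierstrass_weight_zeroD[OF finite_gaps[OF p_U]] \<open>\<not> weierstrass_point K p\<close>
    by (simp add: weierstrass_point_def m_def)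
  \<comment> \<open>The least odd number above m; all n + 2 t are then odd nongaps as well.\<close>
  define n where "n = (if odd (m + 1) then m + 1 else m + 2)"
  have n: "odd n" "m < n" "n \<le> m + 2" by (auto simp: n_def)
  obtain f where f: "anti_invariant f" "laurent_expansion f p \<noteq> 0" "fls_subdegree (laurent_expansion f p) = - int n" "reg_off p f"
    using anti_invariant_of_odd_nongap[of n] n gaps by force
  have af: "autom K 0 f" using f(1) by (simp add: anti_invariant_def)
  have fnz: "laurent_expansion f z \<noteq> 0" if "z \<in> upper_half_plane" for z
    using autom_laurent_nonzero[OF af p_U f(2) that] .
  define ordf where "ordf = (\<lambda>z. fls_subdegree (laurent_expansion f z))"
  have o_ge: "ordf z \<ge> 0" if "z \<in> upper_half_plane" "\<not> eqv z p" for z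
    using f(4) that by (simp add: reg_off_def ordf_def)
  have o_eqv: "ordf z = ordf w" if "eqv z w" "w \<in> upper_half_plane" for z w
    unfolding ordf_def using autom_laurent(2)[OF af that(2,1)] .
  have o_T: "ordf (mob_act T z) = ordf z" if "z \<in> upper_half_plane" for z
    unfolding ordf_def using anti_invariant_T(2)[OF f(1) that] .
  obtain S where S: "finite S" "S \<subseteq> upper_half_plane"
    "\<And>z. z \<in> upper_half_plane \<Longrightarrow> (\<And>w. eqv w z \<Longrightarrow> fls_subdegree (laurent_expansion f w) \<noteq> 0) \<Longrightarrow> \<exists>s\<in>S. eqv s z"
    using zero_reps[OF autom_meromorphic[OF af] fnz] by metis
  define N where "N = {s\<in>S. \<not> eqv s p}"
  have N: "finite N" "N \<subseteq> upper_half_plane" using S by (auto simp: N_def)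
  have coverN: "\<exists>s\<in>N. eqv s z" if z: "z \<in> upper_half_plane" "\<not> eqv z p" "ordf z \<noteq> 0" for z
  proof -
    have "\<exists>s\<in>S. eqv s z"
      by (rule S(3)[OF z(1)]) (use o_eqv[OF _ z(1)] z(3) in \<open>auto simp: ordf_def\<close>)
    then obtain s where s: "s \<in> S" "eqv s z" by blast
    moreover have "\<not> eqv s p" using eqv_trans[OF eqv_sym[OF s(2) z(1)] _ p_U] z(2) by blast
    ultimately show ?thesis by (auto simp: N_def)
  qed
  \<comment> \<open>Equivalence under K and T together. R takes one zero of f from each class; A
    collects those whose point on X is fixed by T, B those that T exchanges with another
    point.\<close>
  define E where "E = (\<lambda>z w. eqv z w \<or> eqv z (mob_act T w))"
  have E_sym: "E w z" if "E z w" "z \<in> upper_half_plane" "w \<in> upper_half_plane" for z w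
    using that(1) unfolding E_def
  proof
    assume "eqv z w" thus "eqv w z \<or> eqv w (mob_act T z)" using eqv_sym that(3) by blast
  next
    assume "eqv z (mob_act T w)"
    hence "eqv (mob_act T z) w" using eqv_T[OF _ T_U[OF that(3)]] T_T[OF that(3)] by metis
    thus "eqv w z \<or> eqv w (mob_act T z)" using eqv_sym that(3) by blast
  qed
  have E_trans: "E a c" if "E a b" "E b c" "a \<in> upper_half_plane" "b \<in> upper_half_plane" "c \<in> upper_half_plane" for a b c
  proof -
    have 1: "eqv (mob_act T b) (mob_act T c)" if "eqv b c" using eqv_T[OF that \<open>c \<in> upper_half_plane\<close>] .
    have 2: "eqv (mob_act T b) c" if "eqv b (mob_act T c)"
      using eqv_T[OF that T_U] T_T \<open>c \<in> upper_half_plane\<close> by metis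
    show ?thesis using that(1,2) 1 2 eqv_trans T_U[OF that(5)] that(5) unfolding E_def by blast
  qed
  have "\<exists>R\<subseteq>N. (\<forall>s\<in>N. \<exists>r\<in>R. E s r) \<and> (\<forall>r\<in>R. \<forall>r'\<in>R. E r r' \<longrightarrow> r = r')"
  proof (rule finite_representatives)
    show "E a a" for a using eqv_refl by (simp add: E_def)
    show "E b a" if "a \<in> N" "b \<in> N" "E a b" for a b using E_sym that N(2) by blast
    show "E a c" if "a \<in> N" "b \<in> N" "c \<in> N" "E a b" "E b c" for a b c
      by (rule E_trans[OF that(4,5)]) (use that N(2) in auto)
  qed
  then obtain R where R: "R \<subseteq> N" "\<And>s. s \<in> N \<Longrightarrow> \<exists>r\<in>R. E s r" "\<And>r r'. r \<in> R \<Longrightarrow> r' \<in> R \<Longrightarrow> E r r' \<Longrightarrow> r = r'"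
    by metis
  have finR: "finite R" using R(1) N(1) finite_subset by blast
  have RU: "r \<in> upper_half_plane" if "r \<in> R" for r using that R(1) N(2) by blast
  have Rp: "\<not> eqv r p" if "r \<in> R" for r using that R(1) by (auto simp: N_def)
  have TRp: "\<not> eqv (mob_act T r) p" if "r \<in> R" for r
  proof
    assume "eqv (mob_act T r) p"
    from eqv_T[OF this p_U] show False using Rp[OF that] RU[OF that] by (simp add: T_T T_p)
  qed
  define A where "A = {r\<in>R. eqv (mob_act T r) r}"
  define B where "B = R - A"
  have AB: "A \<subseteq> R" "B \<subseteq> R" "finite A" "finite B" "A \<inter> B = {}" "A \<union> B = R"
    using finR by (auto simp: A_def B_def)
  have odd_o: "odd (ordf w)" if "w \<in> upper_half_plane" "eqv (mob_act T w) w" for w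
    using anti_invariant_order_odd[OF f(1) that fnz[OF that(1)]] by (simp add: ordf_def)
  \<comment> \<open>The order of f is odd, hence nonzero, at each of the four fixed points, so each
    of them is represented in A.\<close>
  have cardA: "card A \<ge> 4"
  proof -
    have "\<exists>r\<in>A. eqv w r" if w: "w \<in> W" for w
    proof -
      have wU: "w \<in> upper_half_plane" using w W by blast
      have "odd (ordf w)" using odd_o[OF wU W(5)[OF w]] .
      hence "ordf w \<noteq> 0" by auto
      then obtain s where s: "s \<in> N" "eqv s w" using coverN[OF wU W(4)[OF w]] by blast
      then obtain r where r: "r \<in> R" "E s r" using R(2) by blast
      have sU: "s \<in> upper_half_plane" using s N by blast
      have Trr: "eqv (mob_act T r) r"
      proof -
        have "E w r" using E_trans[OF _ r(2) wU sU RU[OF r(1)]] eqv_sym[OF s(2) wU] by (simp add: E_def)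
        thus ?thesis unfolding E_def
        proof
          assume a: "eqv w r"
          have "eqv (mob_act T r) (mob_act T w)" using eqv_T[OF eqv_sym[OF a RU[OF r(1)]] wU] .
          from eqv_trans[OF eqv_trans[OF this W(5)[OF w] wU] a RU[OF r(1)]] show ?thesis .
        next
          assume a: "eqv w (mob_act T r)"
          have b: "eqv (mob_act T w) r" using eqv_T[OF a T_U[OF RU[OF r(1)]]] T_T[OF RU[OF r(1)]] by simp
          from eqv_trans[OF eqv_sym[OF a T_U[OF RU[OF r(1)]]] eqv_sym[OF W(5)[OF w] wU] T_U[OF wU]]
          have "eqv (mob_act T r) (mob_act T w)" .
          from eqv_trans[OF this b RU[OF r(1)]] show ?thesis .
        qed
      qed
      have sr: "eqv s r" using r(2) eqv_trans[OF _ Trr RU[OF r(1)]] unfolding E_def by blast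
      have "eqv w r" using eqv_trans[OF eqv_sym[OF s(2) wU] sr RU[OF r(1)]] .
      thus ?thesis using r(1) Trr by (auto simp: A_def)
    qed
    then obtain g where g: "\<And>w. w \<in> W \<Longrightarrow> g w \<in> A \<and> eqv w (g w)" by metis
    have "inj_on g W"
    proof (rule inj_onI)
      fix w w' assume w: "w \<in> W" "w' \<in> W" "g w = g w'"
      have "g w \<in> upper_half_plane" "w' \<in> upper_half_plane" using g[OF w(1)] AB RU w W by auto
      hence "eqv w w'" using eqv_trans[OF _ eqv_sym] g[OF w(1)] g[OF w(2)] w(3) by metis
      thus "w = w'" using W(3) w by blast
    qed
    moreover have "g ` W \<subseteq> A" using g by blast
    ultimately show ?thesis using card_inj_on_le[of g W A] AB(3) W(2) by simp
  qed
  define e where "e = (\<lambda>z. nat (ordf z))"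
  have e: "int (e z) = ordf z" if "z \<in> upper_half_plane" "\<not> eqv z p" for z using o_ge[OF that] by (simp add: e_def)
  have injT: "inj_on (mob_act T) B"
    by (rule inj_onI) (metis AB(2) RU T_T subsetD)
  \<comment> \<open>A point of B counts twice: its image under T is another point of X, with the
    same order.\<close>
  have deg: "(\<Sum>r\<in>A. e r) + 2 * (\<Sum>r\<in>B. e r) \<le> n"
  proof -
    define Q where "Q = R \<union> mob_act T ` B"
    have RT: False if "r \<in> R" "b \<in> B" "eqv r (mob_act T b)" for r b
    proof -
      have "r = b" using R(3)[of r b] that AB(2) by (auto simp: E_def)
      hence "eqv (mob_act T b) b" using that eqv_sym[OF _ T_U[OF RU]] by blast
      thus False using that(2) AB(2) by (auto simp: A_def B_def)
    qed
    have "(\<Sum>q\<in>Q. e q) \<le> n"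
    proof (rule zeros_le_pole_order[OF p_U af f(2,3)])
      show "fls_subdegree (laurent_expansion f z) \<ge> 0" if "z \<in> upper_half_plane" "\<not> eqv z p" for z
        using o_ge[OF that] by (simp add: ordf_def)
      show "finite Q" using finR AB(4) by (simp add: Q_def)
      show QU: "Q \<subseteq> upper_half_plane" unfolding Q_def using RU T_U AB(2) by blast
      show Qp: "\<not> eqv q p" if "q \<in> Q" for q using that Rp TRp AB(2) unfolding Q_def by blast
      show "int (e q) \<le> fls_subdegree (laurent_expansion f q)" if "q \<in> Q" for q
        using e[of q] QU Qp[OF that] that by (auto simp: ordf_def)
      show "q = q'" if q: "q \<in> Q" "q' \<in> Q" "eqv q q'" for q q'
      proof -
        have q'U: "q' \<in> upper_half_plane" using q QU by blast
        consider "q \<in> R" "q' \<in> R" | b where "q \<in> R" "b \<in> B" "q' = mob_act T b"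
          | b where "b \<in> B" "q = mob_act T b" "q' \<in> R" | b b' where "b \<in> B" "q = mob_act T b" "b' \<in> B" "q' = mob_act T b'"
          using q unfolding Q_def by blast
        thus ?thesis
        proof cases
          case 1 thus ?thesis using R(3) q(3) by (auto simp: E_def)
        next
          case 2 thus ?thesis using RT q(3) by blast
        next
          case 3
          have "eqv q' (mob_act T b)" using eqv_sym[OF q(3) q'U] 3 by simp
          thus ?thesis using RT 3 by blast
        next
          case 4
          have "b \<in> upper_half_plane" "b' \<in> upper_half_plane" using 4 AB(2) RU by auto
          hence "eqv b b'" using eqv_T[OF q(3) q'U] 4 by (simp add: T_T)
          hence "b = b'" using R(3)[of b b'] 4 AB(2) by (auto simp: E_def)
          thus ?thesis using 4 by simp
        qed
      qed
    qed
    moreover have "R \<inter> mob_act T ` B = {}" using RT eqv_refl by blast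
    hence "(\<Sum>q\<in>Q. e q) = (\<Sum>r\<in>R. e r) + (\<Sum>r\<in>mob_act T ` B. e r)"
      unfolding Q_def using finR AB(4) by (intro sum.union_disjoint) auto
    moreover have "(\<Sum>r\<in>R. e r) = (\<Sum>r\<in>A. e r) + (\<Sum>r\<in>B. e r)"
      using sum.union_disjoint[OF AB(3,4,5), of e] AB(6) by simp
    moreover have "(\<Sum>r\<in>mob_act T ` B. e r) = (\<Sum>r\<in>B. e r)"
      unfolding sum.reindex[OF injT] ordf_def
      by (rule sum.cong) (use o_T RU AB(2) in \<open>auto simp: e_def ordf_def\<close>)
    ultimately show ?thesis by simp
  qed
  \<comment> \<open>Conditions for F to vanish to order e r. At points of A the order of F is odd,
    so only the odd coefficients are tested, which are (e r - 1) / 2 in number.\<close>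
  define J where "J = (SIGMA r:A. {i. odd i \<and> i < e r}) \<union> (SIGMA r:B. {..<e r})"
  have finJ: "finite J" using AB by (auto simp: J_def)
  have eodd: "odd (e r)" if "r \<in> A" for r
  proof -
    have "r \<in> R" "eqv (mob_act T r) r" using that by (auto simp: A_def)
    hence "odd (ordf r)" "int (e r) = ordf r" using odd_o[OF RU] e[OF RU Rp] by auto
    thus ?thesis by presburger
  qed
  have "card J = (\<Sum>r\<in>A. card {i. odd i \<and> i < e r}) + (\<Sum>r\<in>B. e r)"
    unfolding J_def using AB by (subst card_Un_disjoint) (auto simp: card_SigmaI)
  moreover have "2 * card {i. odd i \<and> i < e r} + 1 = e r" if "r \<in> A" for r
    using eodd[OF that] card_odd_lessThan by (auto elim!: oddE)
  hence "2 * (\<Sum>r\<in>A. card {i. odd i \<and> i < e r}) + card A = (\<Sum>r\<in>A. e r)"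
    by (simp add: sum_distrib_left card_eq_sum flip: sum.distrib del: sum_constant)
  ultimately have "2 * card J + 4 \<le> n" using deg cardA by simp
  \<comment> \<open>n is odd, so the even bound 2 card J + 4 improves by one.\<close>
  hence cJ: "2 * card J + 5 \<le> n" using n(1) by presburger
  \<comment> \<open>One unknown more than conditions. Then 2 t <= 2 card J + 2 <= n - 3 < m, which
    keeps the final pole order 2 t among the gaps.\<close>
  define I where "I = {1..Suc (card J)}"
  have "\<exists>u. anti_invariant u \<and> laurent_expansion u p \<noteq> 0 \<and> fls_subdegree (laurent_expansion u p) = - int (n + 2 * t) \<and> reg_off p u"
    if "t \<in> I" for t
  proof -
    have "odd (n + 2 * t)" "n + 2 * t \<notin> gaps K p" using n gaps by auto
    from anti_invariant_of_odd_nongap[OF this] show ?thesis by metis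
  qed
  then obtain u where u: "\<And>t. t \<in> I \<Longrightarrow> anti_invariant (u t)" "\<And>t. t \<in> I \<Longrightarrow> laurent_expansion (u t) p \<noteq> 0"
    "\<And>t. t \<in> I \<Longrightarrow> fls_subdegree (laurent_expansion (u t) p) = - int (n + 2 * t)" "\<And>t. t \<in> I \<Longrightarrow> reg_off p (u t)"
    by metis
  have finI: "finite I" "card J < card I" by (auto simp: I_def)
  have au: "autom K 0 (u t)" if "t \<in> I" for t using u(1)[OF that] by (simp add: anti_invariant_def)
  obtain c where c: "\<exists>t\<in>I. c t \<noteq> 0"
    "\<forall>j\<in>J. (\<Sum>t\<in>I. c t * laurent_expansion (u t) (fst j) $$ int (snd j)) = 0"
    using underdetermined_homogeneous_system[OF finI(1) finJ finI(2), of "\<lambda>j t. laurent_expansion (u t) (fst j) $$ int (snd j)"]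
    by auto
  define F where "F = (\<lambda>w. \<Sum>t\<in>I. c t * u t w)"
  have aF: "autom K 0 F" unfolding F_def by (rule autom_lincomb[OF finI(1) au])
  have antiF: "anti_invariant F" unfolding anti_invariant_def
  proof (intro conjI aF ballI)
    fix z assume "z \<in> upper_half_plane"
    hence "\<forall>\<^sub>F w in at z. \<forall>t\<in>I. u t (mob_act T w) = - u t w"
      using finI(1) u(1) by (intro eventually_ball_finite) (auto simp: anti_invariant_def)
    thus "\<forall>\<^sub>F w in at z. F (mob_act T w) = - F w"
      by eventually_elim (simp add: F_def sum_negf)
  qed
  have Fnth: "laurent_expansion F z $$ i = (\<Sum>t\<in>I. c t * laurent_expansion (u t) z $$ i)"
    if "z \<in> upper_half_plane" for z i
    unfolding F_def by (rule laurent_lincomb_nth) (rule autom_at[OF au that])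
  have Freg: "fls_subdegree (laurent_expansion F z) \<ge> 0" if z: "z \<in> upper_half_plane" "\<not> eqv z p" for z
    using u(4) z
    by (intro fls_subdegree_ge0I) (auto simp: Fnth[OF z(1)] fls_nth_neg reg_off_def intro!: sum.neutral)
  have "inj_on (\<lambda>t. fls_subdegree (laurent_expansion (u t) p)) I"
    using u(3) by (auto simp: inj_on_def)
  note dist = lincomb_distinct_orders[where f = u, OF finI(1) autom_at[OF au p_U] u(2) this c(1), folded F_def]
  obtain t where t0: "t \<in> I" "laurent_expansion F p \<noteq> 0"
      "fls_subdegree (laurent_expansion F p) = fls_subdegree (laurent_expansion (u t) p)"
    by (rule dist)
  note t = t0(1,2) t0(3)[unfolded u(3)[OF t0(1)]]
  have Fnz: "laurent_expansion F z \<noteq> 0" if "z \<in> upper_half_plane" for z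
    using autom_laurent_nonzero[OF aF p_U t(2) that] .
  have FR: "fls_subdegree (laurent_expansion F r) \<ge> ordf r" if r: "r \<in> R" for r
  proof (rule ccontr)
    assume lt: "\<not> ?thesis"
    define i where "i = nat (fls_subdegree (laurent_expansion F r))"
    have i: "int i = fls_subdegree (laurent_expansion F r)" using Freg[OF RU[OF r] Rp[OF r]] by (simp add: i_def)
    have ie: "i < e r" using lt i e[OF RU[OF r] Rp[OF r]] by simp
    have "(r, i) \<in> J"
    proof (cases "r \<in> A")
      case True
      hence "odd (int i)" unfolding i using anti_invariant_order_odd[OF antiF RU[OF r] _ Fnz[OF RU[OF r]]] by (auto simp: A_def)
      thus ?thesis using True ie by (auto simp: J_def)
    next
      case False
      thus ?thesis using r ie by (auto simp: J_def B_def)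
    qed
    hence "laurent_expansion F r $$ int i = 0" using c(2) Fnth[OF RU[OF r]] by force
    thus False using Fnz[OF RU[OF r]] i by simp
  qed
  define a where "a = (\<lambda>w. F w / f w)"
  have aa: "autom K 0 a" unfolding a_def by (rule autom_divide[OF aF af det_K])
  have LEa: "fls_subdegree (laurent_expansion a z) = fls_subdegree (laurent_expansion F z) - ordf z" if "z \<in> upper_half_plane" for z
    using laurent_divide[OF autom_at[OF aF that] autom_at[OF af that]] Fnz[OF that] fnz[OF that]
    by (simp add: a_def ordf_def fls_divide_subdegree)
  have "fls_subdegree (laurent_expansion a z) \<ge> 0" if z: "z \<in> upper_half_plane" "\<not> eqv z p" for z
  proof (cases "ordf z = 0")
    case True thus ?thesis using LEa[OF z(1)] Freg[OF z] by simp
  next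
    case False
    obtain s where s: "s \<in> N" "eqv s z" using coverN[OF z False] by blast
    then obtain r where r: "r \<in> R" "E s r" using R(2) by blast
    have sU: "s \<in> upper_half_plane" using s N by blast
    have "E z r" using E_trans[OF _ r(2) z(1) sU RU[OF r(1)]] eqv_sym[OF s(2) z(1)] by (simp add: E_def)
    moreover have "fls_subdegree (laurent_expansion F (mob_act T r)) = fls_subdegree (laurent_expansion F r)"
      using anti_invariant_T(2)[OF antiF RU[OF r(1)]] .
    ultimately have "fls_subdegree (laurent_expansion F z) = fls_subdegree (laurent_expansion F r) \<and> ordf z = ordf r"
      using autom_laurent(2)[OF aF, of _ z] o_eqv RU[OF r(1)] T_U[OF RU[OF r(1)]] o_T[OF RU[OF r(1)]] unfolding E_def by metis
    thus ?thesis using LEa[OF z(1)] FR[OF r(1)] by simp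
  qed
  moreover have "fls_subdegree (laurent_expansion a p) = - int (2 * t)"
    using LEa[OF p_U] t(3) f(3) by (simp add: ordf_def)
  ultimately have "2 * t \<notin> gaps K p"
    using not_gapI[OF aa p_U, of "2 * t"] t(1) by (simp add: I_def)
  moreover have "2 * t \<le> m" "2 * t \<ge> 1" using t(1) cJ n(3) by (auto simp: I_def)
  ultimately show False using gaps by simp
qed

end

section \<open>The quaternion order of the triangle group\<close>

type_synonym 'r quad = "'r \<times> 'r \<times> 'r \<times> 'r"

fun mul4 :: "'r::{plus,times} quad \<Rightarrow> 'r quad \<Rightarrow> 'r quad" where
  "mul4 (a, b, c, d) (e, f, g, h) = (a * e + b * g, a * f + b * h, c * e + d * g, c * f + d * h)"

fun det4 :: "'r::{minus,times} quad \<Rightarrow> 'r" where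
  "det4 (a, b, c, d) = a * d - b * c"

fun tr4 :: "'r::plus quad \<Rightarrow> 'r" where
  "tr4 (a, b, c, d) = a + d"

fun map4 :: "('a \<Rightarrow> 'b) \<Rightarrow> 'a quad \<Rightarrow> 'b quad" where
  "map4 f (a, b, c, d) = (f a, f b, f c, f d)"

fun neg4 :: "'r::uminus quad \<Rightarrow> 'r quad" where
  "neg4 (a, b, c, d) = (- a, - b, - c, - d)"

lemma mul4_assoc: "mul4 (mul4 A B) C = mul4 A (mul4 B (C :: 'r::comm_ring_1 quad))"
  by (cases A; cases B; cases C) (simp add: algebra_simps)

lemma mul4_neg4 [simp]: "mul4 (neg4 A) B = neg4 (mul4 A (B :: 'r::comm_ring_1 quad))" "mul4 A (neg4 B) = neg4 (mul4 A B)"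
  "neg4 (neg4 A) = A"
  by (cases A; cases B; simp add: algebra_simps)+

lemma det4_mul4: "det4 (mul4 A B) = det4 A * det4 (B :: 'r::comm_ring_1 quad)"
  by (cases A; cases B) (simp add: algebra_simps)

lemma det4_neg4 [simp]: "det4 (neg4 A) = det4 (A :: 'r::comm_ring_1 quad)"
  by (cases A) simp

text \<open>a + b X + c Y + d X Y, written out.\<close>

fun lcomb :: "'r::comm_ring_1 quad \<Rightarrow> 'r quad \<Rightarrow> 'r quad \<Rightarrow> 'r quad" where
  "lcomb (x1, x2, x3, x4) (y1, y2, y3, y4) (a, b, c, d) =
     (a + b * x1 + c * y1 + d * (x1 * y1 + x2 * y3), b * x2 + c * y2 + d * (x1 * y2 + x2 * y4),
      b * x3 + c * y3 + d * (x3 * y1 + x4 * y3), a + b * x4 + c * y4 + d * (x3 * y2 + x4 * y4))"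

text \<open>Structure constants of the quaternion algebra with basis 1, x, y, xy, where
  x^2 = -1, y^2 = y - 1 and xy has trace t, so that yx = x + t - xy.\<close>
fun qm :: "'r::{plus,minus,times} \<Rightarrow> 'r quad \<Rightarrow> 'r quad \<Rightarrow> 'r quad" where
  "qm t (a, b, c, d) (a', b', c', d') =
     (a * a' - b * b' + t * (c * b') - c * c' - d * b' - d * d',
      a * b' + b * a' + c * b' + c * d' + t * (d * b') - d * c',
      a * c' + c * a' - b * d' + c * c' + t * (c * d') + d * b',
      a * d' + d * a' + b * c' - c * b' + d * c' + t * (d * d'))"

text \<open>The reduced norm of a + b x + c y + d xy.\<close>

fun qn :: "'r::{plus,minus,times} \<Rightarrow> 'r quad \<Rightarrow> 'r" where
  "qn t (a, b, c, d) = a * a + b * b + c * c + d * d + a * c + t * (a * d) - t * (b * c) + b * d"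

lemma qn_qm: "qn t (qm t p p') = qn t p * qn (t :: 'r::comm_ring_1) p'"
  by (cases p; cases p') (simp add: algebra_simps)

text \<open>E, X, Y, Z stand for one fixed entry of the basis matrices 1, x, y, xy, and the
  hypotheses for that entry of their 16 products. Working with this table avoids expanding a
  polynomial in all matrix entries at once.\<close>

lemma bilinear_table:
  fixes a b c d :: "'r::comm_ring_1"
  assumes "e1 * f1 + e2 * f2 = E" "e1 * x1' + e2 * x2' = X" "e1 * y1' + e2 * y2' = Y" "e1 * z1' + e2 * z2' = Z"
    "x1 * f1 + x2 * f2 = X" "x1 * x1' + x2 * x2' = - E" "x1 * y1' + x2 * y2' = Z" "x1 * z1' + x2 * z2' = - Y"
    "y1 * f1 + y2 * f2 = Y" "y1 * x1' + y2 * x2' = X + t * E - Z" "y1 * y1' + y2 * y2' = Y - E" "y1 * z1' + y2 * z2' = X + t * Y"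
    "z1 * f1 + z2 * f2 = Z" "z1 * x1' + z2 * x2' = - E + t * X + Y" "z1 * y1' + z2 * y2' = Z - X" "z1 * z1' + z2 * z2' = t * Z - E"
  shows "(a * e1 + b * x1 + c * y1 + d * z1) * (a' * f1 + b' * x1' + c' * y1' + d' * z1') +
         (a * e2 + b * x2 + c * y2 + d * z2) * (a' * f2 + b' * x2' + c' * y2' + d' * z2') =
     (a * a' - b * b' + t * (c * b') - c * c' - d * b' - d * d') * E +
     (a * b' + b * a' + c * b' + c * d' + t * (d * b') - d * c') * X +
     (a * c' + c * a' - b * d' + c * c' + t * (c * d') + d * b') * Y +
     (a * d' + d * a' + b * c' - c * b' + d * c' + t * (d * d')) * Z" (is "?l = ?r")
proof -
  have "?l = a * a' * (e1 * f1 + e2 * f2) + a * b' * (e1 * x1' + e2 * x2') + a * c' * (e1 * y1' + e2 * y2') + a * d' * (e1 * z1' + e2 * z2')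
    + b * a' * (x1 * f1 + x2 * f2) + b * b' * (x1 * x1' + x2 * x2') + b * c' * (x1 * y1' + x2 * y2') + b * d' * (x1 * z1' + x2 * z2')
    + c * a' * (y1 * f1 + y2 * f2) + c * b' * (y1 * x1' + y2 * x2') + c * c' * (y1 * y1' + y2 * y2') + c * d' * (y1 * z1' + y2 * z2')
    + d * a' * (z1 * f1 + z2 * f2) + d * b' * (z1 * x1' + z2 * x2') + d * c' * (z1 * y1' + z2 * y2') + d * d' * (z1 * z1' + z2 * z2')"
    by (simp add: algebra_simps)
  also have "\<dots> = ?r" unfolding assms by (simp add: algebra_simps)
  finally show ?thesis .
qed

text \<open>By Cayley-Hamilton, X^2 = -1, Y^2 = Y - 1 and YX = X + t - XY over every commutative
  ring. It is applied over the reals and modulo 13.\<close>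

lemma mul4_lcomb:
  fixes X Y p p' :: "'r::comm_ring_1 quad"
  assumes "det4 X = 1" "tr4 X = 0" "det4 Y = 1" "tr4 Y = 1" "tr4 (mul4 X Y) = t"
  shows "mul4 (lcomb X Y p) (lcomb X Y p') = lcomb X Y (qm t p p')"
proof -
  obtain x1 x2 x3 x4 y1 y2 y3 y4 where XY: "X = (x1, x2, x3, x4)" "Y = (y1, y2, y3, y4)" by (cases X; cases Y)
  obtain a b c d a' b' c' d' where p: "p = (a, b, c, d)" "p' = (a', b', c', d')" by (cases p; cases p')
  have x4: "x4 = - x1" using assms(2) by (simp add: XY add_eq_0_iff)
  have y4: "y4 = 1 - y1" using assms(4) unfolding XY tr4.simps by (metis add_diff_cancel_left')
  have "x2 * x3 = x1 * x4 - (x1 * x4 - x2 * x3)" by simp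
  also have "x1 * x4 - x2 * x3 = 1" using assms(1) by (simp add: XY)
  \<comment> \<open>Determinants eliminate the products of off-diagonal entries. The versions with a
    trailing factor and with swapped factors let the rewriting act inside longer monomials.\<close>
  finally have dx: "x2 * x3 = - 1 - x1 * x1" by (simp add: x4)
  have dx': "x2 * (x3 * u) = - u - x1 * (x1 * u)" for u
    unfolding mult.assoc[symmetric] dx by (simp add: left_diff_distrib)
  have "y2 * y3 = y1 * y4 - (y1 * y4 - y2 * y3)" by simp
  also have "y1 * y4 - y2 * y3 = 1" using assms(3) by (simp add: XY)
  finally have dy: "y2 * y3 = y1 - y1 * y1 - 1" by (simp add: y4 right_diff_distrib)
  have dy': "y2 * (y3 * u) = y1 * u - y1 * (y1 * u) - u" for u
    unfolding mult.assoc[symmetric] dy by (simp add: left_diff_distrib)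
  have dxc: "x3 * x2 = - 1 - x1 * x1" "x3 * (x2 * u) = - u - x1 * (x1 * u)" for u
    using dx dx'[of u] by (metis mult.commute mult.left_commute)+
  have dyc: "y3 * y2 = y1 - y1 * y1 - 1" "y3 * (y2 * u) = y1 * u - y1 * (y1 * u) - u" for u
    using dy dy'[of u] by (metis mult.commute mult.left_commute)+
  have t: "t = x1 * y1 + x2 * y3 + (x3 * y2 - x1 * (1 - y1))" using assms(5) by (simp add: XY x4 y4)
  note S = x4 y4 dx dx' dy dy' dxc dyc t
  note B = bilinear_table[where a=a and b=b and c=c and d=d and a'=a' and b'=b' and c'=c' and d'=d' and t=t]
  let ?z1 = "x1 * y1 + x2 * y3" and ?z2 = "x1 * y2 + x2 * y4" and ?z3 = "x3 * y1 + x4 * y3" and ?z4 = "x3 * y2 + x4 * y4"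
  let ?A = "a * a' - b * b' + t * (c * b') - c * c' - d * b' - d * d'"
    and ?B = "a * b' + b * a' + c * b' + c * d' + t * (d * b') - d * c'"
    and ?C = "a * c' + c * a' - b * d' + c * c' + t * (c * d') + d * b'"
    and ?D = "a * d' + d * a' + b * c' - c * b' + d * c' + t * (d * d')"
  have 11: "(a * 1 + b * x1 + c * y1 + d * ?z1) * (a' * 1 + b' * x1 + c' * y1 + d' * ?z1) +
    (a * 0 + b * x2 + c * y2 + d * ?z2) * (a' * 0 + b' * x3 + c' * y3 + d' * ?z3) = ?A * 1 + ?B * x1 + ?C * y1 + ?D * ?z1"
    by (rule B[where E=1 and X=x1 and Y=y1 and Z="?z1"]) (simp_all add: S algebra_simps)
  have 12: "(a * 1 + b * x1 + c * y1 + d * ?z1) * (a' * 0 + b' * x2 + c' * y2 + d' * ?z2) +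
    (a * 0 + b * x2 + c * y2 + d * ?z2) * (a' * 1 + b' * x4 + c' * y4 + d' * ?z4) = ?A * 0 + ?B * x2 + ?C * y2 + ?D * ?z2"
    by (rule B[where E=0 and X=x2 and Y=y2 and Z="?z2"]) (simp_all add: S algebra_simps)
  have 21: "(a * 0 + b * x3 + c * y3 + d * ?z3) * (a' * 1 + b' * x1 + c' * y1 + d' * ?z1) +
    (a * 1 + b * x4 + c * y4 + d * ?z4) * (a' * 0 + b' * x3 + c' * y3 + d' * ?z3) = ?A * 0 + ?B * x3 + ?C * y3 + ?D * ?z3"
    by (rule B[where E=0 and X=x3 and Y=y3 and Z="?z3"]) (simp_all add: S algebra_simps)
  have 22: "(a * 0 + b * x3 + c * y3 + d * ?z3) * (a' * 0 + b' * x2 + c' * y2 + d' * ?z2) +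
    (a * 1 + b * x4 + c * y4 + d * ?z4) * (a' * 1 + b' * x4 + c' * y4 + d' * ?z4) = ?A * 1 + ?B * x4 + ?C * y4 + ?D * ?z4"
    by (rule B[where E=1 and X=x4 and Y=y4 and Z="?z4"]) (simp_all add: S algebra_simps)
  show ?thesis unfolding XY p lcomb.simps qm.simps mul4.simps
    using 11 12 21 22 by (simp only: mult_1_right mult_zero_right add_0_left prod.inject simp_thms)
qed

section \<open>The cubic field of 2 cos(pi/7)\<close>

text \<open>The ring of integers Z[t] of the cubic field, with t^3 = t^2 + 2 t - 1.\<close>
datatype zl = Zl int int int

instantiation zl :: "{zero,one,plus,minus,uminus,times}"
begin
definition "0 = Zl 0 0 0"
definition "1 = Zl 1 0 0"
fun plus_zl where "Zl a b c + Zl a' b' c' = Zl (a + a') (b + b') (c + c')"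
fun minus_zl where "Zl a b c - Zl a' b' c' = Zl (a - a') (b - b') (c - c')"
fun uminus_zl where "- Zl a b c = Zl (- a) (- b) (- c)"
fun times_zl where "Zl a b c * Zl a' b' c' =
  Zl (a * a' - (b * c' + c * b') - c * c')
     (a * b' + b * a' + 2 * (b * c' + c * b') + c * c')
     (a * c' + b * b' + c * a' + (b * c' + c * b') + 3 * (c * c'))"
instance ..
end

definition cubic_root :: "'r::comm_ring_1 \<Rightarrow> bool" where
  "cubic_root t \<longleftrightarrow> t * t * t = t * t + 2 * t - 1"

text \<open>Evaluation at t, a ring homomorphism when t is a root of the cubic: at lam, mu, nu a
  real embedding, modulo 13 or 169 a reduction.\<close>

fun ev :: "'r::comm_ring_1 \<Rightarrow> zl \<Rightarrow> 'r" where
  "ev t (Zl a b c) = of_int a + of_int b * t + of_int c * (t * t)"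

lemma ev_simps [simp]:
  "ev t 0 = 0" "ev t 1 = 1" "ev t (p + q) = ev t p + ev t q" "ev t (p - q) = ev t p - ev t q" "ev t (- p) = - ev t p"
  "ev t (Zl 0 1 0) = t"
  by (cases p; cases q; simp add: zero_zl_def one_zl_def algebra_simps)+

lemma cubD: "cubic_root t \<Longrightarrow> t * (t * t) = t * t + 2 * t - 1" "cubic_root t \<Longrightarrow> t * (t * (t * u)) = t * (t * u) + 2 * (t * u) - u"
proof -
  assume c: "cubic_root t"
  show 1: "t * (t * t) = t * t + 2 * t - 1" using c by (simp add: cubic_root_def mult_ac)
  have "t * (t * (t * u)) = (t * (t * t)) * u" by (simp add: mult_ac)
  also have "\<dots> = t * (t * u) + 2 * (t * u) - u" unfolding 1 by (simp add: algebra_simps)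
  finally show "t * (t * (t * u)) = t * (t * u) + 2 * (t * u) - u" .
qed

lemma ev_mult [simp]:
  assumes "cubic_root t" shows "ev t (p * q) = ev t p * ev t q"
proof (cases p; cases q)
  fix a b c a' b' c' assume p: "p = Zl a b c" "q = Zl a' b' c'"
  show ?thesis unfolding p by (simp add: algebra_simps cubD[OF assms])
qed

lemma ev_of_int: "ev (of_int t) p = of_int (ev t p)"
  by (cases p) simp

text \<open>The field norm, that is, the product over t and its conjugates t^2 - t - 1 and 2 - t^2,
  expanded.\<close>

fun norm_zl :: "zl \<Rightarrow> int" where
  "norm_zl (Zl a b c) = a * a * a + a * a * b + 5 * (a * a * c) - 2 * (a * b * b) + a * b * c + 6 * (a * c * c)
     - b * b * b - b * b * c + 2 * (b * c * c) + c * c * c"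

lemma ev_norm_zl:
  assumes "cubic_root t"
  shows "of_int (norm_zl p) = ev t p * ev (t * t - t - 1) p * ev (2 - t * t) p"
proof (cases p)
  case (Zl a b c)
  show ?thesis unfolding Zl by (simp add: algebra_simps cubD[OF assms])
qed

text \<open>2 is inert in the cubic field, so an element of even norm is divisible by 2.\<close>

lemma norm_zl_even:
  "even (norm_zl (Zl a b c)) \<Longrightarrow> even a \<and> even b \<and> even c"
  by auto

declare norm_zl.simps [simp del]

text \<open>Infinite descent: a zero of the norm form is twice another zero, because halving all
  coefficients divides the form by 8.\<close>

lemma norm_zl_eq_0_iff: "norm_zl p = 0 \<longleftrightarrow> p = 0"
proof
  have "norm_zl (Zl a b c) = 0 \<Longrightarrow> a = 0 \<and> b = 0 \<and> c = 0" for a b c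
  proof (induction "nat (\<bar>a\<bar> + \<bar>b\<bar> + \<bar>c\<bar>)" arbitrary: a b c rule: less_induct)
    case less
    have "even (norm_zl (Zl a b c))" using less.prems by simp
    hence "2 dvd a" "2 dvd b" "2 dvd c" using norm_zl_even by blast+
    then obtain a' b' c' where e: "a = 2 * a'" "b = 2 * b'" "c = 2 * c'"
      unfolding dvd_def by blast
    have "norm_zl (Zl a b c) = 8 * norm_zl (Zl a' b' c')" unfolding e norm_zl.simps by (simp add: algebra_simps)
    hence n: "norm_zl (Zl a' b' c') = 0" using less.prems by simp
    show ?case
    proof (rule ccontr)
      assume "\<not> ?case"
      hence "nat (\<bar>a'\<bar> + \<bar>b'\<bar> + \<bar>c'\<bar>) < nat (\<bar>a\<bar> + \<bar>b\<bar> + \<bar>c\<bar>)" unfolding e by auto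
      from less.hyps[OF this n] show False using \<open>\<not> ?case\<close> e by simp
    qed
  qed
  note * = this
  assume "norm_zl p = 0"
  moreover obtain a b c where "p = Zl a b c" by (cases p)
  ultimately show "p = 0" using *[of a b c] by (simp add: zero_zl_def)
qed (simp add: zero_zl_def norm_zl.simps)

lemma cubic_root_conj:
  fixes t :: "'r::comm_ring_1"
  assumes "cubic_root t" shows "cubic_root (t * t - t - 1)" "cubic_root (2 - t * t)"
  unfolding cubic_root_def by (simp_all add: algebra_simps cubD[OF assms])

section \<open>The three real embeddings of Z[t]\<close>

definition lam :: real where "lam = 2 * cos (pi / 7)"
definition mu :: real where "mu = lam * lam - lam - 1"
definition nu :: real where "nu = 2 - lam * lam"

text \<open>For c = cos(pi/7) the relation cos(3 pi/7) = - cos(4 pi/7) is a quartic equation;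
  removing the factor c + 1 leaves the cubic.\<close>

lemma cubic_root_lam: "cubic_root lam"
proof -
  define c where "c = cos (pi / 7)"
  have "cos (3 * (pi / 7)) = - cos (4 * (pi / 7))"
    using cos_pi_minus[of "4 * (pi / 7)"] by (simp add: field_simps)
  moreover have "cos (3 * (pi / 7)) = 4 * c ^ 3 - 3 * c" unfolding c_def by (rule cos_treble_cos)
  moreover have "cos (4 * (pi / 7)) = 2 * (2 * c\<^sup>2 - 1)\<^sup>2 - 1"
    using cos_double_cos[of "2 * (pi / 7)"] cos_double_cos[of "pi / 7"] by (simp add: c_def)
  ultimately have "(c + 1) * (8 * c ^ 3 - 4 * c\<^sup>2 - 4 * c + 1) = 0"
    by (simp add: algebra_simps power2_eq_square power3_eq_cube power4_eq_xxxx)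
  moreover have "c > 0" unfolding c_def by (rule cos_gt_zero) (use pi_gt_zero in auto)
  ultimately have "8 * c ^ 3 - 4 * c\<^sup>2 - 4 * c + 1 = 0" by simp
  thus ?thesis by (simp add: cubic_root_def lam_def c_def[symmetric] power2_eq_square power3_eq_cube)
qed

lemma cubic_root_mu: "cubic_root mu" and cubic_root_nu: "cubic_root nu"
  using cubic_root_conj[OF cubic_root_lam] by (simp_all add: mu_def nu_def)

lemma lam_bounds: "1.8 < lam" "lam < 1.803"
proof -
  have c: "lam * lam * lam - lam * lam - 2 * lam + 1 = 0" using cubic_root_lam by (simp add: cubic_root_def)
  have "cos (pi / 3) < cos (pi / 7)" by (rule cos_monotone_0_pi) (use pi_gt_zero in auto)
  hence 1: "lam > 1" by (simp add: lam_def cos_60)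
  show "1.8 < lam"
  proof (rule ccontr)
    assume "\<not> ?thesis"
    \<comment> \<open>The second factor is the quotient of t^3 - t^2 - 2 t + 1 by t - 1.8; the sign
      of the remainder -0.008 gives the contradiction. The upper bound is obtained in the same
      way.\<close>
    hence "(1.8 - lam) * (lam * lam + 0.8 * lam - 0.56) \<ge> 0"
      using 1 mult_strict_mono[of 1 lam 1 lam] by (intro mult_nonneg_nonneg) auto
    moreover have "(1.8 - lam) * (lam * lam + 0.8 * lam - 0.56) = - (lam * lam * lam - lam * lam - 2 * lam + 1) - 0.008"
      by (simp add: field_simps)
    ultimately show False unfolding c by simp
  qed
  show "lam < 1.803"
  proof (rule ccontr)
    assume "\<not> ?thesis"
    hence "(lam - 1.803) * (lam * lam + 0.803 * lam - 0.552191) \<ge> 0"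
      using 1 mult_strict_mono[of 1 lam 1 lam] by (intro mult_nonneg_nonneg) auto
    moreover have "(lam - 1.803) * (lam * lam + 0.803 * lam - 0.552191) = (lam * lam * lam - lam * lam - 2 * lam + 1) - 0.004399627"
      by (simp add: field_simps)
    ultimately show False unfolding c by simp
  qed
qed

lemma lam_sq_bounds: "3.24 < lam * lam" "lam * lam < 3.251"
  using mult_strict_mono[of "1.8" lam "1.8" lam] mult_strict_mono[of lam "1.803" lam "1.803"] lam_bounds by auto

lemma mu_bounds: "0.437 < mu" "mu < 0.451" and nu_bounds: "-1.251 < nu" "nu < -1.24"
  using lam_bounds lam_sq_bounds by (auto simp: mu_def nu_def)

lemma norm_zl_real: "real_of_int (norm_zl p) = ev lam p * ev mu p * ev nu p"
  using ev_norm_zl[OF cubic_root_lam, of p] by (simp add: mu_def nu_def)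

lemma ev_real_eq_0_iff:
  assumes "s \<in> {lam, mu, nu}" shows "ev s p = 0 \<longleftrightarrow> p = 0"
proof
  assume "ev s p = 0"
  hence "real_of_int (norm_zl p) = 0" unfolding norm_zl_real using assms by auto
  thus "p = 0" using norm_zl_eq_0_iff by simp
qed simp

text \<open>Divided differences invert the Vandermonde system. The numbers lam - mu, mu - nu and
  (lam - nu) / 2 exceed 1, so dividing by them does not enlarge the bounds.\<close>

lemma zl_coeff_bound:
  assumes "\<bar>ev lam (Zl a b c)\<bar> \<le> B" "\<bar>ev mu (Zl a b c)\<bar> \<le> B" "\<bar>ev nu (Zl a b c)\<bar> \<le> B"
  shows "real_of_int \<bar>a\<bar> \<le> 7 * B" "real_of_int \<bar>b\<bar> \<le> 7 * B" "real_of_int \<bar>c\<bar> \<le> 7 * B"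
proof -
  define x y z where "x = real_of_int a" "y = real_of_int b" "z = real_of_int c"
  have e: "\<bar>x + y * lam + z * (lam * lam)\<bar> \<le> B" "\<bar>x + y * mu + z * (mu * mu)\<bar> \<le> B" "\<bar>x + y * nu + z * (nu * nu)\<bar> \<le> B"
    using assms by (simp_all add: x_y_z_def)
  have B: "B \<ge> 0" using e(1) by linarith
  have *: "\<bar>u\<bar> \<le> 2 * B" if "\<bar>d * u\<bar> \<le> 2 * B" "d \<ge> 1" for d u :: real
  proof -
    have "\<bar>u\<bar> * 1 \<le> \<bar>u\<bar> * d" using that by (intro mult_left_mono) auto
    thus ?thesis using that by (simp add: abs_mult mult.commute)
  qed
  have "\<bar>(lam - mu) * (y + z * (lam + mu))\<bar> \<le> 2 * B"
  proof -
    have "(lam - mu) * (y + z * (lam + mu)) = (x + y * lam + z * (lam * lam)) - (x + y * mu + z * (mu * mu))"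
      by (simp add: algebra_simps)
    thus ?thesis using e by linarith
  qed
  hence 1: "\<bar>y + z * (lam + mu)\<bar> \<le> 2 * B" by (rule *) (use lam_bounds mu_bounds in auto)
  have "\<bar>(mu - nu) * (y + z * (mu + nu))\<bar> \<le> 2 * B"
  proof -
    have "(mu - nu) * (y + z * (mu + nu)) = (x + y * mu + z * (mu * mu)) - (x + y * nu + z * (nu * nu))"
      by (simp add: algebra_simps)
    thus ?thesis using e by linarith
  qed
  hence 2: "\<bar>y + z * (mu + nu)\<bar> \<le> 2 * B" by (rule *) (use nu_bounds mu_bounds in auto)
  have "\<bar>((lam - nu) / 2) * z\<bar> \<le> 2 * B"
  proof -
    have "((lam - nu) / 2) * z = ((y + z * (lam + mu)) - (y + z * (mu + nu))) / 2" by (simp add: field_simps)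
    moreover have "\<bar>(p - q) / 2\<bar> \<le> 2 * B" if "\<bar>p\<bar> \<le> 2 * B" "\<bar>q\<bar> \<le> 2 * B" for p q
      using that by (simp add: abs_le_iff)
    ultimately show ?thesis using 1 2 by metis
  qed
  hence z: "\<bar>z\<bar> \<le> 2 * B" by (rule *) (use nu_bounds lam_bounds in auto)
  have "\<bar>z * (lam + mu)\<bar> \<le> (2 * B) * 2.5"
    unfolding abs_mult using z lam_bounds mu_bounds by (intro mult_mono) auto
  hence y: "\<bar>y\<bar> \<le> 7 * B" using 1 by linarith
  have "\<bar>y * mu\<bar> \<le> (7 * B) * 0.5" "\<bar>z * (mu * mu)\<bar> \<le> (2 * B) * (0.5 * 0.5)"
    unfolding abs_mult using z y mu_bounds B by (intro mult_mono; auto)+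
  hence "\<bar>x\<bar> \<le> 7 * B" using e(2) B by linarith
  thus "real_of_int \<bar>a\<bar> \<le> 7 * B" "real_of_int \<bar>b\<bar> \<le> 7 * B" "real_of_int \<bar>c\<bar> \<le> 7 * B"
    using y z B by (auto simp: x_y_z_def)
qed

text \<open>3 - t^2 is positive at mu and nu and negative at lam: the norm form is definite at two
  real places and indefinite at the third.\<close>

lemma qn_squares:
  fixes t :: real
  shows "qn t (a, b, c, d) = (a + c / 2 + t * d / 2)\<^sup>2 + (b - t * c / 2 + d / 2)\<^sup>2 + (3 - t * t) / 4 * (c\<^sup>2 + d\<^sup>2)"
  by (simp add: power2_eq_square field_simps)

lemma definite_place:
  assumes "s \<in> {mu, nu}" shows "s * s < 1.57" "\<bar>s\<bar> < 1.26"
proof -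
  show 1: "\<bar>s\<bar> < 1.26" using assms mu_bounds nu_bounds by auto
  hence "\<bar>s\<bar> * \<bar>s\<bar> < 1.251 * 1.251" using assms mu_bounds nu_bounds
    by (intro mult_strict_mono) auto
  thus "s * s < 1.57" by simp
qed

text \<open>At a definite place norm 1 confines the four coordinates to a compact set; 1/3 is a
  lower bound for (3 - s^2) / 4.\<close>

lemma qn_definite_bounds:
  assumes s: "s \<in> {mu, nu}" and q: "qn s (a, b, c, d) = 1"
  shows "\<bar>a\<bar> \<le> 4" "\<bar>b\<bar> \<le> 4" "\<bar>c\<bar> \<le> 4" "\<bar>d\<bar> \<le> 4"
proof -
  note ss = definite_place[OF s]
  have cd: "(3 - s * s) / 4 * (c\<^sup>2 + d\<^sup>2) \<ge> 1/3 * (c\<^sup>2 + d\<^sup>2)"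
    using ss by (intro mult_right_mono) auto
  define U V W where "U = (a + c / 2 + s * d / 2)\<^sup>2" "V = (b - s * c / 2 + d / 2)\<^sup>2" "W = (3 - s * s) / 4 * (c\<^sup>2 + d\<^sup>2)"
  have "U + V + W = 1" using q unfolding qn_squares U_V_W_def .
  moreover have "U \<ge> 0" "V \<ge> 0" "c\<^sup>2 \<ge> 0" "d\<^sup>2 \<ge> 0" by (simp_all add: U_V_W_def)
  moreover have "3 * W \<ge> c\<^sup>2 + d\<^sup>2" using cd by (simp add: U_V_W_def)
  ultimately have "U \<le> 1 \<and> V \<le> 1 \<and> c\<^sup>2 \<le> 4 \<and> d\<^sup>2 \<le> 4" by (intro conjI) linarith+
  hence u: "(a + c / 2 + s * d / 2)\<^sup>2 \<le> 1" "(b - s * c / 2 + d / 2)\<^sup>2 \<le> 1" "c\<^sup>2 \<le> 2\<^sup>2" "d\<^sup>2 \<le> 2\<^sup>2"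
    by (simp_all add: U_V_W_def)
  hence v: "\<bar>a + c / 2 + s * d / 2\<bar> \<le> 1" "\<bar>b - s * c / 2 + d / 2\<bar> \<le> 1" "\<bar>c\<bar> \<le> 2" "\<bar>d\<bar> \<le> 2"
    using abs_square_le_1 power2_le_iff_abs_le[of "2::real"] by auto
  have "\<bar>s * c\<bar> \<le> 1.26 * 2" "\<bar>s * d\<bar> \<le> 1.26 * 2"
    unfolding abs_mult using ss v by (intro mult_mono; simp)+
  thus "\<bar>a\<bar> \<le> 4" "\<bar>b\<bar> \<le> 4" "\<bar>c\<bar> \<le> 4" "\<bar>d\<bar> \<le> 4" using v by auto
qed

text \<open>2 a + c + s d is the reduced trace, twice the base of the first square in
  \<open>qn_squares\<close>; the remaining summands are nonnegative.\<close>

lemma qn_trace_bound: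
  assumes s: "s \<in> {mu, nu}" shows "(2 * a + c + s * d)\<^sup>2 \<le> 4 * qn s (a, b, c, d)"
proof -
  have "(3 - s * s) / 4 * (c\<^sup>2 + d\<^sup>2) \<ge> 0" using definite_place[OF s] by simp
  moreover have "(2 * a + c + s * d)\<^sup>2 = 4 * (a + c / 2 + s * d / 2)\<^sup>2" by (simp add: power2_eq_square field_simps)
  ultimately show ?thesis unfolding qn_squares by simp
qed

lemma qn_shift: "qn t (a - e, b, c, d) = qn t (a, b, c, d) - e * (2 * a + c + t * d) + e * (e :: 'r::comm_ring_1)"
  by (simp add: algebra_simps)

lemma ev_qn: "cubic_root t \<Longrightarrow> ev t (qn (Zl 0 1 0) P) = qn t (map4 (ev t) P)"
  by (cases P) simp

lemma ev_qm: "cubic_root t \<Longrightarrow> map4 (ev t) (qm (Zl 0 1 0) P P') = qm t (map4 (ev t) P) (map4 (ev t) P')"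
  by (cases P; cases P') simp

lemma ev_qn_shift:
  fixes s :: "'r::comm_ring_1"
  assumes "cubic_root s"
  shows "ev s (qn (Zl 0 1 0) (a - Zl e 0 0, b, c, d)) = qn s (ev s a - of_int e, ev s b, ev s c, ev s d)"
  using ev_qn[OF assms, of "(a - Zl e 0 0, b, c, d)"] by simp

text \<open>N is the reduced norm of P - epsilon, equal to 2 - epsilon tr P. A trace below 2 in
  absolute value would put N strictly between 0 and 4 at lam; at mu and nu it is in [0, 4] anyway,
  so the field norm of N is at most 64. It is also divisible by 169, hence 0, and N = 0 contradicts
  positivity at lam.\<close>

lemma congruence_subgroup_trace:
  fixes P :: "zl quad" and \<epsilon> \<tau> :: int
  assumes P: "P = (a, b, c, d)" and eps: "\<epsilon> = 1 \<or> \<epsilon> = -1"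
    and root: "cubic_root (of_int \<tau> :: 169)"
    and dvd: "13 dvd ev \<tau> a - \<epsilon>" "13 dvd ev \<tau> b" "13 dvd ev \<tau> c" "13 dvd ev \<tau> d"
    and q: "\<And>s. s \<in> {lam, mu, nu} \<Longrightarrow> qn s (map4 (ev s) P) = 1"
  shows "\<bar>2 * ev lam a + ev lam c + lam * ev lam d\<bar> \<ge> 2"
proof (rule ccontr)
  assume "\<not> ?thesis"
  hence tr: "\<bar>2 * ev lam a + ev lam c + lam * ev lam d\<bar> < 2" by simp
  define N where "N = qn (Zl 0 1 0) (a - Zl \<epsilon> 0 0, b, c, d)"
  have evN': "ev s N = 2 - of_int \<epsilon> * (2 * ev s a + ev s c + s * ev s d)" if "s \<in> {lam, mu, nu}" for s
  proof -
    have "cubic_root s" using that cubic_root_lam cubic_root_mu cubic_root_nu by auto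
    moreover have "qn s (ev s a, ev s b, ev s c, ev s d) = 1" using q[OF that] by (simp add: P)
    moreover have "of_int \<epsilon> * of_int \<epsilon> = (1::real)" using eps by auto
    ultimately show ?thesis unfolding N_def ev_qn_shift[OF \<open>cubic_root s\<close>] qn_shift by simp
  qed
  have b1: "0 < ev lam N" "ev lam N < 4"
    using tr eps unfolding evN'[of lam, simplified] by auto
  have b2: "0 \<le> ev s N \<and> ev s N \<le> 4" if s: "s \<in> {mu, nu}" for s
  proof -
    have "qn s (ev s a, ev s b, ev s c, ev s d) = 1" using q[of s] s by (auto simp: P)
    hence "(2 * ev s a + ev s c + s * ev s d)\<^sup>2 \<le> 2\<^sup>2" using qn_trace_bound[OF s, of "ev s a" "ev s c" "ev s d" "ev s b"] by simp
    hence "\<bar>2 * ev s a + ev s c + s * ev s d\<bar> \<le> 2" using power2_le_iff_abs_le[of "2::real"] by simp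
    moreover have "ev s N = 2 - of_int \<epsilon> * (2 * ev s a + ev s c + s * ev s d)"
      by (rule evN') (use s in auto)
    ultimately show ?thesis using eps by (auto simp: abs_le_iff)
  qed
  have "of_int (norm_zl N) = (0::169)"
  proof -
    obtain a' b' c' d' where e: "ev \<tau> a - \<epsilon> = 13 * a'" "ev \<tau> b = 13 * b'" "ev \<tau> c = 13 * c'" "ev \<tau> d = 13 * d'"
      using dvd unfolding dvd_def by blast
    \<comment> \<open>tau is a root modulo 169 and not only modulo 13, so evaluation at it detects
      divisibility by the square of the prime.\<close>
    have "ev (of_int \<tau> :: 169) N = of_int (qn \<tau> (ev \<tau> a - \<epsilon>, ev \<tau> b, ev \<tau> c, ev \<tau> d))"
      unfolding N_def ev_qn_shift[OF root] by (simp add: ev_of_int)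
    also have "qn \<tau> (ev \<tau> a - \<epsilon>, ev \<tau> b, ev \<tau> c, ev \<tau> d) = 169 * qn \<tau> (a', b', c', d')"
      unfolding e by (simp add: algebra_simps)
    also have "of_int (169 * qn \<tau> (a', b', c', d')) = (0 :: 169)"
      by (subst of_int_eq_0_iff_char_dvd) simp
    finally show ?thesis unfolding ev_norm_zl[OF root] by simp
  qed
  hence "169 dvd norm_zl N" using of_int_eq_0_iff_char_dvd[where 'a = 169] by simp
  moreover have "0 \<le> norm_zl N" "norm_zl N \<le> 64"
  proof -
    have "0 \<le> real_of_int (norm_zl N)" unfolding norm_zl_real using b1 b2 by simp
    thus "0 \<le> norm_zl N" by simp
    have "real_of_int (norm_zl N) \<le> 4 * 4 * 4"
      unfolding norm_zl_real using b1 b2 by (intro mult_mono) auto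
    thus "norm_zl N \<le> 64" by simp
  qed
  ultimately have "norm_zl N = 0" by (auto elim!: dvdE)
  hence "N = 0" using norm_zl_eq_0_iff by simp
  thus False using b1 by simp
qed

text \<open>A and B are both divisible by 2. For the halves, P^2 + Q^2 = 1 in every real embedding;
  if Q is nonzero, all conjugates of P lie in (-1, 1), so the integer norm of P is 0.\<close>

lemma sum_two_squares_4:
  assumes "(ev lam A)\<^sup>2 + (ev lam B)\<^sup>2 = 4" shows "A = 0 \<or> B = 0"
proof -
  obtain a0 a1 a2 b0 b1 b2 where AB: "A = Zl a0 a1 a2" "B = Zl b0 b1 b2" by (cases A; cases B)
  have "ev lam (A * A + B * B - Zl 4 0 0) = 0"
    using assms cubic_root_lam by (simp add: power2_eq_square)
  hence z: "A * A + B * B - Zl 4 0 0 = 0" using ev_real_eq_0_iff by blast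
  hence eqs: "a0 * a0 - 2 * (a1 * a2) - a2 * a2 + (b0 * b0 - 2 * (b1 * b2) - b2 * b2) = 4"
    "2 * (a0 * a1) + 4 * (a1 * a2) + a2 * a2 + (2 * (b0 * b1) + 4 * (b1 * b2) + b2 * b2) = 0"
    "2 * (a0 * a2) + a1 * a1 + 2 * (a1 * a2) + 3 * (a2 * a2) + (2 * (b0 * b2) + b1 * b1 + 2 * (b1 * b2) + 3 * (b2 * b2)) = 0"
    unfolding AB by (simp_all add: zero_zl_def algebra_simps)
  have sq: "(ev s A)\<^sup>2 + (ev s B)\<^sup>2 = 4" if "s \<in> {lam, mu, nu}" for s
  proof -
    have "cubic_root s" using that cubic_root_lam cubic_root_mu cubic_root_nu by auto
    hence "ev s (A * A + B * B - Zl 4 0 0) = (ev s A)\<^sup>2 + (ev s B)\<^sup>2 - 4" by (simp add: power2_eq_square)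
    thus ?thesis unfolding z by simp
  qed
  \<comment> \<open>A^2 + B^2 is (A + B)^2 modulo 2, so A and B agree modulo 2.\<close>
  have e2: "even (a2 + b2)"
    using arg_cong[OF eqs(2), of even] by simp
  have e1: "even (a1 + b1)" using arg_cong[OF eqs(3), of even] e2 by auto
  have e0: "even (a0 + b0)" using arg_cong[OF eqs(1), of even] e2 by auto
  obtain c0 c1 c2 where c: "a0 = b0 + 2 * c0" "a1 = b1 + 2 * c1" "a2 = b2 + 2 * c2"
  proof -
    have "even (a0 - b0)" "even (a1 - b1)" "even (a2 - b2)" using e0 e1 e2 by auto
    then obtain c0 c1 c2 where "a0 - b0 = 2 * c0" "a1 - b1 = 2 * c1" "a2 - b2 = 2 * c2" unfolding dvd_def by blast
    thus ?thesis using that[of c0 c1 c2] by simp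
  qed
  \<comment> \<open>With A = B + 2 C, half of the equation reads B^2 + 2 B C + 2 C^2 = 2; its three
    coefficients show that B is even.\<close>
  have "b2 * b2 + 2 * (b0 * b1 + b0 * c1 + c0 * b1 + 2 * (c0 * c1) + 2 * (b1 * b2) + 2 * (b1 * c2 + c1 * b2 + 2 * (c1 * c2)) + b2 * c2 + c2 * c2 ) = 0"
    using eqs(2) unfolding c by (simp add: algebra_simps)
  from arg_cong[OF this, of even] have f2: "even b2" by simp
  have "b1 * b1 + 3 * (b2 * b2) + 2 * (b0 * b2 + b0 * c2 + c0 * b2 + 2 * (c0 * c2) + b1 * c1 + c1 * c1 + b1 * b2 + b1 * c2 + c1 * b2 + 2 * (c1 * c2) + 3 * (b2 * c2) + 3 * (c2 * c2)) = 0"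
    using eqs(3) unfolding c by (simp add: algebra_simps)
  from arg_cong[OF this, of even] have f1: "even b1" using f2 by simp
  have "b0 * b0 - b2 * b2 + 2 * (b0 * c0 + c0 * c0 - b1 * b2 - b1 * c2 - c1 * b2 - 2 * (c1 * c2) - b2 * c2 - c2 * c2) = 2"
    using eqs(1) unfolding c by (simp add: algebra_simps)
  from arg_cong[OF this, of even] have f0: "even b0" using f2 by simp
  have "even a0" "even a1" "even a2" unfolding c using f0 f1 f2 by auto
  then obtain p0 p1 p2 q0 q1 q2 where pq: "a0 = 2 * p0" "a1 = 2 * p1" "a2 = 2 * p2" "b0 = 2 * q0" "b1 = 2 * q1" "b2 = 2 * q2"
    using f0 f1 f2 unfolding dvd_def by blast
  define P Q where "P = Zl p0 p1 p2" "Q = Zl q0 q1 q2"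
  have evPQ: "ev s A = 2 * ev s P" "ev s B = 2 * ev s Q" for s :: real
    unfolding AB pq P_Q_def by (simp_all add: algebra_simps)
  have sq1: "(ev s P)\<^sup>2 + (ev s Q)\<^sup>2 = 1" if "s \<in> {lam, mu, nu}" for s
    using sq[OF that] unfolding evPQ by (simp add: power2_eq_square)
  show ?thesis
  proof (rule ccontr)
    assume ne: "\<not> ?thesis"
    hence "P \<noteq> 0" "Q \<noteq> 0" unfolding AB pq P_Q_def zero_zl_def by auto
    have lt: "\<bar>ev s P\<bar> < 1" if s: "s \<in> {lam, mu, nu}" for s
    proof -
      have "ev s Q \<noteq> 0" using ev_real_eq_0_iff[OF s] \<open>Q \<noteq> 0\<close> by simp
      hence "(ev s Q)\<^sup>2 > 0" by simp
      hence "(ev s P)\<^sup>2 < 1" using sq1[OF s] by linarith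
      thus ?thesis using abs_square_less_1 by blast
    qed
    have "\<bar>real_of_int (norm_zl P)\<bar> = \<bar>ev lam P\<bar> * \<bar>ev mu P\<bar> * \<bar>ev nu P\<bar>" unfolding norm_zl_real by (simp add: abs_mult)
    also have "\<dots> < 1 * 1 * 1" using lt by (intro mult_strict_mono) auto
    finally have "norm_zl P = 0" by linarith
    thus False using norm_zl_eq_0_iff \<open>P \<noteq> 0\<close> by blast
  qed
qed

section \<open>Matrices over the field with 13 elements\<close>

lemma of_int_13_eq_iff: "(of_int a :: 13) = of_int b \<longleftrightarrow> a mod 13 = b mod 13"
  using of_int_eq_iff_cong_CHAR[where 'a = 13] by (simp add: cong_def)

lemma of_int_mod_13: "(of_int (a mod 13) :: 13) = of_int a"
  by (simp add: of_int_13_eq_iff)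

lemma ex_int_13: "\<exists>i\<in>{0..12}. (u :: 13) = of_int i"
proof (cases u rule: bit1_cases)
  case (of_int z)
  thus ?thesis by (intro bexI[of _ z]) auto
qed

lemma inverse_13: "(u :: 13) \<noteq> 0 \<Longrightarrow> \<exists>v. u * v = 1"
proof -
  assume u: "u \<noteq> 0"
  obtain i where i: "u = of_int i" using ex_int_13 by blast
  have "\<not> 13 dvd i" using u of_int_13_eq_iff[of i 0] by (auto simp: i)
  moreover have "prime (13::int)" by (simp add: prime_int_numeral_eq)
  ultimately have "coprime i 13" using prime_imp_coprime coprime_commute by blast
  then obtain j where "[i * j = 1] (mod 13)" using cong_solve_coprime_int by blast
  hence "(of_int (i * j) :: 13) = of_int 1" unfolding of_int_13_eq_iff by (simp add: cong_def)
  thus ?thesis by (auto simp: i)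
qed

lemma no_zero_div_13: "(u :: 13) * v = 0 \<Longrightarrow> u = 0 \<or> v = 0"
proof (rule disjCI)
  assume uv: "u * v = 0" and "v \<noteq> 0"
  then obtain w where w: "v * w = 1" using inverse_13 by blast
  have "u = u * (v * w)" by (simp add: w)
  also have "\<dots> = (u * v) * w" by (simp only: mult.assoc)
  finally show "u = 0" by (simp add: uv)
qed

fun of_m13 :: "m13 \<Rightarrow> 13 quad" where
  "of_m13 (a, b, c, d) = (of_int a, of_int b, of_int c, of_int d)"

text \<open>Classes {M, -M} indexed by matrices over the ring \<open>13\<close>, which turns
  computations with residues into ring identities.\<close>

definition psl_class :: "13 quad \<Rightarrow> m13 set" where
  "psl_class N = {M\<in>SL2_13. of_m13 M = N \<or> of_m13 M = neg4 N}"

abbreviation one4 :: "'r::{zero,one} quad" where "one4 \<equiv> (1, 0, 0, 1)"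

lemma of_m13_mmul13: "of_m13 (mmul13 M N) = mul4 (of_m13 M) (of_m13 N)"
  by (cases M; cases N) (simp add: of_int_mod_13)

lemma of_m13_mneg13: "of_m13 (mneg13 M) = neg4 (of_m13 M)"
  by (cases M) (simp add: of_int_mod_13)

lemma in_SL2_13_iff:
  "(a, b, c, d) \<in> SL2_13 \<longleftrightarrow> a \<in> {0..12} \<and> b \<in> {0..12} \<and> c \<in> {0..12} \<and> d \<in> {0..12} \<and> det4 (of_m13 (a, b, c, d)) = 1"
proof -
  have "det4 (of_m13 (a, b, c, d)) = 1 \<longleftrightarrow> (of_int (a * d - b * c) :: 13) = of_int 1" by simp
  also have "\<dots> \<longleftrightarrow> (a * d - b * c) mod 13 = 1" unfolding of_int_13_eq_iff by simp
  finally show ?thesis by (simp add: SL2_13_def)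
qed

lemma SL2_13_det: "M \<in> SL2_13 \<Longrightarrow> det4 (of_m13 M) = 1"
  by (cases M) (simp add: in_SL2_13_iff del: of_m13.simps det4.simps)

lemma of_m13_inj: "M \<in> SL2_13 \<Longrightarrow> N \<in> SL2_13 \<Longrightarrow> of_m13 M = of_m13 N \<Longrightarrow> M = N"
  by (cases M; cases N) (auto simp: SL2_13_def of_int_13_eq_iff)

lemma of_m13_surj:
  assumes "det4 N = 1" shows "\<exists>M\<in>SL2_13. of_m13 M = N"
proof -
  obtain p q r s where N: "N = (p, q, r, s)" by (cases N)
  obtain a b c d where "a \<in> {0..12}" "p = of_int a" "b \<in> {0..12}" "q = of_int b"
    "c \<in> {0..12}" "r = of_int c" "d \<in> {0..12}" "s = of_int d" using ex_int_13 by metis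
  thus ?thesis using assms by (intro bexI[of _ "(a, b, c, d)"]) (simp_all only: N of_m13.simps in_SL2_13_iff simp_thms)
qed

lemma mmul13_SL2: "M \<in> SL2_13 \<Longrightarrow> N \<in> SL2_13 \<Longrightarrow> mmul13 M N \<in> SL2_13"
proof -
  assume "M \<in> SL2_13" "N \<in> SL2_13"
  hence "det4 (of_m13 (mmul13 M N)) = 1" unfolding of_m13_mmul13 det4_mul4 by (simp add: SL2_13_det)
  moreover have "\<exists>a b c d. mmul13 M N = (a mod 13, b mod 13, c mod 13, d mod 13)" by (cases M; cases N) auto
  then obtain a b c d where e: "mmul13 M N = (a mod 13, b mod 13, c mod 13, d mod 13)" by blast
  moreover have "u mod 13 \<in> {0..12}" for u :: int using pos_mod_bound[of 13 u] pos_mod_sign[of 13 u] by simp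
  ultimately show ?thesis unfolding e in_SL2_13_iff by blast
qed

lemma mneg13_SL2: "M \<in> SL2_13 \<Longrightarrow> mneg13 M \<in> SL2_13"
proof -
  assume "M \<in> SL2_13"
  hence "det4 (of_m13 (mneg13 M)) = 1" unfolding of_m13_mneg13 det4_neg4 by (simp add: SL2_13_det)
  moreover have "\<exists>a b c d. mneg13 M = (a mod 13, b mod 13, c mod 13, d mod 13)" by (cases M) auto
  then obtain a b c d where e: "mneg13 M = (a mod 13, b mod 13, c mod 13, d mod 13)" by blast
  moreover have "u mod 13 \<in> {0..12}" for u :: int using pos_mod_bound[of 13 u] pos_mod_sign[of 13 u] by simp
  ultimately show ?thesis unfolding e in_SL2_13_iff by blast
qed

lemma psl_class_io: "M \<in> SL2_13 \<Longrightarrow> psl_class (of_m13 M) = {M, mneg13 M}"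
  unfolding psl_class_def of_m13_mneg13[symmetric] using of_m13_inj[of _ M] of_m13_inj[OF _ mneg13_SL2[of M]] mneg13_SL2[of M] by blast

lemma carrier_PSL: "carrier PSL2_13 = psl_class ` {N. det4 N = 1}"
proof -
  have "{{M, mneg13 M} | M. M \<in> SL2_13} = (\<lambda>M. psl_class (of_m13 M)) ` SL2_13"
    unfolding Setcompr_eq_image by (intro image_cong refl psl_class_io[symmetric])
  hence "carrier PSL2_13 = (\<lambda>M. psl_class (of_m13 M)) ` SL2_13" unfolding PSL2_13_def partial_object.select_convs .
  also have "\<dots> = psl_class ` (of_m13 ` SL2_13)" by (simp add: image_image)
  also have "of_m13 ` SL2_13 = {N. det4 N = 1}" using of_m13_surj SL2_13_det by blast
  finally show ?thesis .
qed

lemma psl_class_neg4 [simp]: "psl_class (neg4 N) = psl_class N"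
  unfolding psl_class_def mul4_neg4 by blast

lemma psl_class_eq_iff:
  assumes "det4 N = 1" shows "psl_class N = psl_class N' \<longleftrightarrow> N = N' \<or> N = neg4 N'"
proof
  assume eq: "psl_class N = psl_class N'"
  obtain M where M: "M \<in> SL2_13" "of_m13 M = N" using of_m13_surj[OF assms] by blast
  hence "M \<in> psl_class N" by (simp add: psl_class_def)
  hence "of_m13 M = N' \<or> of_m13 M = neg4 N'" unfolding eq by (simp add: psl_class_def)
  thus "N = N' \<or> N = neg4 N'" using M by simp
qed auto

lemma mult_PSL:
  assumes "det4 N = 1" "det4 N' = 1"
  shows "psl_class N \<otimes>\<^bsub>PSL2_13\<^esub> psl_class N' = psl_class (mul4 N N')"
proof -
  obtain M M' where M: "M \<in> SL2_13" "of_m13 M = N" "M' \<in> SL2_13" "of_m13 M' = N'" using of_m13_surj assms by metis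
  have "psl_class N \<otimes>\<^bsub>PSL2_13\<^esub> psl_class N' = (\<lambda>(M, N). mmul13 M N) ` (psl_class N \<times> psl_class N')" by (simp add: PSL2_13_def)
  also have "\<dots> = psl_class (mul4 N N')"
  proof
    show "(\<lambda>(M, N). mmul13 M N) ` (psl_class N \<times> psl_class N') \<subseteq> psl_class (mul4 N N')"
    proof (rule image_subsetI)
      fix z assume "z \<in> psl_class N \<times> psl_class N'"
      then obtain A B where z: "z = (A, B)" "A \<in> psl_class N" "B \<in> psl_class N'" by blast
      hence "A \<in> SL2_13" "B \<in> SL2_13" "of_m13 A = N \<or> of_m13 A = neg4 N" "of_m13 B = N' \<or> of_m13 B = neg4 N'"
        by (simp_all add: psl_class_def)
      thus "(case z of (A, B) \<Rightarrow> mmul13 A B) \<in> psl_class (mul4 N N')"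
        unfolding psl_class_def z(1) case_prod_conv mem_Collect_eq of_m13_mmul13
        using mmul13_SL2[of A B] by (elim disjE) (simp_all only: mul4_neg4 simp_thms)
    qed
    show "psl_class (mul4 N N') \<subseteq> (\<lambda>(M, N). mmul13 M N) ` (psl_class N \<times> psl_class N')"
    proof
      fix L assume L: "L \<in> psl_class (mul4 N N')"
      hence LS: "L \<in> SL2_13" by (simp add: psl_class_def)
      have "L = mmul13 M M' \<or> L = mmul13 (mneg13 M) M'"
      proof -
        have "of_m13 L = mul4 N N' \<or> of_m13 L = neg4 (mul4 N N')" using L by (simp add: psl_class_def)
        hence "of_m13 L = of_m13 (mmul13 M M') \<or> of_m13 L = of_m13 (mmul13 (mneg13 M) M')"
          unfolding of_m13_mmul13 of_m13_mneg13 M mul4_neg4 .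
        thus ?thesis using of_m13_inj[OF LS mmul13_SL2[OF M(1,3)]] of_m13_inj[OF LS mmul13_SL2[OF mneg13_SL2[OF M(1)] M(3)]] by blast
      qed
      moreover have "M \<in> psl_class N" "M' \<in> psl_class N'" using M by (simp_all add: psl_class_def)
      moreover have "mneg13 M \<in> psl_class N" using M(1,2) mneg13_SL2[OF M(1)] of_m13_mneg13[of M] by (simp add: psl_class_def)
      ultimately show "L \<in> (\<lambda>(M, N). mmul13 M N) ` (psl_class N \<times> psl_class N')" by (metis (mono_tags) SigmaI case_prod_conv imageI)
    qed
  qed
  finally show ?thesis .
qed

lemma one_PSL: "\<one>\<^bsub>PSL2_13\<^esub> = psl_class one4"
proof -
  have "(1, 0, 0, 1) \<in> SL2_13" by (simp add: SL2_13_def)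
  from psl_class_io[OF this] show ?thesis by (simp add: PSL2_13_def)
qed

section \<open>The commutative algebra of the matrices u + v W\<close>

fun lin :: "'r::comm_ring_1 quad \<Rightarrow> 'r \<Rightarrow> 'r \<Rightarrow> 'r quad" where
  "lin (w1, w2, w3, w4) u v = (u + v * w1, v * w2, v * w3, u + v * w4)"

lemma lin_0_1 [simp]: "lin W 0 1 = W" and lin_1_0: "lin W 1 0 = one4" and lin_m1_0: "lin W (-1) 0 = neg4 one4"
  by (cases W; simp)+

lemma neg4_lin: "neg4 (lin W u v) = lin W (- u) (- v)"
  by (cases W) simp

text \<open>Cayley-Hamilton at determinant 1: W^2 = (tr W) W - 1.\<close>

lemma mul4_lin:
  fixes W :: "'r::comm_ring_1 quad"
  assumes "det4 W = 1"
  shows "mul4 (lin W u v) (lin W u' v') = lin W (u * u' - v * v') (u * v' + v * u' + tr4 W * (v * v'))"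
proof -
  obtain w1 w2 w3 w4 where W: "W = (w1, w2, w3, w4)" by (cases W)
  have "w2 * w3 = w1 * w4 - (w1 * w4 - w2 * w3)" by simp
  also have "w1 * w4 - w2 * w3 = 1" using assms by (simp add: W)
  finally have d: "w2 * w3 = w1 * w4 - 1" .
  have d': "w2 * (w3 * z) = w1 * (w4 * z) - z" for z unfolding mult.assoc[symmetric] d by (simp add: left_diff_distrib)
  have dc: "w3 * w2 = w1 * w4 - 1" "w3 * (w2 * z) = w1 * (w4 * z) - z" for z
    using d d'[of z] by (metis mult.commute mult.left_commute)+
  show ?thesis unfolding W by (simp add: algebra_simps d d' dc)
qed

lemma mul4_W_lin:
  fixes W :: "'r::comm_ring_1 quad"
  assumes "det4 W = 1" shows "mul4 W (lin W u v) = lin W (- v) (u + tr4 W * v)"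
  using mul4_lin[OF assms, of 0 1 u v] by simp

definition scalar4 :: "'r::comm_ring_1 quad \<Rightarrow> bool" where
  "scalar4 W \<longleftrightarrow> (\<exists>u. W = (u, 0, 0, u))"

text \<open>1 and W are independent unless W is scalar. This converts relations between powers of W
  into equations for its trace.\<close>

lemma lin_unique_13:
  fixes W :: "13 quad"
  assumes "\<not> scalar4 W" "lin W u v = lin W u' v'" shows "u = u' \<and> v = v'"
proof -
  obtain w1 w2 w3 w4 where W: "W = (w1, w2, w3, w4)" by (cases W)
  have eqs: "u + v * w1 = u' + v' * w1" "v * w2 = v' * w2" "v * w3 = v' * w3" "u + v * w4 = u' + v' * w4"
    using assms(2) unfolding W lin.simps prod.inject by blast+
  have "(v - v') * (w1 - w4) = ((u + v * w1) - (u + v * w4)) - ((u' + v' * w1) - (u' + v' * w4))"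
    by (simp add: algebra_simps)
  also have "\<dots> = 0" unfolding eqs(1,4) by simp
  finally have e: "(v - v') * (w1 - w4) = 0" "(v - v') * w2 = 0" "(v - v') * w3 = 0"
    using eqs(2,3) by (simp_all add: left_diff_distrib)
  have "v = v'"
  proof (rule ccontr)
    assume "v \<noteq> v'"
    hence "v - v' \<noteq> 0" by simp
    hence "w2 = 0" "w3 = 0" "w1 - w4 = 0" using no_zero_div_13 e by blast+
    thus False using assms(1) by (auto simp: W scalar4_def)
  qed
  thus ?thesis using eqs(1) by simp
qed

lemma scalar_det_13:
  fixes W :: "13 quad"
  assumes "scalar4 W" "det4 W = 1" shows "W = one4 \<or> W = neg4 one4"
proof -
  obtain u where W: "W = (u, 0, 0, u)" using assms by (auto simp: scalar4_def)
  hence "(u - 1) * (u + 1) = 0" using assms(2) by (simp add: algebra_simps)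
  hence "u - 1 = 0 \<or> u + 1 = 0" by (rule no_zero_div_13)
  thus ?thesis using W by (auto simp: add_eq_0_iff2)
qed

lemma tr4_lcomb: "tr4 (lcomb X Y (a, b, c, d)) = 2 * a + b * tr4 X + c * tr4 Y + d * tr4 (mul4 X Y)"
  by (cases X; cases Y) (simp add: algebra_simps)

lemma lcomb_basis [simp]: "lcomb X Y (0, 1, 0, 0) = X" "lcomb X Y (0, 0, 1, 0) = Y" "lcomb X Y (0, 0, 0, 1) = mul4 X Y"
  by (cases X; cases Y; simp)+

text \<open>Coordinates with respect to the basis 1, X, Y, XY, recovered through the trace form, whose
  discriminant is a power of t^2 - 3.\<close>
lemma lcomb_coordinates:
  fixes X Y :: "'r::comm_ring_1 quad"
  assumes rel: "det4 X = 1" "tr4 X = 0" "det4 Y = 1" "tr4 Y = 1" "tr4 (mul4 X Y) = t"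
    and M: "M = lcomb X Y (a, b, c, d)"
  shows "(t * t - 3) * c = 2 * tr4 (mul4 M Y) - tr4 M + t * tr4 (mul4 M X)"
    "(t * t - 3) * d = 2 * tr4 (mul4 M (mul4 X Y)) - t * tr4 M - tr4 (mul4 M X)"
    "2 * a = tr4 M - c - t * d" "2 * b = t * c - d - tr4 (mul4 M X)"
proof -
  have mX: "mul4 M X = lcomb X Y (qm t (a, b, c, d) (0, 1, 0, 0))"
    using mul4_lcomb[OF rel, of "(a, b, c, d)" "(0, 1, 0, 0)"] unfolding M lcomb_basis .
  have mY: "mul4 M Y = lcomb X Y (qm t (a, b, c, d) (0, 0, 1, 0))"
    using mul4_lcomb[OF rel, of "(a, b, c, d)" "(0, 0, 1, 0)"] unfolding M lcomb_basis .
  have mXY: "mul4 M (mul4 X Y) = lcomb X Y (qm t (a, b, c, d) (0, 0, 0, 1))"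
    using mul4_lcomb[OF rel, of "(a, b, c, d)" "(0, 0, 0, 1)"] unfolding M lcomb_basis .
  have T: "tr4 M = 2 * a + c + t * d" "tr4 (mul4 M X) = - 2 * b + t * c - d"
    "tr4 (mul4 M Y) = a - c + t * b + t * d" "tr4 (mul4 M (mul4 X Y)) = - 2 * d - b + t * c + t * a + t * t * d"
    unfolding mXY mX mY unfolding M qm.simps tr4_lcomb rel by (simp_all add: algebra_simps)
  show "(t * t - 3) * c = 2 * tr4 (mul4 M Y) - tr4 M + t * tr4 (mul4 M X)"
    "(t * t - 3) * d = 2 * tr4 (mul4 M (mul4 X Y)) - t * tr4 M - tr4 (mul4 M X)"
    "2 * a = tr4 M - c - t * d" "2 * b = t * c - d - tr4 (mul4 M X)"
    unfolding T by (simp_all add: algebra_simps)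
qed

text \<open>Among the possible traces of an element of order 7, the one singled out by W^7 = -1 is a root of
  the cubic, and it lifts to a root modulo 169 by Hensel's lemma.\<close>
lemma trace_order_7:
  fixes t :: 13
  assumes "t ^ 6 - 5 * t ^ 4 + 6 * t\<^sup>2 - 1 = 0" "t ^ 5 - 4 * t ^ 3 + 3 * t = 1"
  shows "cubic_root t" "\<exists>\<tau>. t = of_int \<tau> \<and> cubic_root (of_int \<tau> :: 169)" "t * t - 3 \<noteq> 0"
proof -
  obtain i where i: "i \<in> {0..12}" "t = of_int i" using ex_int_13 by blast
  have "(of_int (i ^ 6 - 5 * i ^ 4 + 6 * i\<^sup>2 - 1) :: 13) = of_int 0" using assms(1) by (simp add: i)
  moreover have "(of_int (i ^ 5 - 4 * i ^ 3 + 3 * i) :: 13) = of_int 1" using assms(2) by (simp add: i)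
  ultimately have *: "(i ^ 6 - 5 * i ^ 4 + 6 * i\<^sup>2 - 1) mod 13 = 0" "(i ^ 5 - 4 * i ^ 3 + 3 * i) mod 13 = 1"
    unfolding of_int_13_eq_iff by simp_all
  have "i = 0 \<or> i = 1 \<or> i = 2 \<or> i = 3 \<or> i = 4 \<or> i = 5 \<or> i = 6 \<or> i = 7 \<or> i = 8 \<or> i = 9 \<or> i = 10 \<or> i = 11 \<or> i = 12"
    using i(1) unfolding atLeastAtMost_iff by presburger
  \<comment> \<open>These are the three roots of the cubic modulo 13, where it splits
    completely.\<close>
  hence "i = 3 \<or> i = 5 \<or> i = 6" using * by (elim disjE) simp_all
  hence i': "t = 3 \<or> t = 5 \<or> t = 6" using i(2) by auto
  show "cubic_root t" "t * t - 3 \<noteq> 0" using i' by (auto simp: cubic_root_def)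
  \<comment> \<open>29, 135 and 6 lift the roots 3, 5 and 6 to roots modulo 169.\<close>
  have "\<exists>\<tau>\<in>{29, 135, 6}. t = of_int \<tau>" using i' by auto
  moreover have "cubic_root (of_int \<tau> :: 169)" if "\<tau> \<in> {29, 135, 6}" for \<tau> using that by (auto simp: cubic_root_def)
  ultimately show "\<exists>\<tau>. t = of_int \<tau> \<and> cubic_root (of_int \<tau> :: 169)" by blast
qed

section \<open>The triangle group and its reduction modulo 13\<close>

definition m4 :: "real^2^2 \<Rightarrow> real quad" where
  "m4 A = (A$1$1, A$1$2, A$2$1, A$2$2)"

lemma m4_mult: "m4 (A ** B) = mul4 (m4 A) (m4 B)"
  by (simp add: m4_def matrix_mult_22)

lemma m4_uminus: "m4 (- A) = neg4 (m4 A)"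
  by (simp add: m4_def)

lemma m4_1: "m4 (mat 1) = one4"
  by (simp add: m4_def)

lemma m4_inject: "m4 A = m4 B \<longleftrightarrow> A = B"
  by (simp add: m4_def mat_eq_22_iff)

lemma det4_m4: "det4 (m4 A) = mdet A" and tr4_m4: "tr4 (m4 A) = mtrace A"
  by (simp_all add: m4_def mdet_def mtrace_def)

lemma minus_mat_mult:
  fixes A B :: "real^2^2"
  shows "(- A) ** B = - (A ** B)" "A ** (- B) = - (A ** B)"
  by (simp_all add: mat_eq_22_iff matrix_mult_22)

lemma power_3_lin:
  assumes "det4 W = 1" "t = tr4 W"
  shows "mul4 W (mul4 W W) = lin W (- t) (t * t - 1)"
proof -
  have "mul4 W (mul4 W W) = mul4 W (mul4 W (lin W 0 1))" by simp
  also have "\<dots> = lin W (- t) (t * t - 1)" unfolding mul4_W_lin[OF assms(1)] assms(2)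
    by (cases W) (simp add: algebra_simps)
  finally show ?thesis .
qed

text \<open>W^k = U_(k-1) W - U_(k-2) with Chebyshev polynomials in the trace; here k = 7.\<close>

lemma power_7_lin:
  assumes "det4 W = 1" "t = tr4 W"
  shows "mul4 W (mul4 W (mul4 W (mul4 W (mul4 W (mul4 W W))))) = lin W (- (t ^ 5 - 4 * t ^ 3 + 3 * t)) (t ^ 6 - 5 * t ^ 4 + 6 * t\<^sup>2 - 1)"
proof -
  have "mul4 W (mul4 W (mul4 W (mul4 W (mul4 W (mul4 W W))))) = mul4 W (mul4 W (mul4 W (mul4 W (mul4 W (mul4 W (lin W 0 1))))))" by simp
  also have "\<dots> = lin W (- (t ^ 5 - 4 * t ^ 3 + 3 * t)) (t ^ 6 - 5 * t ^ 4 + 6 * t\<^sup>2 - 1)"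
    unfolding mul4_W_lin[OF assms(1)] assms(2)[symmetric]
    by (rule arg_cong2[where f = "lin W"]) (simp_all add: algebra_simps power2_eq_square power3_eq_cube eval_nat_numeral)
  finally show ?thesis .
qed

text \<open>Real and imaginary parts of mnum k z = z mden k z. By the last formula a fixed point
  forces |tr k| <= 2, with equality only if the lower left entry is 0.\<close>

lemma fixed_point_entries:
  assumes "mdet k = 1" "Im z > 0" "mob_act k z = z"
  shows "k$2$2 = k$1$1 - 2 * k$2$1 * Re z" "k$1$2 = - (k$2$1 * ((Re z)\<^sup>2 + (Im z)\<^sup>2))"
    "(mtrace k)\<^sup>2 = 4 - 4 * (k$2$1)\<^sup>2 * (Im z)\<^sup>2"
proof -
  define r s where "r = Re z" "s = Im z"
  have "mnum k z = z * mden k z" using mden_nonzero[OF assms(1,2)] assms(3) by (simp add: mob_act_alt field_simps)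
  hence e: "k$1$1 * r + k$1$2 = r * (k$2$1 * r + k$2$2) - s * (k$2$1 * s)" "k$1$1 * s = r * (k$2$1 * s) + s * (k$2$1 * r + k$2$2)"
    unfolding complex_eq_iff by (simp_all add: mnum_def mden_def r_s_def)
  have "s * (k$2$2 - (k$1$1 - 2 * k$2$1 * r)) = 0" using e(2) by (simp add: algebra_simps)
  thus 1: "k$2$2 = k$1$1 - 2 * k$2$1 * Re z" using assms(2) by (simp add: r_s_def)
  show 2: "k$1$2 = - (k$2$1 * ((Re z)\<^sup>2 + (Im z)\<^sup>2))"
    using e(1) unfolding 1 r_s_def by (simp add: power2_eq_square algebra_simps)
  have "(mtrace k)\<^sup>2 = (k$1$1 - k$2$2)\<^sup>2 + 4 * mdet k + 4 * (k$1$2 * k$2$1)"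
    by (simp add: mtrace_def mdet_def power2_eq_square algebra_simps)
  also have "\<dots> = 4 - 4 * (k$2$1)\<^sup>2 * (Im z)\<^sup>2"
    unfolding assms(1) 2 unfolding 1 by (simp add: power2_eq_square algebra_simps)
  finally show "(mtrace k)\<^sup>2 = 4 - 4 * (k$2$1)\<^sup>2 * (Im z)\<^sup>2" .
qed

lemma fixed_point_parabolic:
  assumes "mdet k = 1" "Im z > 0" "mob_act k z = z" "k$2$1 = 0"
  shows "k = mat 1 \<or> k = - mat 1"
proof -
  note f = fixed_point_entries[OF assms(1-3)]
  have a: "k$2$2 = k$1$1" "k$1$2 = 0" using f(1,2) assms(4) by simp_all
  hence "k$1$1 * k$1$1 = 1" using assms(1,4) by (simp add: mdet_def)
  hence "k$1$1 = 1 \<or> k$1$1 = -1" by (simp add: square_eq_1_iff)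
  thus ?thesis using a assms(4) by (auto simp: mat_eq_22_iff)
qed

lemma fixed_point_elliptic:
  assumes "mdet k = 1" "Im z > 0" "mob_act k z = z" "\<bar>mtrace k\<bar> \<ge> 2"
  shows "k = mat 1 \<or> k = - mat 1"
proof -
  have "4 \<le> (mtrace k)\<^sup>2" using abs_le_square_iff[of 2 "mtrace k"] assms(4) by simp
  hence "(k$2$1)\<^sup>2 * (Im z)\<^sup>2 \<le> 0" unfolding fixed_point_entries(3)[OF assms(1-3)] by (simp add: mult.commute)
  hence "k$2$1 = 0" using assms(2) by (metis less_irrefl mult_pos_pos not_le power2_less_0 zero_less_power2)
  thus ?thesis by (rule fixed_point_parabolic[OF assms(1-3)])
qed

locale surj237 =
  fixes x y :: "real^2^2" and \<phi> :: "real^2^2 \<Rightarrow> m13 set"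
  assumes gens: "triangle_237_gens x y"
    and hom: "\<phi> \<in> hom (tri_group x y) PSL2_13"
    and onto: "\<phi> ` carrier (tri_group x y) = carrier PSL2_13"
    and minusI: "\<phi> (- mat 1) = \<one>\<^bsub>PSL2_13\<^esub>"
begin

abbreviation "\<Gamma> \<equiv> gen_mat x y"
abbreviation "K \<equiv> kernel (tri_group x y) PSL2_13 \<phi>"

lemma rel_real: "det4 (m4 x) = 1" "tr4 (m4 x) = 0" "det4 (m4 y) = 1" "tr4 (m4 y) = 1" "tr4 (mul4 (m4 x) (m4 y)) = lam"
  using gens by (simp_all add: triangle_237_gens_def det4_m4 tr4_m4 lam_def flip: m4_mult)

lemma xx: "x ** x = - mat 1"
proof -
  have "mul4 (m4 x) (m4 x) = lin (m4 x) (-1) 0" using mul4_W_lin[OF rel_real(1), of 0 1] rel_real(2) by simp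
  thus ?thesis unfolding m4_inject[symmetric] m4_mult m4_uminus m4_1 lin_m1_0 .
qed

lemma yyy: "y ** (y ** y) = - mat 1"
proof -
  have "mul4 (m4 y) (mul4 (m4 y) (m4 y)) = lin (m4 y) (-1) 0" using power_3_lin[OF rel_real(3), of 1] rel_real(4) by simp
  thus ?thesis unfolding m4_inject[symmetric] m4_mult m4_uminus m4_1 lin_m1_0 .
qed

lemma xy7: "(x ** y) ** ((x ** y) ** ((x ** y) ** ((x ** y) ** ((x ** y) ** ((x ** y) ** (x ** y)))))) = - mat 1"
proof -
  have c: "lam ^ 5 - 4 * lam ^ 3 + 3 * lam = 1" "lam ^ 6 - 5 * lam ^ 4 + 6 * lam\<^sup>2 - 1 = 0"
  proof -
    have f: "lam * lam * lam - lam * lam - 2 * lam + 1 = 0" using cubic_root_lam by (simp add: cubic_root_def)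
    have "lam ^ 5 - 4 * lam ^ 3 + 3 * lam - 1 = (lam * lam * lam - lam * lam - 2 * lam + 1) * (lam * lam + lam - 1)"
      "lam ^ 6 - 5 * lam ^ 4 + 6 * lam\<^sup>2 - 1 = (lam * lam * lam - lam * lam - 2 * lam + 1) * (lam * lam * lam + lam * lam - 2 * lam - 1)"
      by (simp_all add: eval_nat_numeral algebra_simps)
    thus "lam ^ 5 - 4 * lam ^ 3 + 3 * lam = 1" "lam ^ 6 - 5 * lam ^ 4 + 6 * lam\<^sup>2 - 1 = 0" unfolding f by simp_all
  qed
  have "det4 (mul4 (m4 x) (m4 y)) = 1" using rel_real by (simp add: det4_mul4)
  from power_7_lin[OF this rel_real(5)[symmetric]] show ?thesis
    unfolding m4_inject[symmetric] m4_mult m4_uminus m4_1 c lin_m1_0 .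
qed

lemma minus_one_G: "- mat 1 \<in> \<Gamma>"
  using gen_mat.gmul[OF gen_mat.gx gen_mat.gx, of x y] by (simp add: xx)

lemma one_G: "mat 1 \<in> \<Gamma>"
  using gen_mat.gmul[OF minus_one_G minus_one_G] by (simp add: minus_mat_mult)

lemma det_G: "A \<in> \<Gamma> \<Longrightarrow> mdet A = 1"
  by (induction rule: gen_mat.induct) (use gens in \<open>auto simp: triangle_237_gens_def mdet_mult\<close>)

lemma uminus_G: "A \<in> \<Gamma> \<Longrightarrow> - A \<in> \<Gamma>"
  using gen_mat.gmul[OF minus_one_G, of A] by (simp add: minus_mat_mult)

lemma madj_unique: "A ** B = mat 1 \<Longrightarrow> mdet A = 1 \<Longrightarrow> madj A = B"
  using madj_mult(1)[of A] by (metis matrix_mul_assoc matrix_mul_lid matrix_mul_rid)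

text \<open>\<open>gen_mat\<close> is closed under products by definition; inverses come from x^2 =
  y^3 = -1.\<close>

lemma madj_G: "A \<in> \<Gamma> \<Longrightarrow> madj A \<in> \<Gamma>"
proof (induction rule: gen_mat.induct)
  case gx
  have "madj x = - x" by (rule madj_unique) (use xx det_G[OF gen_mat.gx] in \<open>simp_all add: minus_mat_mult\<close>)
  thus ?case using uminus_G gen_mat.gx by simp
next
  case gy
  have "madj y = - (y ** y)" by (rule madj_unique) (use yyy det_G[OF gen_mat.gy] in \<open>simp_all add: minus_mat_mult\<close>)
  thus ?case using uminus_G gen_mat.gmul[OF gen_mat.gy gen_mat.gy] by simp
next
  case (gmul A B)
  have "madj (A ** B) = madj B ** madj A"
  proof (rule madj_unique)
    have "A ** B ** (madj B ** madj A) = A ** (B ** madj B) ** madj A" by (simp add: matrix_mul_assoc)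
    thus "A ** B ** (madj B ** madj A) = mat 1"
      using madj_mult(2) det_G gmul by simp
  qed (use det_G gen_mat.gmul gmul in blast)
  thus ?case using gmul gen_mat.gmul by simp
qed

lemma phi_mult: "A \<in> \<Gamma> \<Longrightarrow> B \<in> \<Gamma> \<Longrightarrow> \<phi> (A ** B) = \<phi> A \<otimes>\<^bsub>PSL2_13\<^esub> \<phi> B"
  using hom by (auto simp: hom_def tri_group_def)

lemma phi_image: "\<phi> ` \<Gamma> = psl_class ` {N. det4 N = 1}"
  using onto unfolding carrier_PSL by (simp add: tri_group_def)

lemma phi_carrier: "A \<in> \<Gamma> \<Longrightarrow> \<exists>N. det4 N = 1 \<and> \<phi> A = psl_class N"
  using phi_image by blast

lemma phi_onto:
  assumes "det4 N = 1" shows "\<exists>A\<in>\<Gamma>. \<phi> A = psl_class N"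
proof -
  have "psl_class N \<in> \<phi> ` \<Gamma>" unfolding phi_image by (rule imageI) (use assms in blast)
  then obtain A where "A \<in> \<Gamma>" "psl_class N = \<phi> A" by (rule imageE)
  thus ?thesis by (intro bexI[of _ A]) simp_all
qed

lemma phi_mult_cl:
  assumes "A \<in> \<Gamma>" "B \<in> \<Gamma>" "\<phi> A = psl_class M" "\<phi> B = psl_class N" "det4 M = 1" "det4 N = 1"
  shows "\<phi> (A ** B) = psl_class (mul4 M N)"
  using phi_mult[OF assms(1,2)] mult_PSL[OF assms(5,6)] assms(3,4) by simp

lemma phi_minus_one: "\<phi> (- mat 1) = psl_class one4"
  using minusI one_PSL by simp

lemma phi_one: "\<phi> (mat 1) = psl_class one4"
  using phi_mult_cl[OF minus_one_G minus_one_G phi_minus_one phi_minus_one] by (simp add: minus_mat_mult)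

lemma K_iff: "k \<in> K \<longleftrightarrow> k \<in> \<Gamma> \<and> \<phi> k = psl_class one4"
  by (auto simp: kernel_def tri_group_def one_PSL)

text \<open>If both images had the form u + v W, the whole image of the group would. The two
  elementary unipotent matrices cannot both have this form: one needs w3 = 0, the other w3
  nonzero.\<close>

lemma not_commutative:
  assumes "det4 W = 1" "det4 X = 1" "det4 Y = 1" "\<phi> x = psl_class X" "\<phi> y = psl_class Y" "X = lin W a b" "Y = lin W c d"
  shows False
proof -
  have all: "\<exists>u v. det4 (lin W u v) = 1 \<and> \<phi> A = psl_class (lin W u v)" if "A \<in> \<Gamma>" for A
    using that
  proof (induction rule: gen_mat.induct)
    case gx show ?case using assms by blast
  next
    case gy show ?case using assms by blast
  next
    case (gmul A B)
    then obtain u v u' v' where "det4 (lin W u v) = 1" "\<phi> A = psl_class (lin W u v)" "det4 (lin W u' v') = 1" "\<phi> B = psl_class (lin W u' v')"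
      by blast
    from phi_mult_cl[OF gmul(1,2) this(2,4,1,3)] det4_mul4[of "lin W u v" "lin W u' v'"] this(1,3)
    show ?case unfolding mul4_lin[OF assms(1)] by (metis mult_1)
  qed
  have ex: "\<exists>u v. N = lin W u v" if N: "det4 N = 1" for N
  proof -
    obtain A where "A \<in> \<Gamma>" "\<phi> A = psl_class N" using phi_onto[OF N] by blast
    then obtain u v where "psl_class N = psl_class (lin W u v)" using all by metis
    hence "N = lin W u v \<or> N = neg4 (lin W u v)" using psl_class_eq_iff[OF N] by simp
    thus ?thesis unfolding neg4_lin by blast
  qed
  obtain w1 w2 w3 w4 where W: "W = (w1, w2, w3, w4)" by (cases W)
  obtain u v u' v' where "(1, 1, 0, 1) = lin W u v" "(1, 0, 1, 1) = lin W u' v'"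
    using ex[of "(1, 1, 0, 1)"] ex[of "(1, 0, 1, 1)"] by auto
  hence "v * w2 = 1" "v * w3 = 0" "v' * w3 = 1" unfolding W lin.simps prod.inject by auto
  thus False using no_zero_div_13[of v w3] by auto
qed

text \<open>phi gives the lifts only up to sign, and the relations for x, y, xy hold for them up to
  sign. As none of X, Y, XY is scalar, the relations determine the traces up to sign; choosing the
  sign of Y, then that of X, matches them with x and y.\<close>

lemma lifts:
  obtains X Y :: "13 quad" and t :: 13 where
    "det4 X = 1" "tr4 X = 0" "det4 Y = 1" "tr4 Y = 1" "tr4 (mul4 X Y) = t" "\<phi> x = psl_class X" "\<phi> y = psl_class Y"
    "cubic_root t" "\<exists>\<tau>. t = of_int \<tau> \<and> cubic_root (of_int \<tau> :: 169)" "t * t - 3 \<noteq> 0"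
proof -
  obtain X0 where X0: "det4 X0 = 1" "\<phi> x = psl_class X0" using phi_carrier[OF gen_mat.gx] by blast
  obtain Y0 where Y0: "det4 Y0 = 1" "\<phi> y = psl_class Y0" using phi_carrier[OF gen_mat.gy] by blast
  have ne: "\<not> scalar4 X0"
  proof
    assume "scalar4 X0"
    hence "X0 = lin Y0 1 0 \<or> X0 = lin Y0 (-1) 0" using scalar_det_13[OF _ X0(1)] by (simp only: lin_1_0 lin_m1_0)
    moreover have "Y0 = lin Y0 0 1" by simp
    ultimately show False using not_commutative[OF Y0(1) X0(1) Y0(1) X0(2) Y0(2)] by blast
  qed
  have neY: "\<not> scalar4 Y0"
  proof
    assume "scalar4 Y0"
    hence "Y0 = lin X0 1 0 \<or> Y0 = lin X0 (-1) 0" using scalar_det_13[OF _ Y0(1)] by (simp only: lin_1_0 lin_m1_0)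
    moreover have "X0 = lin X0 0 1" by simp
    ultimately show False using not_commutative[OF X0(1) X0(1) Y0(1) X0(2) Y0(2)] by blast
  qed
  have "\<phi> (x ** x) = psl_class (mul4 X0 X0)" by (rule phi_mult_cl[OF gen_mat.gx gen_mat.gx X0(2) X0(2) X0(1) X0(1)])
  hence "psl_class one4 = psl_class (mul4 X0 X0)" using phi_minus_one by (simp add: xx)
  hence "one4 = mul4 X0 X0 \<or> one4 = neg4 (mul4 X0 X0)" by (subst (asm) psl_class_eq_iff) auto
  moreover have XX: "mul4 X0 X0 = lin X0 (-1) (tr4 X0)" using mul4_W_lin[OF X0(1), of 0 1] by simp
  ultimately have "lin X0 1 0 = lin X0 (-1) (tr4 X0) \<or> lin X0 1 0 = lin X0 1 (- tr4 X0)"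
    unfolding XX neg4_lin lin_1_0 by simp
  hence tX: "tr4 X0 = 0" using lin_unique_13[OF ne] by fastforce
  have "\<phi> (y ** (y ** y)) = psl_class (mul4 Y0 (mul4 Y0 Y0))"
    by (intro phi_mult_cl gen_mat.gmul gen_mat.gy Y0) (simp add: det4_mul4 Y0(1))
  hence "psl_class one4 = psl_class (mul4 Y0 (mul4 Y0 Y0))" using phi_minus_one by (simp add: yyy)
  hence "one4 = mul4 Y0 (mul4 Y0 Y0) \<or> one4 = neg4 (mul4 Y0 (mul4 Y0 Y0))" by (subst (asm) psl_class_eq_iff) auto
  hence "lin Y0 1 0 = lin Y0 (- tr4 Y0) (tr4 Y0 * tr4 Y0 - 1) \<or> lin Y0 1 0 = lin Y0 (tr4 Y0) (- (tr4 Y0 * tr4 Y0 - 1))"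
    unfolding power_3_lin[OF Y0(1) refl] neg4_lin lin_1_0 by simp
  hence tY: "tr4 Y0 = 1 \<or> tr4 Y0 = -1" using lin_unique_13[OF neY] by (metis minus_minus)
  define Y where "Y = (if tr4 Y0 = 1 then Y0 else neg4 Y0)"
  have tr_neg: "tr4 (neg4 Z) = - tr4 Z" for Z :: "13 quad" by (cases Z) simp
  have Y: "det4 Y = 1" "tr4 Y = 1" "\<phi> y = psl_class Y" using Y0 tY by (auto simp: Y_def tr_neg)
  define W0 where "W0 = mul4 X0 Y"
  have dW: "det4 W0 = 1" by (simp add: W0_def det4_mul4 X0 Y)
  have neW: "\<not> scalar4 W0"
  proof
    assume "scalar4 W0"
    hence W: "W0 = one4 \<or> W0 = neg4 one4" using scalar_det_13[OF _ dW] by blast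
    \<comment> \<open>X (XY) = -Y, so a scalar XY would make Y equal to X or -X and the image
      commutative.\<close>
    have "mul4 X0 W0 = neg4 Y"
    proof -
      have "mul4 X0 W0 = mul4 (mul4 X0 X0) Y" unfolding W0_def by (rule mul4_assoc[symmetric])
      also have "mul4 X0 X0 = neg4 one4" unfolding XX tX lin_m1_0 ..
      finally show ?thesis by (cases Y) simp
    qed
    moreover have "mul4 X0 W0 = X0 \<or> mul4 X0 W0 = neg4 X0" using W by (cases X0) auto
    ultimately have "Y = X0 \<or> Y = neg4 X0" by (metis mul4_neg4(3))
    moreover have "neg4 X0 = lin X0 0 (-1)" using neg4_lin[of X0 0 1] by simp
    ultimately have "Y = lin X0 0 1 \<or> Y = lin X0 0 (-1)" by simp
    moreover have "X0 = lin X0 0 1" by simp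
    ultimately show False using not_commutative[OF X0(1) X0(1) Y(1) X0(2) Y(3)] by blast
  qed
  have xyG: "x ** y \<in> \<Gamma>" by (intro gen_mat.intros)
  have phiW: "\<phi> (x ** y) = psl_class W0" unfolding W0_def by (rule phi_mult_cl[OF gen_mat.gx gen_mat.gy X0(2) Y(3) X0(1) Y(1)])
  define w where "w = x ** y"
  have w: "w \<in> \<Gamma>" "\<phi> w = psl_class W0" using xyG phiW by (simp_all add: w_def)
  have "\<phi> (w ** (w ** (w ** (w ** (w ** (w ** w)))))) = psl_class (mul4 W0 (mul4 W0 (mul4 W0 (mul4 W0 (mul4 W0 (mul4 W0 W0))))))"
    by (intro phi_mult_cl gen_mat.gmul w) (simp_all add: det4_mul4 dW)
  hence "psl_class one4 = psl_class (mul4 W0 (mul4 W0 (mul4 W0 (mul4 W0 (mul4 W0 (mul4 W0 W0))))))" using phi_minus_one xy7 by (simp add: w_def)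
  hence *: "one4 = mul4 W0 (mul4 W0 (mul4 W0 (mul4 W0 (mul4 W0 (mul4 W0 W0))))) \<or> one4 = neg4 (mul4 W0 (mul4 W0 (mul4 W0 (mul4 W0 (mul4 W0 (mul4 W0 W0))))))"
    by (subst (asm) psl_class_eq_iff) auto
  define s where "s = tr4 W0"
  from * have "lin W0 1 0 = lin W0 (- (s ^ 5 - 4 * s ^ 3 + 3 * s)) (s ^ 6 - 5 * s ^ 4 + 6 * s\<^sup>2 - 1) \<or>
     lin W0 1 0 = lin W0 (s ^ 5 - 4 * s ^ 3 + 3 * s) (- (s ^ 6 - 5 * s ^ 4 + 6 * s\<^sup>2 - 1))"
    unfolding power_7_lin[OF dW s_def] neg4_lin lin_1_0 minus_minus .
  hence s7: "(- (s ^ 5 - 4 * s ^ 3 + 3 * s) = 1 \<or> s ^ 5 - 4 * s ^ 3 + 3 * s = 1) \<and> s ^ 6 - 5 * s ^ 4 + 6 * s\<^sup>2 - 1 = 0"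
    using lin_unique_13[OF neW] by (metis neg_equal_0_iff_equal)
  \<comment> \<open>Negating X negates the trace of XY and hence the odd polynomial t^5 - 4 t^3 + 3
    t, whose value 1 means (XY)^7 = -1.\<close>
  define X where "X = (if s ^ 5 - 4 * s ^ 3 + 3 * s = 1 then X0 else neg4 X0)"
  define t where "t = tr4 (mul4 X Y)"
  have X: "det4 X = 1" "tr4 X = 0" "\<phi> x = psl_class X" using X0 tX by (auto simp: X_def tr_neg)
  have t: "t = (if s ^ 5 - 4 * s ^ 3 + 3 * s = 1 then s else - s)"
    by (simp add: t_def X_def s_def W0_def tr_neg)
  have "t ^ 6 - 5 * t ^ 4 + 6 * t\<^sup>2 - 1 = 0" using s7 by (simp add: t)
  moreover have "t ^ 5 - 4 * t ^ 3 + 3 * t = 1"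
  proof (cases "s ^ 5 - 4 * s ^ 3 + 3 * s = 1")
    case False
    have "(- s) ^ 5 - 4 * (- s) ^ 3 + 3 * (- s) = - (s ^ 5 - 4 * s ^ 3 + 3 * s)" by simp
    thus ?thesis using False s7 by (simp add: t)
  qed (simp add: t)
  ultimately show ?thesis using that[OF X(1,2) Y(1,2) t_def[symmetric] X(3) Y(3)] trace_order_7 by blast
qed

end

section \<open>Discreteness and torsion\<close>

lemma summable_on_product_real:
  fixes f :: "'a \<Rightarrow> real" and g :: "'b \<Rightarrow> real"
  assumes "f summable_on A" "g summable_on B" "\<And>a. f a \<ge> 0" "\<And>b. g b \<ge> 0"
  shows "(\<lambda>(a, b). f a * g b) summable_on A \<times> B"
proof (rule summable_on_SigmaI[where g = "\<lambda>a. f a * infsum g B"])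
  show "((\<lambda>b. case (a, b) of (a, b) \<Rightarrow> f a * g b) has_sum f a * infsum g B) B" for a
    using has_sum_cmult_right[OF has_sum_infsum[OF assms(2)]] by simp
  show "(\<lambda>a. f a * infsum g B) summable_on A" using assms(1) by (rule summable_on_cmult_left)
qed (use assms in auto)

text \<open>Square decay makes the sum over one integer coordinate converge; over twelve coordinates
  it amounts to the exponent 24.\<close>

definition decay :: "int \<Rightarrow> real" where
  "decay n = 1 / (1 + \<bar>real_of_int n\<bar>)\<^sup>2"

lemma decay_nonneg: "decay n \<ge> 0"
  by (simp add: decay_def)

lemma summable_decay: "decay summable_on UNIV"
proof -
  have "summable (\<lambda>n. inverse (real (Suc n) ^ 2))"
    using inverse_power_summable[of 2, where 'a = real] by (subst summable_Suc_iff[of "\<lambda>n. inverse (real n ^ 2)"]) simp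
  hence nat: "(\<lambda>n::nat. inverse (real (Suc n) ^ 2)) summable_on UNIV"
    by (subst summable_on_UNIV_nonneg_real_iff) auto
  have 1: "decay summable_on range int"
    by (subst summable_on_reindex) (use nat in \<open>auto simp: decay_def comp_def divide_inverse add.commute\<close>)
  have 2: "decay summable_on range (\<lambda>n. - int n)"
    by (subst summable_on_reindex) (use nat in \<open>auto simp: decay_def comp_def divide_inverse inj_on_def add.commute\<close>)
  have "decay summable_on (range (\<lambda>n. - int n) - range int)"
    by (rule summable_on_subset_banach[OF 2]) auto
  hence "decay summable_on (range int \<union> (range (\<lambda>n. - int n) - range int))"
    by (intro summable_on_Un_disjoint 1) auto
  also have "range int \<union> (range (\<lambda>n. - int n) - range int) = UNIV"
  proof -
    have "i \<in> range int \<or> i \<in> range (\<lambda>n. - int n)" for i :: int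
      by (cases i rule: int_cases2) auto
    thus ?thesis by blast
  qed
  finally show ?thesis .
qed

fun coeffs_zl :: "zl \<Rightarrow> int \<times> int \<times> int" where "coeffs_zl (Zl a b c) = (a, b, c)"

lemma tri_inject: "coeffs_zl p = coeffs_zl q \<longleftrightarrow> p = q"
  by (cases p; cases q) auto

definition decay3 :: "int \<times> int \<times> int \<Rightarrow> real" where
  "decay3 = (\<lambda>(a, b). decay a * (\<lambda>(b, c). decay b * decay c) b)"

definition decay12 :: "(int \<times> int \<times> int) quad \<Rightarrow> real" where
  "decay12 = (\<lambda>(a, q). decay3 a * (\<lambda>(b, r). decay3 b * (\<lambda>(c, d). decay3 c * decay3 d) r) q)"

lemma decay3_nonneg: "decay3 p \<ge> 0"
  by (cases p) (simp add: decay3_def decay_nonneg)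

lemma summable_decay12: "decay12 summable_on UNIV"
proof -
  have 2: "(\<lambda>(b, c). decay b * decay c) summable_on UNIV \<times> UNIV"
    by (intro summable_on_product_real summable_decay decay_nonneg)
  have 3: "decay3 summable_on UNIV \<times> UNIV" unfolding decay3_def
    by (intro summable_on_product_real summable_decay 2[simplified]) (auto simp: decay_nonneg)
  have 6: "(\<lambda>(c, d). decay3 c * decay3 d) summable_on UNIV \<times> UNIV"
    by (intro summable_on_product_real 3[simplified] decay3_nonneg)
  have 9: "(\<lambda>(b, r). decay3 b * (\<lambda>(c, d). decay3 c * decay3 d) r) summable_on UNIV \<times> UNIV"
    by (intro summable_on_product_real 3[simplified] 6[simplified]) (auto simp: decay3_nonneg)
  have "decay12 summable_on UNIV \<times> UNIV" unfolding decay12_def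
    by (intro summable_on_product_real 3[simplified] 9[simplified]) (auto simp: decay3_nonneg)
  thus ?thesis by simp
qed

lemma decay3_ge:
  assumes "D \<ge> 0" "N \<ge> 1" "real_of_int \<bar>a\<bar> \<le> D * N" "real_of_int \<bar>b\<bar> \<le> D * N" "real_of_int \<bar>c\<bar> \<le> D * N"
  shows "1 / N ^ 6 \<le> (D + 1) ^ 6 * decay3 (a, b, c)"
proof -
  have *: "1 / N\<^sup>2 \<le> (D + 1)\<^sup>2 * decay n" if "real_of_int \<bar>n\<bar> \<le> D * N" for n
  proof -
    have "1 + \<bar>real_of_int n\<bar> \<le> (D + 1) * N" using that assms(2) by (simp add: algebra_simps)
    hence "(1 + \<bar>real_of_int n\<bar>)\<^sup>2 \<le> ((D + 1) * N)\<^sup>2" by (rule power_mono) simp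
    thus ?thesis using assms(2) by (simp add: decay_def divide_simps power_mult_distrib add_pos_nonneg)
  qed
  have "1 / N ^ 6 = 1 / N\<^sup>2 * (1 / N\<^sup>2 * (1 / N\<^sup>2))" by (simp flip: power_add)
  also have "\<dots> \<le> ((D + 1)\<^sup>2 * decay a) * (((D + 1)\<^sup>2 * decay b) * ((D + 1)\<^sup>2 * decay c))"
    by (intro mult_mono * assms) (auto simp: decay_nonneg)
  also have "\<dots> = (D + 1) ^ 6 * decay3 (a, b, c)" by (simp add: decay3_def eval_nat_numeral mult_ac)
  finally show ?thesis .
qed

lemma entries_le_norm:
  fixes A :: "real^2^2" shows "\<bar>A$i$j\<bar> \<le> norm A"
  by (rule order_trans[OF component_le_norm_cart Finite_Cartesian_Product.norm_nth_le])

lemma trace_product_bound: "\<bar>tr4 (mul4 (m4 A) (z1, z2, z3, z4))\<bar> \<le> norm A * (\<bar>z1\<bar> + \<bar>z2\<bar> + \<bar>z3\<bar> + \<bar>z4\<bar>)"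
proof -
  have "\<bar>tr4 (mul4 (m4 A) (z1, z2, z3, z4))\<bar> \<le> \<bar>A$1$1 * z1\<bar> + \<bar>A$1$2 * z3\<bar> + (\<bar>A$2$1 * z2\<bar> + \<bar>A$2$2 * z4\<bar>)"
    by (simp add: m4_def)
  also have "\<dots> \<le> norm A * \<bar>z1\<bar> + norm A * \<bar>z3\<bar> + (norm A * \<bar>z2\<bar> + norm A * \<bar>z4\<bar>)"
    unfolding abs_mult by (intro add_mono mult_right_mono entries_le_norm) auto
  finally show ?thesis by (simp add: algebra_simps)
qed

section \<open>Integral coordinates: traces on the kernel, convergence, stabilizers\<close>

context surj237
begin

text \<open>P holds coordinates of A over Z[t] in the basis 1, x, y, xy. The norms at mu and nu,
  which the matrix A does not show, are recorded because they bound the conjugate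
  coordinates.\<close>

definition rep :: "real^2^2 \<Rightarrow> zl quad \<Rightarrow> bool" where
  "rep A P \<longleftrightarrow> m4 A = lcomb (m4 x) (m4 y) (map4 (ev lam) P) \<and> (\<forall>s\<in>{lam, mu, nu}. qn s (map4 (ev s) P) = 1)"

text \<open>A single induction yields P with both of its evaluations, A at lam and phi A at t: the
  multiplication table is the same because X, Y satisfy the relations of x, y.\<close>

lemma rep_exists:
  assumes L: "det4 X = 1" "tr4 X = 0" "det4 Y = 1" "tr4 Y = 1" "tr4 (mul4 X Y) = t" "\<phi> x = psl_class X" "\<phi> y = psl_class Y" "cubic_root t"
    and A: "A \<in> \<Gamma>"
  shows "\<exists>P. rep A P \<and> det4 (lcomb X Y (map4 (ev t) P)) = 1 \<and> \<phi> A = psl_class (lcomb X Y (map4 (ev t) P))"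
  using A
proof (induction rule: gen_mat.induct)
  case gx
  show ?case using L by (intro exI[of _ "(0, 1, 0, 0)"]) (simp add: rep_def)
next
  case gy
  show ?case using L by (intro exI[of _ "(0, 0, 1, 0)"]) (simp add: rep_def)
next
  case (gmul A B)
  obtain P Q where P: "rep A P" "det4 (lcomb X Y (map4 (ev t) P)) = 1" "\<phi> A = psl_class (lcomb X Y (map4 (ev t) P))"
    and Q: "rep B Q" "det4 (lcomb X Y (map4 (ev t) Q)) = 1" "\<phi> B = psl_class (lcomb X Y (map4 (ev t) Q))"
    using gmul.IH by blast
  have m: "mul4 (lcomb X Y (map4 (ev t) P)) (lcomb X Y (map4 (ev t) Q)) = lcomb X Y (map4 (ev t) (qm (Zl 0 1 0) P Q))"
    unfolding ev_qm[OF L(8)] by (rule mul4_lcomb[OF L(1-5)])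
  have "rep (A ** B) (qm (Zl 0 1 0) P Q)" unfolding rep_def
  proof (intro conjI ballI)
    show "m4 (A ** B) = lcomb (m4 x) (m4 y) (map4 (ev lam) (qm (Zl 0 1 0) P Q))"
      using P(1) Q(1) mul4_lcomb[OF rel_real] unfolding m4_mult ev_qm[OF cubic_root_lam] rep_def by simp
    fix s assume s: "s \<in> {lam, mu, nu}"
    hence "cubic_root s" using cubic_root_lam cubic_root_mu cubic_root_nu by auto
    thus "qn s (map4 (ev s) (qm (Zl 0 1 0) P Q)) = 1"
      using P(1) Q(1) s unfolding ev_qm[OF \<open>cubic_root s\<close>] qn_qm rep_def by auto
  qed
  moreover have "det4 (lcomb X Y (map4 (ev t) (qm (Zl 0 1 0) P Q))) = 1"
    unfolding m[symmetric] det4_mul4 P(2) Q(2) by simp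
  moreover have "\<phi> (A ** B) = psl_class (lcomb X Y (map4 (ev t) (qm (Zl 0 1 0) P Q)))"
    unfolding m[symmetric] by (rule phi_mult_cl[OF gmul.hyps P(3) Q(3) P(2) Q(2)])
  ultimately show ?case by blast
qed

lemma rep_ex: "A \<in> \<Gamma> \<Longrightarrow> \<exists>P. rep A P"
  by (rule lifts) (use rep_exists in blast)

lemma mtrace_rep: "rep A (a, b, c, d) \<Longrightarrow> mtrace A = 2 * ev lam a + ev lam c + lam * ev lam d"
  unfolding rep_def tr4_m4[symmetric] using tr4_lcomb[of "m4 x" "m4 y"] rel_real by simp

lemma mtrace_zl: "A \<in> \<Gamma> \<Longrightarrow> \<exists>Z. mtrace A = ev lam Z"
proof -
  assume "A \<in> \<Gamma>"
  then obtain a b c d where "rep A (a, b, c, d)" using rep_ex by (metis prod_cases4)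
  from mtrace_rep[OF this] have "mtrace A = ev lam (a + a + c + Zl 0 1 0 * d)" using cubic_root_lam by simp
  thus ?thesis ..
qed

text \<open>For k in K the evaluation at t is the scalar 1 or -1. The trace form, with t^2 - 3 and 2
  nonzero modulo 13, then gives the coordinates (epsilon, 0, 0, 0) modulo the prime.\<close>

lemma K_trace:
  assumes k: "k \<in> K" shows "\<bar>mtrace k\<bar> \<ge> 2"
proof -
  obtain X Y t where L: "det4 X = 1" "tr4 X = 0" "det4 Y = 1" "tr4 Y = 1" "tr4 (mul4 X Y) = t" "\<phi> x = psl_class X" "\<phi> y = psl_class Y"
    "cubic_root t" and tau: "\<exists>\<tau>. t = of_int \<tau> \<and> cubic_root (of_int \<tau> :: 169)" and t3: "t * t - 3 \<noteq> 0"
    by (rule lifts)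
  obtain \<tau> where \<tau>: "t = of_int \<tau>" "cubic_root (of_int \<tau> :: 169)" using tau by blast
  have kG: "k \<in> \<Gamma>" "\<phi> k = psl_class one4" using k K_iff by auto
  obtain P where P: "rep k P" "det4 (lcomb X Y (map4 (ev t) P)) = 1" "\<phi> k = psl_class (lcomb X Y (map4 (ev t) P))"
    using rep_exists[OF L kG(1)] by blast
  obtain a b c d where abcd: "P = (a, b, c, d)" by (cases P)
  define M where "M = lcomb X Y (ev t a, ev t b, ev t c, ev t d)"
  have "psl_class (lcomb X Y (map4 (ev t) P)) = psl_class one4" using P(3) kG(2) by simp
  hence "M = one4 \<or> M = neg4 one4" unfolding psl_class_eq_iff[OF P(2)] by (simp only: M_def abcd map4.simps)
  then obtain \<epsilon> :: int where eps: "\<epsilon> = 1 \<or> \<epsilon> = -1" "M = (of_int \<epsilon>, 0, 0, of_int \<epsilon>)" by force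
  have tr: "tr4 M = 2 * of_int \<epsilon>" "tr4 (mul4 M Z) = of_int \<epsilon> * tr4 Z" for Z
    unfolding eps(2) by (cases Z; simp add: algebra_simps)+
  note co = lcomb_coordinates[OF L(1-5) M_def]
  have c0: "ev t c = 0"
  proof -
    have "(t * t - 3) * ev t c = 0" unfolding co(1) tr L(2,4) by simp
    thus ?thesis using no_zero_div_13 t3 by blast
  qed
  have d0: "ev t d = 0"
  proof -
    have "(t * t - 3) * ev t d = 0" unfolding co(2) tr L(2,5) by (simp add: algebra_simps)
    thus ?thesis using no_zero_div_13 t3 by blast
  qed
  have "2 * (ev t a - of_int \<epsilon>) = 0" using co(3) unfolding tr c0 d0 by (simp add: algebra_simps)
  hence a0: "ev t a - of_int \<epsilon> = 0" using no_zero_div_13[of 2] by fastforce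
  have "2 * ev t b = 0" using co(4) unfolding tr c0 d0 L(2) by simp
  hence b0: "ev t b = 0" using no_zero_div_13[of 2] by fastforce
  have dv: "13 dvd ev \<tau> Z - e" if "ev t Z - of_int e = 0" for Z e
  proof -
    have "(of_int (ev \<tau> Z) :: 13) = of_int e" using that unfolding \<tau>(1) ev_of_int by simp
    thus ?thesis unfolding of_int_13_eq_iff by (simp add: mod_eq_dvd_iff)
  qed
  have "\<bar>2 * ev lam a + ev lam c + lam * ev lam d\<bar> \<ge> 2"
    by (rule congruence_subgroup_trace[OF abcd eps(1) \<tau>(2)])
       (use dv[OF a0] dv[of _ 0] b0 c0 d0 P(1) in \<open>auto simp: rep_def\<close>)
  thus ?thesis using mtrace_rep P(1) abcd by simp
qed

lemma K_torsion_free: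
  assumes "k \<in> K" "z \<in> upper_half_plane" "mob_act k z = z"
  shows "k = mat 1 \<or> k = - mat 1"
  using fixed_point_elliptic[OF _ _ assms(3) K_trace[OF assms(1)]] det_G assms K_iff
  by (auto simp: upper_half_plane_def)

lemma one_K: "mat 1 \<in> K" and minus_one_K: "- mat 1 \<in> K"
  using one_G minus_one_G phi_one phi_minus_one K_iff by auto

lemma K_mult: "k \<in> K \<Longrightarrow> l \<in> K \<Longrightarrow> k ** l \<in> K"
  using phi_mult_cl[of k l one4 one4] gen_mat.gmul unfolding K_iff by auto

lemma phi_conj:
  assumes "A \<in> \<Gamma>" "k \<in> K" shows "A ** k ** madj A \<in> K"
proof -
  obtain N where N: "det4 N = 1" "\<phi> A = psl_class N" using phi_carrier[OF assms(1)] by blast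
  obtain N' where N': "det4 N' = 1" "\<phi> (madj A) = psl_class N'" using phi_carrier[OF madj_G[OF assms(1)]] by blast
  have k: "k \<in> \<Gamma>" "\<phi> k = psl_class one4" using assms(2) K_iff by auto
  have N1: "mul4 N one4 = N" by (cases N) simp
  have 1: "\<phi> (A ** k) = psl_class N" using phi_mult_cl[OF assms(1) k(1) N(2) k(2) N(1)] N1 by simp
  have AkG: "A ** k \<in> \<Gamma>" using gen_mat.gmul assms(1) k(1) by blast
  have "\<phi> (A ** k ** madj A) = psl_class (mul4 N N')" by (rule phi_mult_cl[OF AkG madj_G[OF assms(1)] 1 N'(2) N(1) N'(1)])
  also have "\<dots> = \<phi> (A ** madj A)" using phi_mult_cl[OF assms(1) madj_G[OF assms(1)] N(2) N'(2) N(1) N'(1)] by simp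
  also have "\<dots> = psl_class one4" using madj_mult(2)[OF det_G[OF assms(1)]] phi_one by simp
  finally show ?thesis using gen_mat.gmul[OF AkG madj_G[OF assms(1)]] K_iff by blast
qed

lemma K_madj:
  assumes "k \<in> K" shows "madj k \<in> K"
proof -
  have k: "k \<in> \<Gamma>" "\<phi> k = psl_class one4" using assms K_iff by auto
  obtain N where N: "det4 N = 1" "\<phi> (madj k) = psl_class N" using phi_carrier[OF madj_G[OF k(1)]] by blast
  have N1: "mul4 one4 N = N" by (cases N) simp
  have "\<phi> (k ** madj k) = psl_class N" using phi_mult_cl[OF k(1) madj_G[OF k(1)] k(2) N(2) _ N(1)] N1 by simp
  hence "\<phi> (madj k) = psl_class one4" using madj_mult(2)[OF det_G[OF k(1)]] phi_one N(2) by simp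
  thus ?thesis using madj_G[OF k(1)] K_iff by blast
qed

text \<open>At determinant 1, (a - d)^2 + (b + c)^2 is the squared norm minus 2.\<close>

lemma norm_G_ge_1: "A \<in> \<Gamma> \<Longrightarrow> norm A \<ge> 1"
proof (rule ccontr)
  assume "A \<in> \<Gamma>" and n: "\<not> norm A \<ge> 1"
  have "A$1$1 * A$2$2 - A$1$2 * A$2$1 = 1" using det_G[OF \<open>A \<in> \<Gamma>\<close>] by (simp add: mdet_def)
  have sq: "(norm A)\<^sup>2 = (A$1$1)\<^sup>2 + (A$1$2)\<^sup>2 + ((A$2$1)\<^sup>2 + (A$2$2)\<^sup>2)"
    unfolding norm_vec_def L2_set_def by (simp add: sum_2)
  have "0 \<le> (A$1$1 - A$2$2)\<^sup>2 + (A$1$2 + A$2$1)\<^sup>2" by simp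
  also have "\<dots> = (norm A)\<^sup>2 - 2" unfolding sq using \<open>A$1$1 * A$2$2 - A$1$2 * A$2$1 = 1\<close>
    by (simp add: power2_eq_square algebra_simps)
  finally have "2 \<le> (norm A)\<^sup>2" by simp
  moreover have "(norm A)\<^sup>2 \<le> 1" using n by (simp add: abs_square_le_1)
  ultimately show False by simp
qed

text \<open>At lam the trace form recovers the coordinates from traces of A times basis elements,
  which are at most a multiple of the norm; at mu and nu they are at most 4. Bounds in all three
  embeddings bound the integers.\<close>

lemma rep_bound:
  obtains D where "D \<ge> 0"
    "\<And>A P1 P2 P3 P4 a b c. \<lbrakk>A \<in> \<Gamma>; rep A (P1, P2, P3, P4); Zl a b c \<in> {P1, P2, P3, P4}\<rbrakk> \<Longrightarrow>
       real_of_int \<bar>a\<bar> \<le> D * norm A \<and> real_of_int \<bar>b\<bar> \<le> D * norm A \<and> real_of_int \<bar>c\<bar> \<le> D * norm A"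
proof -
  define n4 where "n4 = (\<lambda>(a, b, c, d). \<bar>a\<bar> + \<bar>b\<bar> + \<bar>c\<bar> + \<bar>d :: real\<bar>)"
  define H where "H = 2 + n4 (m4 x) + n4 (m4 y) + n4 (mul4 (m4 x) (m4 y))"
  have n4: "n4 Z \<ge> 0" for Z by (cases Z) (simp add: n4_def)
  have tb: "\<bar>tr4 (mul4 (m4 A) Z)\<bar> \<le> norm A * n4 Z" for A Z
    by (cases Z) (use trace_product_bound in \<open>simp add: n4_def\<close>)
  have Hn: "norm A * n4 Z \<le> H * norm A" if "n4 Z \<le> H" for A :: "real^2^2" and Z
    using mult_right_mono[OF that norm_ge_zero[of A]] by (simp add: mult.commute)
  have H2: "H \<ge> 2" using n4 by (simp add: H_def)
  have ev: "\<bar>ev s Z\<bar> \<le> 32 * H * norm A"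
    if A: "A \<in> \<Gamma>" and r: "rep A (P1, P2, P3, P4)" and Z: "Z \<in> {P1, P2, P3, P4}" and s: "s \<in> {lam, mu, nu}" for A P1 P2 P3 P4 Z s
  proof (cases "s = lam")
    case True
    define N where "N = H * norm A"
    have N: "N \<ge> 0" using H2 by (simp add: N_def)
    define T1 T2 T3 T4 where "T1 = tr4 (m4 A)" "T2 = tr4 (mul4 (m4 A) (m4 x))" "T3 = tr4 (mul4 (m4 A) (m4 y))"
      "T4 = tr4 (mul4 (m4 A) (mul4 (m4 x) (m4 y)))"
    have "\<bar>T2\<bar> \<le> N" "\<bar>T3\<bar> \<le> N" "\<bar>T4\<bar> \<le> N"
      unfolding T1_T2_T3_T4_def N_def by (rule order_trans[OF tb Hn]; use n4 in \<open>simp add: H_def add_increasing\<close>)+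
    moreover have "tr4 (mul4 (m4 A) one4) = T1" unfolding T1_T2_T3_T4_def by (cases "m4 A") simp
    hence "\<bar>T1\<bar> \<le> N" using order_trans[OF tb Hn, of one4 A] H2 unfolding N_def by (simp add: n4_def)
    ultimately have T: "\<bar>T1\<bar> \<le> N" "\<bar>T2\<bar> \<le> N" "\<bar>T3\<bar> \<le> N" "\<bar>T4\<bar> \<le> N" by auto
    have M: "m4 A = lcomb (m4 x) (m4 y) (ev lam P1, ev lam P2, ev lam P3, ev lam P4)"
      using r by (simp add: rep_def)
    note co = lcomb_coordinates[OF rel_real M, folded T1_T2_T3_T4_def]
    have lamT: "\<bar>lam * T\<bar> \<le> 2 * B" if "\<bar>T\<bar> \<le> B" for T B
      unfolding abs_mult using that lam_bounds by (intro mult_mono) auto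
    \<comment> \<open>lam^2 - 3 > 0.24, and 5 / 0.24 < 21.\<close>
    have dv: "\<bar>u\<bar> \<le> 21 * N" if "\<bar>(lam * lam - 3) * u\<bar> \<le> 5 * N" for u
    proof -
      have "0.24 * \<bar>u\<bar> \<le> (lam * lam - 3) * \<bar>u\<bar>" using lam_sq_bounds by (intro mult_right_mono) auto
      also have "\<dots> = \<bar>(lam * lam - 3) * u\<bar>" using lam_sq_bounds by (simp add: abs_mult)
      finally show ?thesis using that by simp
    qed
    have P3: "\<bar>ev lam P3\<bar> \<le> 21 * N"
      by (rule dv) (unfold co(1), use T lamT[OF T(2)] in linarith)
    have P4: "\<bar>ev lam P4\<bar> \<le> 21 * N"
      by (rule dv) (unfold co(2), use T lamT[OF T(1)] in linarith)
    have "\<bar>2 * ev lam P1\<bar> \<le> 64 * N" unfolding co(3) using T P3 lamT[OF P4] by linarith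
    moreover have "\<bar>2 * ev lam P2\<bar> \<le> 64 * N" unfolding co(4) using T P4 lamT[OF P3] by linarith
    ultimately have "\<bar>ev lam Z\<bar> \<le> 32 * N" using Z P3 P4 N by auto
    thus ?thesis unfolding True N_def by simp
  next
    case False
    hence s': "s \<in> {mu, nu}" using s by auto
    have "qn s (ev s P1, ev s P2, ev s P3, ev s P4) = 1" using r s by (auto simp: rep_def)
    hence "\<bar>ev s Z\<bar> \<le> 4" using qn_definite_bounds[OF s'] Z by blast
    also have "4 \<le> 32 * H * norm A" using mult_mono[of 2 H 1 "norm A"] H2 norm_G_ge_1[OF A] by simp
    finally show ?thesis .
  qed
  show ?thesis
  proof (rule that[of "7 * (32 * H)"])
    show "0 \<le> 7 * (32 * H)" using H2 by simp
    fix A P1 P2 P3 P4 a b c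
    assume h: "A \<in> \<Gamma>" "rep A (P1, P2, P3, P4)" "Zl a b c \<in> {P1, P2, P3, P4}"
    have e: "\<bar>ev lam (Zl a b c)\<bar> \<le> 32 * H * norm A" "\<bar>ev mu (Zl a b c)\<bar> \<le> 32 * H * norm A" "\<bar>ev nu (Zl a b c)\<bar> \<le> 32 * H * norm A"
      by (rule ev[OF h]; simp)+
    from zl_coeff_bound[OF e] show "real_of_int \<bar>a\<bar> \<le> 7 * (32 * H) * norm A \<and> real_of_int \<bar>b\<bar> \<le> 7 * (32 * H) * norm A \<and> real_of_int \<bar>c\<bar> \<le> 7 * (32 * H) * norm A"
      by simp
  qed
qed

text \<open>Distinct elements have distinct 12-tuples of integers, each at most D times the norm, so
  the sum is dominated by a product of twelve convergent series.\<close>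

lemma summable_G: "(\<lambda>k. 1 / norm k ^ 24) summable_on \<Gamma>"
proof -
  obtain D where D: "D \<ge> 0"
    "\<And>A P1 P2 P3 P4 a b c. \<lbrakk>A \<in> \<Gamma>; rep A (P1, P2, P3, P4); Zl a b c \<in> {P1, P2, P3, P4}\<rbrakk> \<Longrightarrow>
       real_of_int \<bar>a\<bar> \<le> D * norm A \<and> real_of_int \<bar>b\<bar> \<le> D * norm A \<and> real_of_int \<bar>c\<bar> \<le> D * norm A"
    by (rule rep_bound) blast
  obtain P where P: "\<And>A. A \<in> \<Gamma> \<Longrightarrow> rep A (P A)" using rep_ex by metis
  define h where "h = (\<lambda>A. map4 coeffs_zl (P A))"
  have inj: "inj_on h \<Gamma>"
  proof (rule inj_onI)
    fix A B assume AB: "A \<in> \<Gamma>" "B \<in> \<Gamma>" "h A = h B"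
    have "P A = P B" using AB(3) unfolding h_def by (cases "P A"; cases "P B") (simp add: tri_inject)
    hence "m4 A = m4 B" using P[OF AB(1)] P[OF AB(2)] by (simp add: rep_def)
    thus "A = B" by (simp add: m4_inject)
  qed
  have "decay12 summable_on h ` \<Gamma>" by (rule summable_on_subset_banach[OF summable_decay12]) simp
  hence "(decay12 \<circ> h) summable_on \<Gamma>" by (subst (asm) summable_on_reindex[OF inj])
  hence "(\<lambda>A. (D + 1) ^ 24 * (decay12 \<circ> h) A) summable_on \<Gamma>" by (rule summable_on_cmult_right)
  thus ?thesis
  proof (rule summable_on_comparison_test)
    fix A assume A: "A \<in> \<Gamma>"
    obtain P1 P2 P3 P4 where PA: "P A = (P1, P2, P3, P4)" by (cases "P A")
    have r: "rep A (P1, P2, P3, P4)" using P[OF A] PA by simp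
    have b: "1 / norm A ^ 6 \<le> (D + 1) ^ 6 * decay3 (coeffs_zl Z)" if "Z \<in> {P1, P2, P3, P4}" for Z
    proof (cases Z)
      case (Zl a b c)
      show ?thesis unfolding Zl coeffs_zl.simps
        using D(2)[OF A r, of a b c] that Zl by (intro decay3_ge D(1) norm_G_ge_1[OF A]) auto
    qed
    have "1 / norm A ^ 24 = 1 / norm A ^ 6 * (1 / norm A ^ 6 * (1 / norm A ^ 6 * (1 / norm A ^ 6)))"
      by (simp flip: power_add)
    also have "\<dots> \<le> ((D + 1) ^ 6 * decay3 (coeffs_zl P1)) * (((D + 1) ^ 6 * decay3 (coeffs_zl P2)) * (((D + 1) ^ 6 * decay3 (coeffs_zl P3)) * ((D + 1) ^ 6 * decay3 (coeffs_zl P4))))"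
      by (intro mult_mono b) (auto intro!: mult_nonneg_nonneg simp: decay3_nonneg D(1))
    also have "\<dots> = (D + 1) ^ 24 * decay12 (h A)"
      unfolding h_def PA by (simp add: decay12_def mult_ac flip: power_add)
    finally show "1 / norm A ^ 24 \<le> (D + 1) ^ 24 * (decay12 \<circ> h) A" by simp
  qed simp
qed

text \<open>An element fixing z is alpha + beta T with alpha^2 + beta^2 = 1, so the squared traces
  of s and s T, which lie in Z[lam], add up to 4. By \<open>sum_two_squares_4\<close> one of the
  traces is 0.\<close>

lemma stabilizer:
  assumes T: "T \<in> \<Gamma>" "T ** T = - mat 1" "mob_act T z = z" and z: "z \<in> upper_half_plane"
    and s: "s \<in> \<Gamma>" "mob_act s z = z"
  shows "s \<in> {mat 1, - mat 1, T, - T}"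
proof -
  have Im: "Im z > 0" using z by (simp add: upper_half_plane_def)
  note fT = fixed_point_entries[OF det_G[OF T(1)] Im T(3)] and fs = fixed_point_entries[OF det_G[OF s(1)] Im s(2)]
  define r i where "r = Re z" "i = Im z"
  have madjT: "madj T = - T" by (rule madj_unique) (simp_all add: minus_mat_mult T(2) det_G[OF T(1)])
  hence "madj T $1$1 = - T$1$1" by simp
  hence tT: "T$2$2 = - T$1$1" by simp
  hence "mtrace T = 0" by (simp add: mtrace_def)
  hence ci: "(T$2$1)\<^sup>2 * i\<^sup>2 = 1" using fT(3) by (simp add: r_i_def)
  hence cnz: "T$2$1 \<noteq> 0" by auto
  have T11: "T$1$1 = T$2$1 * r" using fT(1) tT by (simp add: r_i_def)
  define \<beta> where "\<beta> = s$2$1 / T$2$1"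
  have s21: "s$2$1 = \<beta> * T$2$1" using cnz by (simp add: \<beta>_def)
  have T12: "T$1$2 = - (T$2$1 * (r\<^sup>2 + i\<^sup>2))" using fT(2) by (simp add: r_i_def)
  have s12: "s$1$2 = \<beta> * T$1$2" using fs(2) unfolding T12 s21 by (simp add: r_i_def)
  have s22: "s$2$2 = s$1$1 - 2 * (\<beta> * T$1$1)" using fs(1) unfolding s21 T11 by (simp add: r_i_def)
  have "mtrace (s ** T) = s$1$1 * T$1$1 + s$1$2 * T$2$1 + (s$2$1 * T$1$2 + s$2$2 * T$2$2)"
    by (simp add: mtrace_def matrix_mult_22)
  also have "\<dots> = 2 * \<beta> * (T$1$1 * T$1$1 + T$1$2 * T$2$1)"
    unfolding s12 s21 s22 tT by (simp add: algebra_simps)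
  also have "T$1$1 * T$1$1 + T$1$2 * T$2$1 = - 1"
    using det_G[OF T(1)] tT by (simp add: mdet_def)
  finally have tsT: "mtrace (s ** T) = - 2 * \<beta>" by simp
  have "(mtrace s)\<^sup>2 + (mtrace (s ** T))\<^sup>2 = 4"
    using fs(3) ci unfolding tsT s21 by (simp add: r_i_def power_mult_distrib)
  moreover obtain A where A: "mtrace s = ev lam A" using mtrace_zl[OF s(1)] by blast
  moreover obtain B where B: "mtrace (s ** T) = ev lam B" using mtrace_zl[OF gen_mat.gmul[OF s(1) T(1)]] by blast
  ultimately have "A = 0 \<or> B = 0" using sum_two_squares_4 by simp
  thus ?thesis
  proof
    assume "B = 0"
    hence "\<beta> = 0" using B tsT by simp
    hence "s$2$1 = 0" using s21 by simp
    from fixed_point_parabolic[OF det_G[OF s(1)] Im s(2) this] show ?thesis by auto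
  next
    assume "A = 0"
    hence ts: "mtrace s = 0" using A by simp
    have "\<beta>\<^sup>2 = 1" using fs(3) ci ts unfolding s21 by (simp add: r_i_def power_mult_distrib)
    hence b: "\<beta> = 1 \<or> \<beta> = -1" by (simp add: power2_eq_1_iff)
    have "s$1$1 = \<beta> * T$1$1" using ts s22 by (simp add: mtrace_def)
    thus ?thesis using b s12 s21 s22 tT by (auto simp: mat_eq_22_iff)
  qed
qed

end

section \<open>Cocompactness\<close>

text \<open>Twice the hyperbolic cosine of the distance from z to i.\<close>

definition height :: "complex \<Rightarrow> real" where
  "height z = ((cmod z)\<^sup>2 + 1) / Im z"

lemma height_mob:
  assumes "mdet g = 1" "Im z > 0"
  shows "height (mob_act g z) = ((cmod (mnum g z))\<^sup>2 + (cmod (mden g z))\<^sup>2) / Im z"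
  using mden_nonzero[OF assms] assms(2) unfolding height_def Im_mob_act[OF assms]
  by (simp add: mob_act_alt norm_divide power_divide field_simps)

text \<open>If all three exceeded -m, all would be below 2 m, and the products (a + m) (2 m - a)
  would be positive; but their sum is 6 m^2 minus the sum of squares, which is 0.\<close>

lemma three_sum_zero:
  fixes a b c m :: real
  assumes "a + b + c = 0" "a\<^sup>2 + b\<^sup>2 + c\<^sup>2 = 6 * m\<^sup>2"
  shows "a \<le> - m \<or> b \<le> - m \<or> c \<le> - m"
proof (rule ccontr)
  assume "\<not> ?thesis"
  hence p: "a + m > 0" "b + m > 0" "c + m > 0" by auto
  hence "2 * m - a > 0" "2 * m - b > 0" "2 * m - c > 0" using assms(1) by linarith+
  hence "(a + m) * (2 * m - a) + (b + m) * (2 * m - b) + (c + m) * (2 * m - c) > 0"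
    using p mult_pos_pos[of "a + m" "2 * m - a"] mult_pos_pos[of "b + m" "2 * m - b"] mult_pos_pos[of "c + m" "2 * m - c"]
    by linarith
  moreover have "(a + m) * (2 * m - a) + (b + m) * (2 * m - b) + (c + m) * (2 * m - c)
      = m * (a + b + c) + 6 * m\<^sup>2 - (a\<^sup>2 + b\<^sup>2 + c\<^sup>2)"
    by (simp add: power2_eq_square algebra_simps)
  ultimately show False using assms by simp
qed

text \<open>In the hyperboloid coordinates (E0, E1, E2) of z an order 3 rotation about i turns (E1, E2) by
  a third of a full turn, so one of the three rotated points moves towards i under the involution.\<close>
lemma descent_normal_form:
  fixes p m n w :: real and z :: complex
  assumes det: "- p * p - m * n = 1" and w: "w * w = 3 / 4" and tr: "w * (m - n) = lam"
    and z: "Im z > 0" "height z \<ge> 6"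
    and g: "g = (\<lambda>a b c d z. ((cmod (of_real a * z + of_real b))\<^sup>2 + (cmod (of_real c * z + of_real d))\<^sup>2) / Im z)"
  shows "g p m n (- p) z \<le> 0.9 * height z \<or>
    g (p / 2 + m * w) (m / 2 - p * w) (n / 2 - p * w) (- p / 2 - n * w) z \<le> 0.9 * height z \<or>
    g (- p / 2 + m * w) (- m / 2 - p * w) (- n / 2 - p * w) (p / 2 - n * w) z \<le> 0.9 * height z"
proof -
  define X Y where "X = Re z" "Y = Im z"
  define E0 E1 E2 where "E0 = (X * X + Y * Y + 1) / Y" "E1 = (X * X + Y * Y - 1) / Y" "E2 = 2 * X / Y"
  have Y: "Y > 0" using z by (simp add: X_Y_def)
  have h: "height z = E0" unfolding height_def cmod_power2 E0_E1_E2_def X_Y_def by (simp add: power2_eq_square)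
  have quad: "E0 * E0 = 4 + E1 * E1 + E2 * E2"
  proof -
    have "(X * X + Y * Y + 1) * (X * X + Y * Y + 1)
        = 4 * (Y * Y) + (X * X + Y * Y - 1) * (X * X + Y * Y - 1) + 2 * X * (2 * X)"
      by (simp add: algebra_simps)
    thus ?thesis using Y unfolding E0_E1_E2_def times_divide_times_eq by (simp add: add_divide_distrib)
  qed
  have gE: "g a b c d z = (a * a + b * b + c * c + d * d) / 2 * E0 + (a * a + c * c - b * b - d * d) / 2 * E1 + (a * b + c * d) * E2" for a b c d
  proof -
    have comb: "P / 2 * (e / Y) + Q / 2 * (f / Y) + R * (h / Y) = (P * e + Q * f + 2 * R * h) / 2 / Y" for P Q R e f h
      by (simp add: add_divide_distrib)
    have n: "2 * ((a * X + b)\<^sup>2 + (a * Y)\<^sup>2 + ((c * X + d)\<^sup>2 + (c * Y)\<^sup>2))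
        = (a * a + b * b + c * c + d * d) * (X * X + Y * Y + 1) + (a * a + c * c - b * b - d * d) * (X * X + Y * Y - 1)
          + 2 * (a * b + c * d) * (2 * X)"
      by (simp add: power2_eq_square algebra_simps)
    have g': "g a b c d z = ((a * X + b)\<^sup>2 + (a * Y)\<^sup>2 + ((c * X + d)\<^sup>2 + (c * Y)\<^sup>2)) / Y"
      unfolding g cmod_power2 by (simp add: X_Y_def)
    show ?thesis unfolding E0_E1_E2_def comb n[symmetric] g' by (simp del: distrib_left_numeral)
  qed
  \<comment> \<open>The coefficients of E0, E1, E2 in the height of the image of z under the
    involution.\<close>
  define \<alpha> \<beta> \<gamma> where "\<alpha> = p * p + (m * m + n * n) / 2" "\<beta> = (n * n - m * m) / 2" "\<gamma> = p * (m - n)"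
  have mn: "m * n = - 1 - p * p" using det by simp
  have d2: "(m - n) * (m - n) = 4 * (lam * lam / 3)"
  proof -
    have "lam * lam = w * w * ((m - n) * (m - n))" unfolding tr[symmetric] by (simp add: algebra_simps)
    thus ?thesis unfolding w by simp
  qed
  \<comment> \<open>The squared hyperbolic cosine of the distance between the centres of the
    involution and of the rotation of order 3; alpha is the hyperbolic cosine of twice this
    distance.\<close>
  define \<kappa> where "\<kappa> = lam * lam / 3"
  have al: "\<alpha> = 2 * \<kappa> - 1"
  proof -
    have "2 * \<alpha> = 2 * (p * p) + ((m - n) * (m - n) + 2 * (m * n))" by (simp add: \<alpha>_\<beta>_\<gamma>_def algebra_simps)
    thus ?thesis unfolding d2 mn by (simp add: \<kappa>_def)
  qed
  have bg: "\<beta> * \<beta> + \<gamma> * \<gamma> = 4 * \<kappa> * (\<kappa> - 1)"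
  proof -
    have "\<beta> * \<beta> + \<gamma> * \<gamma> = ((m - n) * (m - n)) * (((m - n) * (m - n) + 4 * (m * n)) / 4 + p * p)"
      by (simp add: \<alpha>_\<beta>_\<gamma>_def field_simps)
    thus ?thesis unfolding d2 mn by (simp add: \<kappa>_def field_simps)
  qed
  define S0 S1 S2 where "S0 = \<beta> * E1 + \<gamma> * E2" "S1 = \<beta> * (- E1 / 2 - w * E2) + \<gamma> * (w * E1 - E2 / 2)"
    "S2 = \<beta> * (- E1 / 2 + w * E2) + \<gamma> * (- w * E1 - E2 / 2)"
  have w': "w * (w * u) = 3 / 4 * u" for u using w by (metis mult.assoc)
  have G0: "g p m n (- p) z = \<alpha> * E0 + S0"
    unfolding gE by (simp add: S0_S1_S2_def \<alpha>_\<beta>_\<gamma>_def field_simps)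
  have G1: "g (p / 2 + m * w) (m / 2 - p * w) (n / 2 - p * w) (- p / 2 - n * w) z = \<alpha> * E0 + S1"
  proof -
    let ?a = "p / 2 + m * w" and ?b = "m / 2 - p * w" and ?c = "n / 2 - p * w" and ?d = "- p / 2 - n * w"
    have 1: "?a * ?a + ?b * ?b + ?c * ?c + ?d * ?d = 2 * \<alpha>"
      by (simp add: \<alpha>_\<beta>_\<gamma>_def algebra_simps add_divide_distrib diff_divide_distrib w w')
    have 2: "?a * ?a + ?c * ?c - ?b * ?b - ?d * ?d = 2 * (\<gamma> * w - \<beta> / 2)"
      by (simp add: \<alpha>_\<beta>_\<gamma>_def algebra_simps add_divide_distrib diff_divide_distrib w w')
    have 3: "?a * ?b + ?c * ?d = - \<beta> * w - \<gamma> / 2"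
      by (simp add: \<alpha>_\<beta>_\<gamma>_def algebra_simps add_divide_distrib diff_divide_distrib w w')
    show ?thesis unfolding gE 1 2 3 by (simp add: S0_S1_S2_def algebra_simps add_divide_distrib diff_divide_distrib)
  qed
  have G2: "g (- p / 2 + m * w) (- m / 2 - p * w) (- n / 2 - p * w) (p / 2 - n * w) z = \<alpha> * E0 + S2"
  proof -
    let ?a = "- p / 2 + m * w" and ?b = "- m / 2 - p * w" and ?c = "- n / 2 - p * w" and ?d = "p / 2 - n * w"
    have 1: "?a * ?a + ?b * ?b + ?c * ?c + ?d * ?d = 2 * \<alpha>"
      by (simp add: \<alpha>_\<beta>_\<gamma>_def algebra_simps add_divide_distrib diff_divide_distrib w w')
    have 2: "?a * ?a + ?c * ?c - ?b * ?b - ?d * ?d = 2 * (- \<gamma> * w - \<beta> / 2)"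
      by (simp add: \<alpha>_\<beta>_\<gamma>_def algebra_simps add_divide_distrib diff_divide_distrib w w')
    have 3: "?a * ?b + ?c * ?d = \<beta> * w - \<gamma> / 2"
      by (simp add: \<alpha>_\<beta>_\<gamma>_def algebra_simps add_divide_distrib diff_divide_distrib w w')
    show ?thesis unfolding gE 1 2 3 by (simp add: S0_S1_S2_def algebra_simps add_divide_distrib diff_divide_distrib)
  qed
  have sum0: "S0 + S1 + S2 = 0" by (simp add: S0_S1_S2_def algebra_simps)
  have sumsq: "S0\<^sup>2 + S1\<^sup>2 + S2\<^sup>2 = 3 / 2 * ((\<beta> * \<beta> + \<gamma> * \<gamma>) * (E1 * E1 + E2 * E2))"
    by (simp add: S0_S1_S2_def power2_eq_square algebra_simps add_divide_distrib diff_divide_distrib w w')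
  \<comment> \<open>S0, S1, S2 are values of one cosine wave at angles a third of a turn apart, so
    the least is at most minus half the amplitude.\<close>
  define \<mu> where "\<mu> = sqrt ((\<beta> * \<beta> + \<gamma> * \<gamma>) * (E1 * E1 + E2 * E2)) / 2"
  have "6 * \<mu>\<^sup>2 = 3 / 2 * ((\<beta> * \<beta> + \<gamma> * \<gamma>) * (E1 * E1 + E2 * E2))" by (simp add: \<mu>_def power_divide)
  hence S: "S0 \<le> - \<mu> \<or> S1 \<le> - \<mu> \<or> S2 \<le> - \<mu>" using three_sum_zero[OF sum0] sumsq by simp
  have kap: "1.08 < \<kappa>" "\<kappa> < 1.0837" using lam_sq_bounds by (simp_all add: \<kappa>_def)
  have E0: "E0 \<ge> 6" using z(2) h by simp
  \<comment> \<open>For height at least 6, the constant 4 in \<open>quad\<close> is at most a ninth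
    of E0^2.\<close>
  have "6 * 6 \<le> E0 * E0" using E0 by (intro mult_mono) auto
  hence "E1 * E1 + E2 * E2 \<ge> 8 / 9 * (E0 * E0)" using quad by linarith
  moreover have "\<beta> * \<beta> + \<gamma> * \<gamma> \<ge> 0.3456"
  proof -
    have "4.32 * 0.08 \<le> 4 * \<kappa> * (\<kappa> - 1)" by (intro mult_mono) (use kap in simp_all)
    thus ?thesis unfolding bg by simp
  qed
  ultimately have "(\<beta> * \<beta> + \<gamma> * \<gamma>) * (E1 * E1 + E2 * E2) \<ge> 0.3456 * (8 / 9 * (E0 * E0))"
    by (intro mult_mono) auto
  moreover have "(0.54 * E0)\<^sup>2 \<le> 0.3456 * (8 / 9 * (E0 * E0))"
    by (simp add: power2_eq_square)
  ultimately have "(0.54 * E0)\<^sup>2 \<le> (\<beta> * \<beta> + \<gamma> * \<gamma>) * (E1 * E1 + E2 * E2)" by linarith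
  hence "0.54 * E0 \<le> sqrt ((\<beta> * \<beta> + \<gamma> * \<gamma>) * (E1 * E1 + E2 * E2))" by (rule real_le_rsqrt)
  hence mu: "\<mu> \<ge> 0.27 * E0" by (simp add: \<mu>_def)
  \<comment> \<open>The margins combine to 1.17 - 0.27 = 0.9.\<close>
  have "\<alpha> * E0 \<le> 117 / 100 * E0" unfolding al using kap E0 by (intro mult_right_mono) auto
  hence "\<alpha> * E0 - \<mu> \<le> 0.9 * E0" using mu by simp
  thus ?thesis unfolding G0 G1 G2 h using S by auto
qed

definition mat22 :: "real \<Rightarrow> real \<Rightarrow> real \<Rightarrow> real \<Rightarrow> real^2^2" where
  "mat22 a b c d = (\<chi> i j. if i = 1 then (if j = 1 then a else b) else (if j = 1 then c else d))"

lemma mat22_nth [simp]: "mat22 a b c d $1$1 = a" "mat22 a b c d $1$2 = b" "mat22 a b c d $2$1 = c" "mat22 a b c d $2$2 = d"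
  by (simp_all add: mat22_def)

section \<open>Compact sets meeting all orbits of the triangle group and of the kernel\<close>

context surj237
begin

text \<open>V is the affine map taking i to the fixed point of y, whose real part is r and whose
  imaginary part is q^2. The entry c is nonzero because trace 1 excludes real eigenvalues.\<close>

lemma conjugate_to_rotation:
  obtains V where "mdet V = 1" "(madj V ** y ** V)$1$1 = 1/2" "(madj V ** y ** V)$2$2 = 1/2"
    "(madj V ** y ** V)$1$2 = - (madj V ** y ** V)$2$1" "(madj V ** y ** V)$2$1 * (madj V ** y ** V)$2$1 = 3/4"
proof -
  define a b c d where "a = y$1$1" "b = y$1$2" "c = y$2$1" "d = y$2$2"
  have d: "d = 1 - a" and det: "a * (1 - a) - b * c = 1"
    using gens by (simp_all add: triangle_237_gens_def mtrace_def mdet_def a_b_c_d_def) (metis add_diff_cancel_left')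
  have "c \<noteq> 0"
  proof
    assume "c = 0"
    hence "(a - 1/2)\<^sup>2 = - 3/4" using det by (simp add: power2_eq_square field_simps)
    thus False using zero_le_power2[of "a - 1/2"] by linarith
  qed
  define r where "r = (2 * a - 1) / (2 * c)"
  define q where "q = sqrt (sqrt (3/4) / \<bar>c\<bar>)"
  have q: "q > 0" "q * q = sqrt (3/4) / \<bar>c\<bar>" using \<open>c \<noteq> 0\<close> by (simp_all add: q_def flip: power2_eq_square)
  define V where "V = mat22 q (r / q) 0 (1 / q)"
  have detV: "mdet V = 1" using q by (simp add: V_def mdet_def)
  define y' where "y' = madj V ** y ** V"
  have cr: "c * r = a - 1/2" using \<open>c \<noteq> 0\<close> by (simp add: r_def field_simps)
  have e: "y'$1$1 = a - c * r" "y'$2$1 = c * (q * q)" "y'$2$2 = c * r + d"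
    using q(1) by (simp_all add: y'_def V_def matrix_mult_22 a_b_c_d_def field_simps)
  have 11: "y'$1$1 = 1/2" "y'$2$2 = 1/2" using e cr d by simp_all
  have sq: "y'$2$1 * y'$2$1 = 3/4"
  proof -
    have "y'$2$1 * y'$2$1 = (c / \<bar>c\<bar>) * (c / \<bar>c\<bar>) * (sqrt (3/4) * sqrt (3/4))"
      unfolding e q(2) by (simp add: field_simps)
    thus ?thesis using \<open>c \<noteq> 0\<close> by (simp add: abs_if)
  qed
  have "mdet y' = 1" using detV gens by (simp add: y'_def mdet_mult triangle_237_gens_def)
  hence "y'$1$2 * y'$2$1 = - (y'$2$1 * y'$2$1)" unfolding mdet_def 11 sq by simp
  moreover have "y'$2$1 \<noteq> 0" using sq by auto
  ultimately have "y'$1$2 = - y'$2$1" by (metis mult_minus_left mult_right_cancel)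
  thus ?thesis using that[OF detV] 11 sq unfolding y'_def by blast
qed

text \<open>While the height measured from the centre of y is at least 6, one of x, xy, xyy shrinks
  it by the factor 0.9, so every orbit reaches height at most 6.\<close>

lemma G_cocompact: "\<exists>C. compact C \<and> C \<subseteq> upper_half_plane \<and> (\<forall>z\<in>upper_half_plane. \<exists>A\<in>\<Gamma>. mob_act A z \<in> C)"
proof -
  obtain V where V: "mdet V = 1" "(madj V ** y ** V)$1$1 = 1/2" "(madj V ** y ** V)$2$2 = 1/2"
    "(madj V ** y ** V)$1$2 = - (madj V ** y ** V)$2$1" "(madj V ** y ** V)$2$1 * (madj V ** y ** V)$2$1 = 3/4"
    by (rule conjugate_to_rotation)
  define x' y' where "x' = madj V ** x ** V" "y' = madj V ** y ** V"
  define p m n w where "p = x'$1$1" "m = x'$1$2" "n = x'$2$1" "w = y'$2$1"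
  have VV: "V ** madj V = mat 1" "madj V ** V = mat 1" using madj_mult V(1) by auto
  have cancel: "madj V ** A ** V ** (madj V ** B ** V) = madj V ** (A ** B) ** V" for A B
  proof -
    have "madj V ** A ** V ** (madj V ** B ** V) = madj V ** A ** (V ** madj V) ** B ** V" by (simp only: matrix_mul_assoc)
    thus ?thesis unfolding VV by (simp add: matrix_mul_assoc)
  qed
  have trc: "mtrace (madj V ** A ** V) = mtrace A" for A
  proof -
    have "mtrace (madj V ** A ** V) = mtrace A * mdet V"
      by (simp add: mtrace_def mdet_def matrix_mult_22 algebra_simps)
    thus ?thesis using V(1) by simp
  qed
  have gx: "mdet x = 1" "mtrace x = 0" "mdet y = 1" "mtrace (x ** y) = lam"
    using gens by (simp_all add: triangle_237_gens_def lam_def)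
  have x'22: "x'$2$2 = - p" using trc[of x] gx(2) by (simp add: mtrace_def x'_y'_def p_m_n_w_def)
  have "mdet x' = 1" using gx(1) V(1) by (simp add: x'_y'_def mdet_mult)
  hence det: "- p * p - m * n = 1" using x'22 by (simp add: mdet_def p_m_n_w_def)
  have y': "y'$1$1 = 1/2" "y'$2$2 = 1/2" "y'$1$2 = - w" "y'$2$1 = w" "w * w = 3/4"
    using V(2-5) by (simp_all add: x'_y'_def p_m_n_w_def)
  have "mtrace (x' ** y') = lam" using trc[of "x ** y"] gx(4) by (simp add: x'_y'_def cancel)
  hence tr: "w * (m - n) = lam"
    using x'22 y' by (simp add: mtrace_def matrix_mult_22 p_m_n_w_def[symmetric] algebra_simps)
  define H where "H = (\<lambda>z. height (mob_act (madj V) z))"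
  have step: "\<exists>A\<in>\<Gamma>. H (mob_act A z) \<le> 0.9 * H z" if z: "z \<in> upper_half_plane" "H z \<ge> 6" for z
  proof -
    define \<zeta> where "\<zeta> = mob_act (madj V) z"
    have zI: "Im z > 0" using z by (simp add: upper_half_plane_def)
    have \<zeta>U: "\<zeta> \<in> upper_half_plane" unfolding \<zeta>_def using mob_act_in_U[of "madj V" z] V(1) z(1) by simp
    hence \<zeta>I: "Im \<zeta> > 0" by (simp add: upper_half_plane_def)
    have act: "mob_act (madj V) (mob_act A z) = mob_act (madj V ** A ** V) \<zeta>" if "mdet A = 1" for A
    proof -
      have "mob_act (madj V ** A ** V) \<zeta> = mob_act (madj V ** A ** V ** madj V) z"
        unfolding \<zeta>_def using mob_act_mult[of "madj V" z] V(1) zI by simp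
      also have "madj V ** A ** V ** madj V = madj V ** A" using VV by (simp flip: matrix_mul_assoc)
      also have "mob_act (madj V ** A) z = mob_act (madj V) (mob_act A z)" using mob_act_mult[OF that zI] .
      finally show ?thesis ..
    qed
    define g where "g = (\<lambda>a b c d z. ((cmod (of_real a * z + of_real b))\<^sup>2 + (cmod (of_real c * z + of_real d))\<^sup>2) / Im z)"
    have Hg: "H (mob_act A z) = g (B$1$1) (B$1$2) (B$2$1) (B$2$2) \<zeta>" if "A \<in> \<Gamma>" "B = madj V ** A ** V" for A B
    proof -
      have dA: "mdet A = 1" using det_G that by blast
      hence "mdet B = 1" using that(2) V(1) by (simp add: mdet_mult)
      from height_mob[OF this \<zeta>I] show ?thesis
        unfolding H_def act[OF dA] that(2)[symmetric] by (simp add: g_def mnum_def mden_def)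
    qed
    have G: "x \<in> \<Gamma>" "x ** y \<in> \<Gamma>" "x ** (y ** y) \<in> \<Gamma>" by (intro gen_mat.intros)+
    have B0: "x' = madj V ** x ** V" by (simp add: x'_y'_def)
    have B1: "x' ** y' = madj V ** (x ** y) ** V" by (simp add: x'_y'_def cancel)
    have B2: "x' ** (y' ** y') = madj V ** (x ** (y ** y)) ** V" by (simp add: x'_y'_def cancel)
    have h0: "H (mob_act x z) = g p m n (- p) \<zeta>"
      using Hg[OF G(1) B0] x'22 by (simp add: p_m_n_w_def)
    have h1: "H (mob_act (x ** y) z) = g (p / 2 + m * w) (m / 2 - p * w) (n / 2 - p * w) (- p / 2 - n * w) \<zeta>"
    proof -
      have "(x' ** y')$1$1 = p / 2 + m * w" "(x' ** y')$1$2 = m / 2 - p * w" "(x' ** y')$2$1 = n / 2 - p * w" "(x' ** y')$2$2 = - p / 2 - n * w"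
        unfolding matrix_mult_22 y' using x'22 by (simp_all add: p_m_n_w_def[symmetric])
      thus ?thesis unfolding Hg[OF G(2) B1] by simp
    qed
    have h2: "H (mob_act (x ** (y ** y)) z) = g (- p / 2 + m * w) (- m / 2 - p * w) (- n / 2 - p * w) (p / 2 - n * w) \<zeta>"
    proof -
      have "(y' ** y')$1$1 = -1/2" "(y' ** y')$1$2 = - w" "(y' ** y')$2$1 = w" "(y' ** y')$2$2 = -1/2"
        unfolding matrix_mult_22 y' using y'(5) by simp_all
      hence "(x' ** (y' ** y'))$1$1 = - p / 2 + m * w" "(x' ** (y' ** y'))$1$2 = - m / 2 - p * w"
         "(x' ** (y' ** y'))$2$1 = - n / 2 - p * w" "(x' ** (y' ** y'))$2$2 = p / 2 - n * w"
        using x'22 by (simp_all add: matrix_mult_22[of x'] p_m_n_w_def[symmetric] mult.commute)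
      thus ?thesis unfolding Hg[OF G(3) B2] by simp
    qed
    have Hz: "height \<zeta> = H z" by (simp add: H_def \<zeta>_def)
    show ?thesis
      using descent_normal_form[OF det y'(5) tr \<zeta>I _ g_def, unfolded Hz, OF z(2)] G
      unfolding h0[symmetric] h1[symmetric] h2[symmetric] by blast
  qed
  have Gact: "mob_act (A ** B) z = mob_act A (mob_act B z)" if "B \<in> \<Gamma>" "z \<in> upper_half_plane" for A B z
    using mob_act_mult[OF det_G[OF that(1)]] that(2) by (simp add: upper_half_plane_def)
  have iter: "\<exists>A\<in>\<Gamma>. H (mob_act A z) \<le> 6 \<or> H (mob_act A z) \<le> 0.9 ^ N * H z" if z: "z \<in> upper_half_plane" for z N
  proof (induction N)
    case 0 show ?case by (intro bexI[of _ "mat 1"] one_G) simp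
  next
    case (Suc N)
    then obtain A where A: "A \<in> \<Gamma>" "H (mob_act A z) \<le> 6 \<or> H (mob_act A z) \<le> 0.9 ^ N * H z" by blast
    show ?case
    proof (cases "H (mob_act A z) \<le> 6")
      case True thus ?thesis using A(1) by blast
    next
      case False
      have AzU: "mob_act A z \<in> upper_half_plane" using mob_act_in_U[OF det_G[OF A(1)] z] .
      obtain B where B: "B \<in> \<Gamma>" "H (mob_act B (mob_act A z)) \<le> 0.9 * H (mob_act A z)" using step[OF AzU] False by force
      have "H (mob_act (B ** A) z) \<le> 0.9 ^ Suc N * H z"
        unfolding Gact[OF A(1) z] using B(2) A(2) False by simp
      thus ?thesis using gen_mat.gmul[OF B(1) A(1)] by blast
    qed
  qed
  \<comment> \<open>Completing the square, height at most 6 is the closed Euclidean disc of radius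
    sqrt 8 about 3 i.\<close>
  define C where "C = mob_act V ` cball (3 * \<i>) (sqrt 8)"
  have ballU: "cball (3 * \<i>) (sqrt 8) \<subseteq> upper_half_plane"
  proof
    fix \<zeta> :: complex assume "\<zeta> \<in> cball (3 * \<i>) (sqrt 8)"
    hence "\<bar>Im (3 * \<i> - \<zeta>)\<bar> \<le> sqrt 8" using abs_Im_le_cmod[of "3 * \<i> - \<zeta>"] by (simp add: dist_norm)
    moreover have "sqrt 8 < 3" by (rule real_less_lsqrt) auto
    ultimately show "\<zeta> \<in> upper_half_plane" by (simp add: upper_half_plane_def)
  qed
  have "compact C" unfolding C_def
  proof (rule compact_continuous_image)
    have "mob_act V holomorphic_on upper_half_plane" by (rule analytic_imp_holomorphic[OF mob_act_analytic[OF V(1)]])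
    thus "continuous_on (cball (3 * \<i>) (sqrt 8)) (mob_act V)"
      using holomorphic_on_imp_continuous_on continuous_on_subset ballU by blast
  qed auto
  moreover have "C \<subseteq> upper_half_plane" unfolding C_def using ballU mob_act_in_U[OF V(1)] by blast
  moreover have "\<exists>A\<in>\<Gamma>. mob_act A z \<in> C" if z: "z \<in> upper_half_plane" for z
  proof -
    obtain N where N: "0.9 ^ N * H z \<le> 6"
    proof -
      have pos: "\<bar>H z\<bar> + 1 > 0" by simp
      obtain N where "0.9 ^ N < 6 / (\<bar>H z\<bar> + 1)"
        using real_arch_pow_inv[of "6 / (\<bar>H z\<bar> + 1)" "0.9"] pos by auto
      hence "0.9 ^ N * (\<bar>H z\<bar> + 1) < 6" unfolding pos_less_divide_eq[OF pos] .
      moreover have "0.9 ^ N * H z \<le> 0.9 ^ N * (\<bar>H z\<bar> + 1)" by (intro mult_left_mono) auto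
      ultimately show ?thesis by (intro that[of N] less_imp_le) (rule le_less_trans)
    qed
    obtain A where A: "A \<in> \<Gamma>" "H (mob_act A z) \<le> 6" using iter[OF z, of N] N by force
    define \<zeta> where "\<zeta> = mob_act (madj V) (mob_act A z)"
    have AzU: "mob_act A z \<in> upper_half_plane" using mob_act_in_U[OF det_G[OF A(1)] z] .
    have "\<zeta> \<in> upper_half_plane" unfolding \<zeta>_def using mob_act_in_U[OF _ AzU, of "madj V"] V(1) by simp
    hence \<zeta>I: "Im \<zeta> > 0" by (simp add: upper_half_plane_def)
    have "(cmod \<zeta>)\<^sup>2 + 1 \<le> 6 * Im \<zeta>" using A(2) \<zeta>I by (simp add: H_def \<zeta>_def[symmetric] height_def divide_le_eq)
    moreover have "(cmod (3 * \<i> - \<zeta>))\<^sup>2 = (cmod \<zeta>)\<^sup>2 - 6 * Im \<zeta> + 9"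
      unfolding cmod_power2 by (simp add: power2_eq_square algebra_simps)
    ultimately have "(cmod (3 * \<i> - \<zeta>))\<^sup>2 \<le> 8" by linarith
    hence "\<zeta> \<in> cball (3 * \<i>) (sqrt 8)" by (simp add: dist_norm real_le_rsqrt)
    moreover have "mob_act V \<zeta> = mob_act A z"
      unfolding \<zeta>_def using mob_act_madj(2)[OF V(1)] AzU by (simp add: upper_half_plane_def)
    ultimately show ?thesis using A(1) unfolding C_def by (metis imageI)
  qed
  ultimately show ?thesis by blast
qed

lemma phi_eq_K:
  assumes "A \<in> \<Gamma>" "B \<in> \<Gamma>" "\<phi> A = \<phi> B" shows "madj B ** A \<in> K"
proof -
  have "\<phi> (madj B ** A) = \<phi> (madj B ** B)"
    using assms phi_mult madj_G by simp_all
  hence "\<phi> (madj B ** A) = psl_class one4"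
    using madj_mult[OF det_G[OF assms(2)]] phi_one by simp_all
  thus ?thesis unfolding K_iff using assms gen_mat.gmul madj_G by blast
qed

text \<open>The image of phi is finite, so K has finite index; the compact set is spread by the
  inverse of one group element for each value of phi.\<close>

lemma K_cocompact: "\<exists>C. compact C \<and> C \<subseteq> upper_half_plane \<and> (\<forall>z\<in>upper_half_plane. \<exists>k\<in>K. mob_act k z \<in> C)"
proof -
  obtain C where C: "compact C" "C \<subseteq> upper_half_plane" "\<And>z. z \<in> upper_half_plane \<Longrightarrow> \<exists>A\<in>\<Gamma>. mob_act A z \<in> C"
    using G_cocompact by blast
  define R where "R = inv_into \<Gamma> \<phi> ` (\<phi> ` \<Gamma>)"
  have "finite (\<phi> ` \<Gamma>)" unfolding phi_image by (rule finite_imageI) simp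
  hence finR: "finite R" by (simp add: R_def)
  have RG: "R \<subseteq> \<Gamma>"
  proof
    fix B assume "B \<in> R"
    then obtain c where "c \<in> \<phi> ` \<Gamma>" "B = inv_into \<Gamma> \<phi> c" by (auto simp: R_def)
    thus "B \<in> \<Gamma>" using inv_into_into by metis
  qed
  define C' where "C' = (\<Union>B\<in>R. mob_act (madj B) ` C)"
  have "compact (mob_act (madj B) ` C)" if "B \<in> R" for B
  proof (rule compact_continuous_image[OF _ C(1)])
    have "mob_act (madj B) holomorphic_on upper_half_plane"
      by (rule analytic_imp_holomorphic[OF mob_act_analytic]) (use det_G RG that in auto)
    thus "continuous_on C (mob_act (madj B))"
      using holomorphic_on_imp_continuous_on continuous_on_subset C(2) by blast
  qed
  hence "compact C'" unfolding C'_def using finR by (intro compact_UN) auto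
  moreover have "C' \<subseteq> upper_half_plane"
  proof
    fix w assume "w \<in> C'"
    then obtain B z where B: "B \<in> R" "z \<in> C" "w = mob_act (madj B) z" by (auto simp: C'_def)
    hence "mdet (madj B) = 1" using det_G[of B] RG by auto
    thus "w \<in> upper_half_plane" unfolding B(3) using mob_act_in_U B(2) C(2) by blast
  qed
  moreover have "\<exists>k\<in>K. mob_act k z \<in> C'" if z: "z \<in> upper_half_plane" for z
  proof -
    obtain A where A: "A \<in> \<Gamma>" "mob_act A z \<in> C" using C(3)[OF z] by blast
    define B where "B = inv_into \<Gamma> \<phi> (\<phi> A)"
    have B: "B \<in> R" "\<phi> B = \<phi> A" using A(1) by (auto simp: B_def R_def f_inv_into_f)
    hence "madj B ** A \<in> K" using phi_eq_K[OF A(1)] RG by auto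
    moreover have "mob_act (madj B ** A) z = mob_act (madj B) (mob_act A z)"
      using mob_act_mult[OF det_G[OF A(1)]] z by (simp add: upper_half_plane_def)
    ultimately show ?thesis using A(2) B(1) unfolding C'_def by (metis UN_I imageI)
  qed
  ultimately show ?thesis by blast
qed

end

section \<open>Fixed points of an involution\<close>

lemma det4_lin: "det4 (lin M u v) = u * u + u * v * tr4 M + v * v * det4 (M :: 'r::comm_ring_1 quad)"
  by (cases M) (simp add: algebra_simps)

fun adj4 :: "'r::comm_ring_1 quad \<Rightarrow> 'r quad" where "adj4 (a, b, c, d) = (d, - b, - c, a)"

lemma mul4_adj4: "mul4 (adj4 P) (mul4 P A) = lin A 0 (det4 P)"
  by (cases P; cases A) (simp add: algebra_simps)

lemma mul4_left_cancel: "det4 (P :: 'r::comm_ring_1 quad) = 1 \<Longrightarrow> mul4 P A = mul4 P B \<Longrightarrow> A = B"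
  using mul4_adj4[of P A] mul4_adj4[of P B] by (metis lin_0_1)

lemma mul4_one4 [simp]: "mul4 one4 A = (A :: 'r::comm_ring_1 quad)" "mul4 A one4 = A"
  by (cases A; simp)+

text \<open>N is a traceless matrix orthogonal to M under the trace form. As 5^2 = -1 modulo 13, the
  diagonal (5, -5) gives determinant 1, and one off-diagonal entry is solved for; a diagonal M is
  swapped with its negative by (0, 1, -1, 0).\<close>

lemma anticommuting_13:
  fixes M :: "13 quad"
  assumes "det4 M = 1" "tr4 M = 0"
  shows "\<exists>N. det4 N = 1 \<and> mul4 N M = neg4 (mul4 M N)"
proof -
  obtain a b c d where M: "M = (a, b, c, d)" by (cases M)
  have d: "d = - a" using assms(2) by (simp add: M add_eq_0_iff)
  consider "b \<noteq> 0" | "c \<noteq> 0" | "b = 0" "c = 0" by blast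
  thus ?thesis
  proof cases
    case 1
    then obtain v where v: "b * v = 1" using inverse_13 by blast
    have bv: "b * (v * u) = u" "v * (b * u) = u" for u using v by (metis mult.assoc mult.commute mult_1)+
    show ?thesis
      by (rule exI[of _ "(5, 0, - 10 * (a * v), - 5)"]) (simp add: M d algebra_simps bv)
  next
    case 2
    then obtain v where v: "c * v = 1" using inverse_13 by blast
    have bv: "c * (v * u) = u" "v * (c * u) = u" for u using v by (metis mult.assoc mult.commute mult_1)+
    show ?thesis
      by (rule exI[of _ "(5, - 10 * (a * v), 0, - 5)"]) (simp add: M d algebra_simps bv)
  next
    case 3
    show ?thesis by (rule exI[of _ "(0, 1, - 1, 0)"]) (simp add: M d 3)
  qed
qed

text \<open>u^2 + v^2 = 1 has 12 solutions modulo 13. Multiplication by M sends (u, v) to (-v, u),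
  with orbits of length 4, and (1, 0), (2, 6), (2, -6) represent the three orbits: 4 + 36 = 40 = 1.
  Indices 3 and 4 reuse the first two pairs behind the factor N.\<close>

definition cent_u :: "nat \<Rightarrow> 13" where "cent_u i = (if i = 0 \<or> i = 3 then 1 else 2)"
definition cent_v :: "nat \<Rightarrow> 13" where "cent_v i = (if i = 0 \<or> i = 3 then 0 else if i = 2 then - 6 else 6)"

text \<open>Coset representatives of the group generated by M inside its centralizer modulo signs, a dihedral
  group of order 12: the pairs (u, v) solve u^2 + v^2 = 1.\<close>
definition cent :: "13 quad \<Rightarrow> 13 quad \<Rightarrow> nat \<Rightarrow> 13 quad" where
  "cent M N i = mul4 (if i < 3 then one4 else N) (lin M (cent_u i) (cent_v i))"

lemma cuv: "cent_u i * cent_u i + cent_v i * cent_v i = 1"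
  by (simp add: cent_u_def cent_v_def)

context
  fixes M N :: "13 quad"
  assumes M: "det4 M = 1" "tr4 M = 0" "\<not> scalar4 M" and N: "det4 N = 1" "mul4 N M = neg4 (mul4 M N)"
begin

lemma det4_cent: "det4 (cent M N i) = 1"
  using M(1,2) N(1) cuv[of i] by (simp add: cent_def det4_mul4 det4_lin)

lemma lin_commutes: "mul4 (lin M u v) M = mul4 M (lin M u v)"
  using mul4_lin[OF M(1), of u v 0 1] mul4_lin[OF M(1), of 0 1 u v] by (simp add: algebra_simps)

lemma lin_M: "mul4 (lin M u v) M = lin M (- v) u"
  using mul4_lin[OF M(1), of u v 0 1] M(2) by simp

lemma cent_commutes: "mul4 (cent M N i) M = mul4 M (cent M N i) \<or> mul4 (cent M N i) M = neg4 (mul4 M (cent M N i))"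
proof (cases "i < 3")
  case True thus ?thesis using lin_commutes by (simp add: cent_def)
next
  case False
  have "mul4 (cent M N i) M = mul4 (mul4 N M) (lin M (cent_u i) (cent_v i))"
    using False by (simp add: cent_def mul4_assoc lin_commutes)
  thus ?thesis using False by (simp add: N(2) cent_def mul4_assoc)
qed

text \<open>N anticommutes with M, every u + v M commutes with it, and 2 is invertible.\<close>

lemma N_not_lin: "N \<noteq> lin M u v"
proof
  assume e: "N = lin M u v"
  hence "mul4 M N = neg4 (mul4 M N)" using N(2) lin_commutes by simp
  moreover have "Q = neg4 Q \<Longrightarrow> Q = (0, 0, 0, 0)" for Q :: "13 quad"
  proof (cases Q)
    case (fields a b c d)
    assume "Q = neg4 Q"
    hence "2 * a = 0" "2 * b = 0" "2 * c = 0" "2 * d = 0"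
      unfolding fields neg4.simps prod.inject by (metis add.right_inverse mult_2)+
    thus ?thesis using no_zero_div_13[of 2] unfolding fields by fastforce
  qed
  ultimately have "mul4 M N = (0, 0, 0, 0)" by blast
  hence "det4 (mul4 M N) = 0" by simp
  thus False using M(1) N(1) by (simp add: det4_mul4)
qed

lemma N_lin_not_lin: assumes "a * a + b * b = 1" shows "mul4 N (lin M a b) \<noteq> lin M u v"
proof
  assume e: "mul4 N (lin M a b) = lin M u v"
  have "mul4 N (mul4 (lin M a b) (lin M a (- b))) = mul4 (lin M u v) (lin M a (- b))"
    unfolding mul4_assoc[symmetric] e ..
  moreover have "mul4 (lin M a b) (lin M a (- b)) = one4"
    unfolding mul4_lin[OF M(1)] using M(2) assms by (simp add: lin_1_0 mult.commute)
  ultimately show False using N_not_lin mul4_lin[OF M(1)] by simp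
qed

text \<open>Behind the left factor, the four pairs describe C, -C, -CM or CM up to order, where C is
  the i-th representative.\<close>

lemma cent_coset_aux:
  assumes ij: "i < 5" "j < 5" "i \<noteq> j" and uv: "(u, v) \<in> {(cent_u i, cent_v i), (- cent_u i, - cent_v i), (- cent_v i, cent_u i), (cent_v i, - cent_u i)}"
  shows "cent M N j \<noteq> mul4 (if i < 3 then one4 else N) (lin M u v)"
proof
  assume e: "cent M N j = mul4 (if i < 3 then one4 else N) (lin M u v)"
  have n: "u * u + v * v = 1" using uv cuv[of i] by (auto simp: add.commute)
  show False
  proof (cases "(i < 3) = (j < 3)")
    case True
    have "lin M (cent_u j) (cent_v j) = lin M u v"
      by (rule mul4_left_cancel[of "if i < 3 then one4 else N"]) (use e True N(1) in \<open>auto simp: cent_def\<close>)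
    hence uv': "cent_u j = u" "cent_v j = v" using lin_unique_13[OF M(3)] by blast+
    have "i \<in> {0, 1, 2, 3, 4}" "j \<in> {0, 1, 2, 3, 4}" using ij by auto
    thus False using uv True ij(3) unfolding uv'[symmetric] by (auto simp: cent_u_def cent_v_def)
  next
    case False
    show ?thesis
    proof (cases "i < 3")
      case True
      thus False using e False N_lin_not_lin[OF cuv[of j]] by (simp add: cent_def)
    next
      case nt: False
      hence "lin M (cent_u j) (cent_v j) = mul4 N (lin M u v)" using e False by (simp add: cent_def)
      thus False using N_lin_not_lin[OF n] by metis
    qed
  qed
qed

lemma cent_coset:
  assumes ij: "i < 5" "j < 5" "i \<noteq> j"
  shows "cent M N j \<notin> {cent M N i, neg4 (cent M N i), mul4 (cent M N i) M, neg4 (mul4 (cent M N i) M)}"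
proof -
  let ?P = "if i < 3 then one4 else N"
  have c: "cent M N i = mul4 ?P (lin M (cent_u i) (cent_v i))" by (simp only: cent_def)
  have cn: "neg4 (cent M N i) = mul4 ?P (lin M (- cent_u i) (- cent_v i))" unfolding c mul4_neg4(2)[symmetric] neg4_lin ..
  have cM: "mul4 (cent M N i) M = mul4 ?P (lin M (- cent_v i) (cent_u i))" unfolding c mul4_assoc lin_M ..
  have cMn: "neg4 (mul4 (cent M N i) M) = mul4 ?P (lin M (cent_v i) (- cent_u i))" unfolding cM mul4_neg4(2)[symmetric] neg4_lin by simp
  show ?thesis unfolding cn cMn unfolding cM using cent_coset_aux[OF ij] c by auto
qed

end

section \<open>Inequivalent fixed points from the centralizer of an involution\<close>

context surj237
begin

lemma phi_uminus: "A \<in> \<Gamma> \<Longrightarrow> \<phi> (- A) = \<phi> A"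
proof -
  assume A: "A \<in> \<Gamma>"
  obtain N where N: "det4 N = 1" "\<phi> A = psl_class N" using phi_carrier[OF A] by blast
  have "\<phi> ((- mat 1) ** A) = psl_class (mul4 one4 N)" by (rule phi_mult_cl[OF minus_one_G A phi_minus_one N(2) _ N(1)]) simp
  thus ?thesis using N(2) by (simp add: minus_mat_mult)
qed

text \<open>T^2 lies in K and fixes z, so it is 1 or -1; T^2 = 1 would make T itself 1 or -1, with
  trivial image.\<close>

lemma involution_square:
  assumes T: "T \<in> \<Gamma>" "\<phi> T \<noteq> psl_class one4" "\<phi> (T ** T) = psl_class one4" "mob_act T z = z" "z \<in> upper_half_plane"
  shows "T ** T = - mat 1"
proof -
  have "T ** T \<in> K" using T gen_mat.gmul K_iff by blast
  moreover have "mob_act (T ** T) z = z"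
    using mob_act_mult[OF det_G[OF T(1)], of z T] T(4,5) by (simp add: upper_half_plane_def)
  ultimately consider "T ** T = mat 1" | "T ** T = - mat 1" using K_torsion_free T(5) by blast
  thus ?thesis
  proof cases
    case 1
    have "madj T = T" by (rule madj_unique[OF 1 det_G[OF T(1)]])
    hence "madj T $1$2 = T$1$2" "madj T $2$1 = T$2$1" "madj T $1$1 = T$1$1" by simp_all
    hence s: "T$1$2 = 0" "T$2$1 = 0" "T$2$2 = T$1$1" by simp_all
    hence "T$1$1 * T$1$1 = 1" using det_G[OF T(1)] by (simp add: mdet_def)
    hence "T$1$1 = 1 \<or> T$1$1 = -1" by (simp add: square_eq_1_iff)
    hence "T = mat 1 \<or> T = - mat 1" using s by (auto simp: mat_eq_22_iff)
    thus ?thesis using T(2) phi_one phi_minus_one by auto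
  qed
qed

text \<open>If the image of c commutes with that of T, then T c z and c T z = c z agree modulo K. If
  c i z and c j z were equivalent, \<open>stabilizer\<close> would place the images of c i and c j
  in the same coset of the group generated by M.\<close>

lemma inequivalent_fixed_points:
  assumes T: "T \<in> \<Gamma>" "\<phi> T \<noteq> psl_class one4" "\<phi> (T ** T) = psl_class one4" "mob_act T z = z" and z: "z \<in> upper_half_plane"
  obtains c where "c 0 = mat 1" "\<And>i. i < 5 \<Longrightarrow> c i \<in> \<Gamma>"
    "\<And>i j k. i < (5::nat) \<Longrightarrow> j < 5 \<Longrightarrow> i \<noteq> j \<Longrightarrow> k \<in> K \<Longrightarrow> mob_act (c i) z \<noteq> mob_act k (mob_act (c j) z)"
    "\<And>i. i < 5 \<Longrightarrow> \<exists>k\<in>K. mob_act T (mob_act (c i) z) = mob_act k (mob_act (c i) z)"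
proof -
  have T2: "T ** T = - mat 1" by (rule involution_square[OF T z])
  have zI: "Im z > 0" using z by (simp add: upper_half_plane_def)
  obtain M where M: "det4 M = 1" "\<phi> T = psl_class M" using phi_carrier[OF T(1)] by blast
  have Mns: "\<not> scalar4 M"
  proof
    assume "scalar4 M"
    hence "M = one4 \<or> M = neg4 one4" using scalar_det_13[OF _ M(1)] by blast
    thus False using M(2) T(2) psl_class_neg4[of one4] by metis
  qed
  have "psl_class one4 = psl_class (mul4 M M)" using T(3) phi_mult_cl[OF T(1) T(1) M(2) M(2) M(1) M(1)] by simp
  hence "one4 = mul4 M M \<or> one4 = neg4 (mul4 M M)" by (subst (asm) psl_class_eq_iff) auto
  moreover have MM: "mul4 M M = lin M (-1) (tr4 M)" using mul4_W_lin[OF M(1), of 0 1] by simp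
  ultimately have "lin M 1 0 = lin M (-1) (tr4 M) \<or> lin M 1 0 = lin M 1 (- tr4 M)"
    unfolding MM neg4_lin lin_1_0 by simp
  hence trM: "tr4 M = 0" using lin_unique_13[OF Mns] by fastforce
  obtain N where N: "det4 N = 1" "mul4 N M = neg4 (mul4 M N)" using anticommuting_13[OF M(1) trM] by blast
  note ctx = M(1) trM Mns N
  have "\<exists>A. A \<in> \<Gamma> \<and> \<phi> A = psl_class (cent M N i)" for i using phi_onto[OF det4_cent[OF ctx]] by blast
  then obtain c' where c': "\<And>i. c' i \<in> \<Gamma>" "\<And>i. \<phi> (c' i) = psl_class (cent M N i)" by metis
  define c where "c = c'(0 := mat 1)"
  have cent0: "cent M N 0 = one4" by (simp add: cent_def cent_u_def cent_v_def lin_1_0)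
  have c: "c i \<in> \<Gamma>" "\<phi> (c i) = psl_class (cent M N i)" for i
    using c' one_G phi_one cent0 by (auto simp: c_def)
  have act: "mob_act (A ** B) w = mob_act A (mob_act B w)" if "B \<in> \<Gamma>" "Im w > 0" for A B w
    using mob_act_mult[OF det_G[OF that(1)] that(2)] .
  have cU: "Im (mob_act (c i) z) > 0" for i
    using mob_act_in_U[OF det_G[OF c(1)] z] by (simp add: upper_half_plane_def)
  show ?thesis
  proof (rule that[of c])
    show "c 0 = mat 1" by (simp add: c_def)
    show "c i \<in> \<Gamma>" for i by (rule c(1))
    show "\<exists>k\<in>K. mob_act T (mob_act (c i) z) = mob_act k (mob_act (c i) z)" for i
    proof (rule bexI)
      have Tc: "T ** c i \<in> \<Gamma>" "c i ** T \<in> \<Gamma>" using gen_mat.gmul T(1) c(1) by blast+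
      have "\<phi> (T ** c i) = psl_class (mul4 M (cent M N i))" "\<phi> (c i ** T) = psl_class (mul4 (cent M N i) M)"
        using phi_mult_cl[OF T(1) c(1) M(2) c(2) M(1) det4_cent[OF ctx]] phi_mult_cl[OF c(1) T(1) c(2) M(2) det4_cent[OF ctx] M(1)] .
      hence ep: "\<phi> (T ** c i) = \<phi> (c i ** T)" using cent_commutes[OF ctx, of i] by auto
      have "\<phi> ((T ** c i) ** madj (c i ** T)) = \<phi> ((c i ** T) ** madj (c i ** T))"
        using Tc ep phi_mult madj_G by simp
      also have "\<dots> = psl_class one4" using madj_mult(2)[OF det_G[OF Tc(2)]] phi_one by simp
      finally have K': "(T ** c i) ** madj (c i ** T) \<in> K" unfolding K_iff using Tc gen_mat.gmul madj_G by blast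
      thus "(T ** c i) ** madj (c i ** T) \<in> K" .
      have e: "mob_act (c i) z = mob_act (c i ** T) z" using act[OF T(1) zI] T(4) by simp
      have "mob_act ((T ** c i) ** madj (c i ** T)) (mob_act (c i) z) = mob_act (T ** c i) (mob_act (madj (c i ** T)) (mob_act (c i) z))"
        using act[OF madj_G[OF Tc(2)] cU] .
      also have "mob_act (madj (c i ** T)) (mob_act (c i) z) = z"
        unfolding e by (rule mob_act_madj(1)[OF det_G[OF Tc(2)] zI])
      also have "mob_act (T ** c i) z = mob_act T (mob_act (c i) z)" by (rule act[OF c(1) zI])
      finally show "mob_act T (mob_act (c i) z) = mob_act ((T ** c i) ** madj (c i ** T)) (mob_act (c i) z)" ..
    qed
    show "mob_act (c i) z \<noteq> mob_act k (mob_act (c j) z)" if ij: "i < 5" "j < 5" "i \<noteq> j" and k: "k \<in> K" for i j k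
    proof
      assume e: "mob_act (c i) z = mob_act k (mob_act (c j) z)"
      have kG: "k \<in> \<Gamma>" "\<phi> k = psl_class one4" using k K_iff by auto
      define s where "s = madj (c i) ** (k ** c j)"
      have kc: "k ** c j \<in> \<Gamma>" using gen_mat.gmul kG(1) c(1) by blast
      have sG: "s \<in> \<Gamma>" unfolding s_def using gen_mat.gmul madj_G c(1) kc by blast
      have "mob_act s z = mob_act (madj (c i)) (mob_act (k ** c j) z)" unfolding s_def by (rule act[OF kc zI])
      also have "mob_act (k ** c j) z = mob_act (c i) z" using act[OF c(1) zI] e by simp
      also have "mob_act (madj (c i)) (mob_act (c i) z) = z" by (rule mob_act_madj(1)[OF det_G[OF c(1)] zI])
      finally have s: "s \<in> {mat 1, - mat 1, T, - T}" using stabilizer[OF T(1) T2 T(4) z sG] by blast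
      have cis: "c i ** s = k ** c j"
        unfolding s_def using madj_mult(2)[OF det_G[OF c(1)[of i]]] by (simp add: matrix_mul_assoc)
      have "\<phi> (k ** c j) = psl_class (cent M N j)"
        using phi_mult_cl[OF kG(1) c(1) kG(2) c(2) _ det4_cent[OF ctx]] by simp
      moreover have "\<phi> (c i ** s) = psl_class (cent M N i) \<or> \<phi> (c i ** s) = psl_class (mul4 (cent M N i) M)"
      proof -
        have cT: "\<phi> (c i ** T) = psl_class (mul4 (cent M N i) M)"
          by (rule phi_mult_cl[OF c(1) T(1) c(2) M(2) det4_cent[OF ctx] M(1)])
        have cTG: "c i ** T \<in> \<Gamma>" using gen_mat.gmul c(1) T(1) by blast
        show ?thesis using s cT c(2)[of i] phi_uminus[OF c(1)[of i]] phi_uminus[OF cTG] by (auto simp: minus_mat_mult)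
      qed
      ultimately have "psl_class (cent M N j) = psl_class (cent M N i) \<or> psl_class (cent M N j) = psl_class (mul4 (cent M N i) M)"
        using cis by simp
      hence "cent M N j \<in> {cent M N i, neg4 (cent M N i), mul4 (cent M N i) M, neg4 (mul4 (cent M N i) M)}"
        unfolding psl_class_eq_iff[OF det4_cent[OF ctx]] by blast
      thus False using cent_coset[OF ctx ij] by blast
    qed
  qed
qed

end

theorem theorem12:
  fixes x y :: "real^2^2" and \<phi> :: "real^2^2 \<Rightarrow> m13 set" and z :: complex
  assumes gens: "triangle_237_gens x y"
    and hom: "\<phi> \<in> hom (tri_group x y) PSL2_13"
    and onto: "\<phi> ` carrier (tri_group x y) = carrier PSL2_13"
    and minusI: "\<phi> (- mat 1) = \<one>\<^bsub>PSL2_13\<^esub>"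
    and zU: "z \<in> upper_half_plane"
    and edge: "\<exists>g\<in>carrier (tri_group x y).
                 \<phi> g \<noteq> \<one>\<^bsub>PSL2_13\<^esub> \<and> \<phi> g \<otimes>\<^bsub>PSL2_13\<^esub> \<phi> g = \<one>\<^bsub>PSL2_13\<^esub>
                 \<and> (\<exists>k\<in>kernel (tri_group x y) PSL2_13 \<phi>. mob_act k (mob_act g z) = z)"
  shows "weierstrass_point (kernel (tri_group x y) PSL2_13 \<phi>) z"
proof -
  interpret S: surj237 x y \<phi> using gens hom onto minusI by unfold_locales
  have zI: "Im z > 0" using zU by (simp add: upper_half_plane_def)
  obtain g k where g: "g \<in> gen_mat x y" "\<phi> g \<noteq> psl_class one4" "\<phi> g \<otimes>\<^bsub>PSL2_13\<^esub> \<phi> g = psl_class one4"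
    and k: "k \<in> S.K" "mob_act k (mob_act g z) = z"
    using edge by (auto simp: tri_group_def one_PSL)
  have kG: "k \<in> gen_mat x y" "\<phi> k = psl_class one4" using k(1) S.K_iff by auto
  \<comment> \<open>g fixes z only modulo K; k g fixes z itself and has the same image under
    phi.\<close>
  define T where "T = k ** g"
  have TG: "T \<in> gen_mat x y" unfolding T_def using gen_mat.gmul kG(1) g(1) by blast
  obtain N where N: "det4 N = 1" "\<phi> g = psl_class N" using S.phi_carrier[OF g(1)] by blast
  have phiT: "\<phi> T = \<phi> g" unfolding T_def using S.phi_mult_cl[OF kG(1) g(1) kG(2) N(2) _ N(1)] N(2) by simp
  have T: "\<phi> T \<noteq> psl_class one4" "\<phi> (T ** T) = psl_class one4" "mob_act T z = z"
    using g phiT S.phi_mult[OF TG TG] k(2) mob_act_mult[OF S.det_G[OF g(1)] zI, of k] by (simp_all add: T_def)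
  interpret F: fuchsian_involution S.K T z
  proof
    show "(\<lambda>k. 1 / norm k ^ 24) summable_on S.K"
      by (rule summable_on_subset_banach[OF S.summable_G]) (use S.K_iff in auto)
    show "T ** T = - mat 1" by (rule S.involution_square[OF TG T zU])
  qed (use S.K_iff S.det_G S.one_K S.minus_one_K S.K_mult S.K_madj S.K_torsion_free S.K_cocompact S.phi_conj TG T(3) zU in auto)
  obtain c where c: "c 0 = mat 1" "\<And>i. i < 5 \<Longrightarrow> c i \<in> gen_mat x y"
    "\<And>i j k. i < (5::nat) \<Longrightarrow> j < 5 \<Longrightarrow> i \<noteq> j \<Longrightarrow> k \<in> S.K \<Longrightarrow> mob_act (c i) z \<noteq> mob_act k (mob_act (c j) z)"
    "\<And>i. i < 5 \<Longrightarrow> \<exists>k\<in>S.K. mob_act T (mob_act (c i) z) = mob_act k (mob_act (c i) z)"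
    using S.inequivalent_fixed_points[OF TG T zU] by metis
  define w where "w = (\<lambda>i. mob_act (c i) z)"
  have neq: "\<not> F.eqv (w i) (w j)" if "i < 5" "j < 5" "i \<noteq> j" for i j
    using c(3)[OF that] by (auto simp: F.eqv_def w_def)
  \<comment> \<open>Index 0 is the point z itself; indices 1 to 4 give the four other fixed
    points.\<close>
  have w0: "w 0 = z" by (simp add: w_def c(1))
  have inj: "inj_on w {1..4}"
  proof (rule inj_onI, rule ccontr)
    fix i j :: nat assume "i \<in> {1..4}" "j \<in> {1..4}" "w i = w j" "i \<noteq> j"
    thus False using neq[of i j] F.eqv_refl[of "w j"] by simp
  qed
  show ?thesis
  proof (rule F.weierstrass_of_fixed_points[of "w ` {1..4}"])
    show "w ` {1..4} \<subseteq> upper_half_plane"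
      unfolding w_def using mob_act_in_U[OF S.det_G[OF c(2)] zU] by auto
    show "card (w ` {1..4}) = 4" using card_image[OF inj] by simp
    show "v = v'" if v: "v \<in> w ` {1..4}" "v' \<in> w ` {1..4}" "F.eqv v v'" for v v'
    proof -
      obtain i j where "i \<in> {1..4}" "j \<in> {1..4}" "v = w i" "v' = w j" using v(1,2) by blast
      thus ?thesis using neq[of i j] v(3) by (cases "i = j") auto
    qed
    show "\<not> F.eqv v z" if "v \<in> w ` {1..4}" for v
      using that neq[of _ 0] w0 by auto
    show "F.eqv (mob_act T v) v" if "v \<in> w ` {1..4}" for v
      using that c(4) by (auto simp: F.eqv_def w_def)
  qed
qed

end
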